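(* Let $q$ be a prime power with $q\equiv1\pmod 4$ such that $2$ is a square in $\mathbb F_q$, and let $\mathcal U_3,\mathcal X^+,\Delta^+,\Omega,\mathcal G_1,\mathcal G_2,\mathfrak H$ and the points "of Case (III)" be as in the context. Then the following are equivalent: (a) there exist an $\mathfrak H$-orbit $\mathcal M_1$ on $\mathcal G_1$ and an $\mathfrak H$-orbit $\mathcal M_2$ on $\mathcal G_2$ such that, with $\mathcal M=\mathcal M_1\cup\mathcal M_2$, every point $P$ of Case (III) satisfies Condition (B), i.e. the number of generators of $\mathcal M$ through $P$ equals $\frac12 n_P$; (b) the number $N_q$ of $\mathbb F_q$-rational points (including the point at infinity) of the elliptic curve $Y^2=X^3-X$ equals $q-1$ or $q+3$.
   Context: In $\mathrm{PG}(3,q^2)$ with coordinates $(X_0,X_1,X_2,X_3)$ (points as column vectors, matrices acting by $x\mapsto Ax$), $\mathcal U_3$ is $X_1^{q+1}+2X_2^{q+1}=X_3^qX_0+X_3X_0^q$; a generator is a line of $\mathrm{PG}(3,q^2)$ contained in $\mathcal U_3$. $\mathcal X^+$ is the non-singular model of the plane curve $y^qz-yz^q=x^{(q+1)/2}$ under $(x,y,z)\mapsto(z^2,xz,yz,y^2)$, a degree-$(q+1)$ $\mathbb F_{q^2}$-maximal curve on $\mathcal U_3$. $\pi$ is the plane $X_1=0$, $\Omega=\mathcal X^+\cap\pi=\{(1,0,y,y^2):y\in\mathbb F_q\}\cup\{(0,0,0,1)\}$, $\Delta^+=\mathcal X^+(\mathbb F_{q^2})\setminus\Omega$. $\mathcal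 G_1$ (resp. $\mathcal G_2$) is the set of generators meeting $\Delta^+$ (resp. $\Omega$). $\mathfrak G\le\mathrm{PGU}(4,q)$ is generated by the collineations with matrices $\mathbf T_\alpha=\begin{pmatrix}1&0&0&0\\0&1&0&0\\ \alpha&0&1&0\\ \alpha^2&0&2\alpha&1\end{pmatrix}$ ($\alpha\in\mathbb F_q$), $\mathbf M_\rho=\mathrm{diag}(\rho^{-1},1,1,\rho)$ ($\rho$ non-zero square in $\mathbb F_q$), $\mathbf L_\lambda=\mathrm{diag}(1,\lambda,1,1)$ ($\lambda^{(q+1)/2}=1$), $\mathbf N_\sigma=\begin{pmatrix}0&0&0&1\\0&\sigma&0&0\\0&0&1&0\\1&0&0&0\end{pmatrix}$ ($\sigma^{(q+1)/2}=-1$), $\mathbf R_\mu=\begin{pmatrix}0&0&0&\mu^{-1}\\0&1&0&0\\0&0&1&0\\ \mu&0&0&0\end{pmatrix}$ ($\mu$ non-square in $\mathbb F_q$); $\mathfrak H$ is the subgroup of $\mathfrak G$ generated by its elements of $p$-power order ($p$ the characteristic) and the $\mathbf L_\lambda$. Identify $\pi$ with $\mathrm{PG}(2,q^2)$ via $(X_0,X_2,X_3)$; let $\mathcal C$ be the conic $X_0X_3=X_2^2$. The projection of $P\ne(0,1,0,0)$ from $X_\infty=(0,1,0,0)$ onto $\pi$ is $P'=(x_0,x_2,x_3)$. A point $P\in\mathcal U_3$ with coordinates in $\mathbb F_{q^2}$ is of Case (III) if $P'\notin\mathrm{PG}(2,q)$ and $P'$ lies on a line of $\mathrm{PG}(2,q)$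 that is tangent to $\mathcal C$ at a point of $\Omega$. For such $P$ (which is not on $\mathcal X^+$), $n_P$ is the number of generators through $P$ containing a point of $\mathcal X^+(\mathbb F_{q^2})$. *)

theory Defs
  imports
    "HOL-Analysis.Analysis"
    "HOL-Algebra.Algebra"
    "HOL-Number_Theory.Prime_Powers"
begin

text \<open>
  Throughout, \<open>'a\<close> is a field with \<open>q\<^sup>2\<close> elements, and the homogeneous coordinates
  \<open>X\<^sub>0, X\<^sub>1, X\<^sub>2, X\<^sub>3\<close> are the components with index \<open>0, 1, 2, 3 :: 4\<close>.  A point is a
  one-dimensional subspace of \<open>'a ^ 4\<close>, and a line is the set of points on it.
\<close>

definition Fq :: "nat \<Rightarrow> 'a::{field,finite} set" where
  "Fq q = {x. x ^ q = x}"

definition squares_Fq :: "nat \<Rightarrow> 'a::{field,finite} set" where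
  "squares_Fq q = {s\<^sup>2 | s. s \<in> Fq q}"

definition vec4 :: "'b \<Rightarrow> 'b \<Rightarrow> 'b \<Rightarrow> 'b \<Rightarrow> 'b ^ 4" where
  "vec4 a b c d = (\<chi> i. if i = 0 then a else if i = 1 then b else if i = 2 then c else d)"

definition pt :: "'a::{field,finite} \<Rightarrow> 'a \<Rightarrow> 'a \<Rightarrow> 'a \<Rightarrow> ('a ^ 4) set" where
  "pt a b c d = vec.span {vec4 a b c d}"

definition PG3_points :: "('a::{field,finite} ^ 4) set set" where
  "PG3_points = {P. vec.subspace P \<and> vec.dim P = 1}"

definition PG3_lines :: "('a::{field,finite} ^ 4) set set set" where
  "PG3_lines = {{P \<in> PG3_points. P \<subseteq> W} | W. vec.subspace W \<and> vec.dim W = 2}"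

definition U3 :: "nat \<Rightarrow> ('a::{field,finite} ^ 4) set set" where
  "U3 q = {P \<in> PG3_points. \<forall>x\<in>P.
     (x $ 1) ^ (q + 1) + 2 * (x $ 2) ^ (q + 1) = (x $ 3) ^ q * (x $ 0) + (x $ 3) * (x $ 0) ^ q}"

definition generators :: "nat \<Rightarrow> ('a::{field,finite} ^ 4) set set set" where
  "generators q = {l \<in> PG3_lines. l \<subseteq> U3 q}"

text \<open>
  The \<open>\<F>\<^bsub>q\<^sup>2\<^esub>\<close>-rational points of \<open>\<X>\<^sup>+\<close>.  On the chart \<open>z = 1\<close> the plane curve is
  \<open>y\<^sup>q - y = x\<^bsup>(q+1)/2\<^esup>\<close> and the map \<open>(x,y,z) \<mapsto> (z\<^sup>2,xz,yz,y\<^sup>2)\<close> is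
  \<open>(x,y) \<mapsto> (1,x,y,y\<^sup>2)\<close>; the unique branch at infinity is sent to \<open>(0,0,0,1)\<close>.
\<close>

definition Xplus :: "nat \<Rightarrow> ('a::{field,finite} ^ 4) set set" where
  "Xplus q = {pt 1 x y (y\<^sup>2) | x y. y ^ q - y = x ^ ((q + 1) div 2)} \<union> {pt 0 0 0 1}"

definition pi_plane :: "('a::{field,finite} ^ 4) set set" where
  "pi_plane = {P \<in> PG3_points. \<forall>x\<in>P. x $ 1 = 0}"

definition Omega :: "nat \<Rightarrow> ('a::{field,finite} ^ 4) set set" where
  "Omega q = Xplus q \<inter> pi_plane"

definition Delta_plus :: "nat \<Rightarrow> ('a::{field,finite} ^ 4) set set" where
  "Delta_plus q = Xplus q - Omega q"

definition G1 :: "nat \<Rightarrow> ('a::{field,finite} ^ 4) set set set" where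
  "G1 q = {l \<in> generators q. l \<inter> Delta_plus q \<noteq> {}}"

definition G2 :: "nat \<Rightarrow> ('a::{field,finite} ^ 4) set set set" where
  "G2 q = {l \<in> generators q. l \<inter> Omega q \<noteq> {}}"

text \<open>
  Collineations are permutations of the points, i.e. elements of \<open>BijGroup PG3_points\<close>; a matrix
  and its non-zero scalar multiples induce the same one.
\<close>

definition collineation ::
    "'a::{field,finite} ^ 4 ^ 4 \<Rightarrow> ('a ^ 4) set \<Rightarrow> ('a ^ 4) set" where
  "collineation A = restrict (\<lambda>P. (*v) A ` P) PG3_points"

definition mat_T :: "'a::{field,finite} \<Rightarrow> 'a ^ 4 ^ 4" where
  "mat_T \<alpha> = vec4 (vec4 1      0 0       0)
                  (vec4 0      1 0       0)
                  (vec4 \<alpha>      0 1       0)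
                  (vec4 (\<alpha>\<^sup>2) 0 (2 * \<alpha>) 1)"

definition mat_M :: "'a::{field,finite} \<Rightarrow> 'a ^ 4 ^ 4" where
  "mat_M \<rho> = vec4 (vec4 (inverse \<rho>) 0 0 0)
                  (vec4 0           1 0 0)
                  (vec4 0           0 1 0)
                  (vec4 0           0 0 \<rho>)"

definition mat_L :: "'a::{field,finite} \<Rightarrow> 'a ^ 4 ^ 4" where
  "mat_L lam = vec4 (vec4 1 0   0 0)
                    (vec4 0 lam 0 0)
                    (vec4 0 0   1 0)
                    (vec4 0 0   0 1)"

definition mat_N :: "'a::{field,finite} \<Rightarrow> 'a ^ 4 ^ 4" where
  "mat_N \<sigma> = vec4 (vec4 0 0 0 1)
                  (vec4 0 \<sigma> 0 0)
                  (vec4 0 0 1 0)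
                  (vec4 1 0 0 0)"

definition mat_R :: "'a::{field,finite} \<Rightarrow> 'a ^ 4 ^ 4" where
  "mat_R \<mu> = vec4 (vec4 0 0 0 (inverse \<mu>))
                  (vec4 0 1 0 0)
                  (vec4 0 0 1 0)
                  (vec4 \<mu> 0 0 0)"

definition L_collineations :: "nat \<Rightarrow> (('a::{field,finite} ^ 4) set \<Rightarrow> ('a ^ 4) set) set" where
  "L_collineations q = {collineation (mat_L lam) | lam. lam ^ ((q + 1) div 2) = 1}"

definition group_G :: "nat \<Rightarrow> (('a::{field,finite} ^ 4) set \<Rightarrow> ('a ^ 4) set) set" where
  "group_G q = generate (BijGroup PG3_points)
     ({collineation (mat_T \<alpha>) | \<alpha>. \<alpha> \<in> Fq q}
      \<union> {collineation (mat_M \<rho>) | \<rho>. \<rho> \<in> squares_Fq q \<and> \<rho> \<noteq> 0}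
      \<union> L_collineations q
      \<union> {collineation (mat_N \<sigma>) | \<sigma>. \<sigma> ^ ((q + 1) div 2) = - 1}
      \<union> {collineation (mat_R \<mu>) | \<mu>. \<mu> \<in> Fq q \<and> \<mu> \<notin> squares_Fq q})"

definition group_H :: "nat \<Rightarrow> (('a::{field,finite} ^ 4) set \<Rightarrow> ('a ^ 4) set) set" where
  "group_H q = generate (BijGroup PG3_points)
     ({g \<in> group_G q. \<exists>k. group.ord (BijGroup PG3_points) g = CHAR('a) ^ k}
      \<union> L_collineations q)"

definition H_orbits ::
    "nat \<Rightarrow> ('a::{field,finite} ^ 4) set set set \<Rightarrow> ('a ^ 4) set set set set" where
  "H_orbits q E = orbits ((BijGroup PG3_points)\<lparr>carrier := group_H q\<rparr>) E (\<lambda>g l. g ` l)"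

text \<open>
  The plane \<open>PG(2,q\<^sup>2)\<close> with coordinates \<open>(X\<^sub>0,X\<^sub>2,X\<^sub>3)\<close> is kept inside \<open>PG(3,q\<^sup>2)\<close> as
  \<open>pi_plane\<close>.  Lines of the Baer subplane \<open>PG(2,q)\<close> are taken extended to \<open>PG(2,q\<^sup>2)\<close>, that is,
  they are the lines joining two distinct points of \<open>PG(2,q)\<close>.
\<close>

definition proj_pi :: "('a::{field,finite} ^ 4) set \<Rightarrow> ('a ^ 4) set" where
  "proj_pi P = (\<lambda>x. vec4 (x $ 0) 0 (x $ 2) (x $ 3)) ` P"

definition PG2q_points :: "nat \<Rightarrow> ('a::{field,finite} ^ 4) set set" where
  "PG2q_points q = {pt a 0 b c | a b c.
     a \<in> Fq q \<and> b \<in> Fq q \<and> c \<in> Fq q \<and> (a, b, c) \<noteq> (0, 0, 0)}"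

definition PG2q_lines :: "nat \<Rightarrow> ('a::{field,finite} ^ 4) set set set" where
  "PG2q_lines q = {l \<in> PG3_lines. \<exists>R\<in>PG2q_points q. \<exists>S\<in>PG2q_points q.
     R \<noteq> S \<and> R \<in> l \<and> S \<in> l}"

definition conic :: "('a::{field,finite} ^ 4) set set" where
  "conic = {P \<in> pi_plane. \<forall>x\<in>P. (x $ 0) * (x $ 3) = (x $ 2)\<^sup>2}"

definition tangent_at :: "('a::{field,finite} ^ 4) set set \<Rightarrow> ('a ^ 4) set \<Rightarrow> bool" where
  "tangent_at l R \<longleftrightarrow> l \<inter> conic = {R}"

definition case_III :: "nat \<Rightarrow> ('a::{field,finite} ^ 4) set \<Rightarrow> bool" where
  "case_III q P \<longleftrightarrow> P \<in> U3 q \<and> proj_pi P \<notin> PG2q_points q \<and>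
     (\<exists>l\<in>PG2q_lines q. proj_pi P \<in> l \<and> (\<exists>R\<in>Omega q. tangent_at l R))"

definition n_gen :: "nat \<Rightarrow> ('a::{field,finite} ^ 4) set \<Rightarrow> nat" where
  "n_gen q P = card {l \<in> generators q. P \<in> l \<and> l \<inter> Xplus q \<noteq> {}}"

definition condition_B ::
    "nat \<Rightarrow> ('a::{field,finite} ^ 4) set set set \<Rightarrow> ('a ^ 4) set \<Rightarrow> bool" where
  "condition_B q M P \<longleftrightarrow> real (card {l \<in> M. P \<in> l}) = 1 / 2 * real (n_gen q P)"

definition N_E :: "'a::{field,finite} itself \<Rightarrow> nat \<Rightarrow> nat" where
  "N_E _ q = card {(x, y). x \<in> (Fq q :: 'a set) \<and> y \<in> Fq q \<and> y\<^sup>2 = x ^ 3 - x} + 1"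

lemma vec4_nth [simp]:
  "vec4 a b c d $ 0 = a" "vec4 a b c d $ 1 = b" "vec4 a b c d $ 2 = c" "vec4 a b c d $ 3 = d"
  by (simp_all add: vec4_def)

lemma pt_eq: "pt a b c d = range (\<lambda>k. k *s vec4 a b c d)"
  by (simp add: pt_def vec.span_singleton)

lemma pt_in_PG3_points:
  assumes "(a, b, c, d) \<noteq> (0, 0, 0, 0)"
  shows "pt a b c d \<in> PG3_points"
proof -
  have "vec4 a b c d \<noteq> 0"
    using assms by (metis vec4_nth zero_index)
  then have "vec.independent {vec4 a b c d}"
    by (simp add: vec.independent_insert)
  then show ?thesis
    by (simp add: PG3_points_def pt_def vec.dim_eq_card_independent)
qed

lemma Omega_explicit:
  assumes "q > 0"
  shows "Omega q = {pt 1 0 y (y\<^sup>2) | y. y \<in> Fq q} \<union> {pt 0 0 0 1}"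
proof -
  have pi: "pt a b c d \<in> pi_plane \<longleftrightarrow> b = 0"
    if "(a, b, c, d) \<noteq> (0, 0, 0, 0)" for a b c d :: 'a
    using pt_in_PG3_points[OF that] by (auto simp: pi_plane_def pt_eq dest: spec[of _ 1])
  have "(0 :: 'a) ^ ((q + 1) div 2) = 0"
    by (rule zero_power) (use assms in simp)
  then have eq: "y ^ q - y = 0 ^ ((q + 1) div 2) \<longleftrightarrow> y \<in> Fq q" for y :: 'a
    by (simp only: Fq_def mem_Collect_eq right_minus_eq)
  have "P \<in> Omega q \<longleftrightarrow> (\<exists>y\<in>Fq q. P = pt 1 0 y (y\<^sup>2)) \<or> P = pt 0 0 0 1" for P :: "('a ^ 4) set"
    unfolding Omega_def Xplus_def using pi eq by fastforce
  then show ?thesis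
    by blast
qed

end

theory Submission
  imports Defs "HOL-Number_Theory.Residues"
begin

text \<open>
  Write \<open>x\<^sup>q\<close> as a conjugation \<open>cj\<close>, put \<open>h = (q + 1)/2\<close>, and let \<open>\<chi>\<close> be the quadratic character of
  \<open>\<F>\<^sub>q\<close> and \<open>\<eta>\<close> that of the field with \<open>q\<^sup>2\<close> elements.  Modulo scalars every
  generator of the group is the symmetric square of a matrix \<open>A\<close> over \<open>\<F>\<^sub>q\<close> on
  \<open>(X\<^sub>0, X\<^sub>2, X\<^sub>3)\<close> together with a factor \<open>k\<close> on \<open>X\<^sub>1\<close> such that \<open>k\<^sup>h = det A\<close>;
  the subgroup \<open>\<HH>\<close> is given by \<open>det A = 1\<close>.  A generator through \<open>(1, x, y, y\<^sup>2)\<close> is determined by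
  its point \<open>(0, e, 1, _)\<close> at infinity, and \<open>\<Phi> = e\<^sup>h \<eta>(y\<^sup>q - y - e\<^sup>q x)\<close> is multiplied by
  \<open>\<chi>(det A)\<close>, so its level sets are the \<open>\<HH>\<close>-orbits on the first family; on the second
  family \<open>e\<^sup>h\<close> plays this role.

  A point of Case (III) can be moved to \<open>(0, a, 1, r)\<close> with \<open>r \<notin> \<F>\<^sub>q\<close>.  The generators of the first
  family through it correspond to the solutions \<open>y\<close> of \<open>y\<^sup>q - y = a\<^sup>h (y - n)\<^sup>h\<close>, where
  \<open>n = r\<^sup>q/2\<close>, and exactly one generator of the second family passes through it.  Condition (B)
  becomes \<open>C = \<plusminus>1\<close> for \<open>C = \<Sum> \<eta>(y + y\<^sup>q - 2n)\<close>.  The solutions for \<open>a\<^sup>h\<close> and \<open>- a\<^sup>h\<close> form a conic,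
  the two halves of which are exchanged by \<open>y \<mapsto> 2 n\<^sup>q - y\<close>; hence \<open>2 C\<close> is the sum over the conic,
  which a parametrisation turns into \<open>\<Sum> \<chi>(X\<^sup>3 - X)\<close>, that is, \<open>N\<^sub>q - q - 1\<close>.
\<close>

subsection \<open>Finite fields of square order\<close>

text \<open>\<open>Phi\<close> has two factors because neither is invariant alone. A matrix of
  determinant D sends e to (k/D) e cj(v)/v with v = j W depending on the flag, and (cj(v)/v)^h =
  \<open>eta v\<close>; so e^h picks up this unwanted sign besides chi(D). The element cj(y) - y -
  cj(e) x is multiplied by D/(j cj(W)), so its \<open>eta\<close> picks up the same sign. The group
  \<open>group_H\<close> is never computed. Signs bound its orbits from above: an element of p-power
  order has odd order, so it is an even power of itself and preserves every label. Transvections,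
  which yield all matrices of determinant 1, bound them from below, together with an explicit matrix
  between two flags of equal label. Labels of nonempty classes are square roots of -2, so each
  family has at most two orbits and only the relative sign of the two labels matters. The character
  sum depends neither on a nor on r, so one point of Case (III) decides for all. That -1 and 2 are
  squares puts the labels into F_q; the transitivity argument then may replace cj(e)^h by
  e^h.\<close>

lemma card_roots_of_power_le:
  fixes w :: "'a::{field,finite}"
  assumes "l > 0"
  shows "card {x. x ^ l = w} \<le> l"
proof -
  let ?p = "Polynomial.monom 1 l - [:w:]"
  have "Polynomial.coeff ?p l = 1"
    using assms by (cases l) simp_all
  then have ne: "?p \<noteq> 0"
    by (metis Polynomial.coeff_0 zero_neq_one)
  have "Polynomial.degree ?p \<le> l"
    by (intro Polynomial.degree_diff_le) (simp_all add: Polynomial.degree_monom_le)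
  moreover have "{x. poly ?p x = 0} = {x. x ^ l = w}"
    by (auto simp: poly_monom)
  ultimately show ?thesis
    using card_poly_roots_bound[OF ne] by simp
qed

lemma finite_field_power_card_minus_1:
  fixes x :: "'a::{field,finite}"
  assumes "x \<noteq> 0"
  shows "x ^ (CARD('a) - 1) = 1"
proof -
  have "x ^ (CARD('a) - 1) * \<Prod>(UNIV - {0}) = (\<Prod>y\<in>UNIV - {0}. x * y)"
    by (simp add: prod.distrib)
  also have "\<dots> = \<Prod>(UNIV - {0})"
    by (rule prod.reindex_bij_witness[of _ "\<lambda>y. y / x" "\<lambda>y. x * y"]) (use assms in auto)
  finally show ?thesis
    by simp
qed

text \<open>Counting replaces the cyclicity of the multiplicative group. The fibres of x -> x^k have
  at most k elements, so the k*l nonzero elements yield at least l values; these lie among the roots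
  of w^l = 1, of which there are at most l.\<close>

lemma finite_field_kth_powers:
  assumes kl: "k * l = CARD('a::{field,finite}) - 1"
  shows "(\<lambda>x::'a. x ^ k) ` (UNIV - {0}) = {w. w ^ l = 1}"
    and "card {w::'a. w ^ l = 1} = l"
proof -
  let ?A = "UNIV - {0::'a}" and ?R = "{w::'a. w ^ l = 1}"
  let ?f = "\<lambda>x::'a. x ^ k"
  have cA: "card ?A = k * l"
    using kl by simp
  have "card {0,1::'a} \<le> CARD('a)"
    by (intro card_mono) auto
  then have "k * l > 0"
    using kl by simp
  then have pos: "k > 0" "l > 0"
    by auto
  have one: "x ^ (k * l) = 1" if "x \<noteq> 0" for x :: 'a
    using finite_field_power_card_minus_1[OF that] kl by simp
  have sub: "?f ` ?A \<subseteq> ?R"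
    by (auto simp: one simp flip: power_mult)
  have "card ?A \<le> card (\<Union>w\<in>?f ` ?A. {x. x ^ k = w})"
    by (intro card_mono) auto
  also have "\<dots> \<le> (\<Sum>w\<in>?f ` ?A. card {x. x ^ k = w})"
    by (intro card_UN_le) auto
  also have "\<dots> \<le> (\<Sum>w\<in>?f ` ?A. k)"
    by (intro sum_mono card_roots_of_power_le pos)
  finally have "k * l \<le> card (?f ` ?A) * k"
    using cA by simp
  then have ge: "l \<le> card (?f ` ?A)"
    using pos by simp
  moreover have le: "card ?R \<le> l"
    by (rule card_roots_of_power_le) (use pos in auto)
  moreover have "card (?f ` ?A) \<le> card ?R"
    by (intro card_mono sub) auto
  ultimately show "card ?R = l"
    by simp
  show "?f ` ?A = ?R"
    by (rule card_subset_eq) (use sub ge le \<open>card (?f ` ?A) \<le> card ?R\<close> in auto)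
qed

locale hermitian_field =
  fixes q :: nat and field_type :: "'a::{field,finite} itself"
  assumes primepow_q: "primepow q"
    and q_mod_4: "q mod 4 = 1"
    and card_field: "CARD('a) = q\<^sup>2"
    and two_square: "(2 :: 'a) \<in> squares_Fq q"
begin

definition cj :: "'a \<Rightarrow> 'a" where
  "cj x = x ^ q"

definition h :: nat where
  "h = (q + 1) div 2"

lemma h2: "2 * h = q + 1"
  unfolding h_def using q_mod_4 by presburger

lemma odd_h: "odd h"
  unfolding h_def using q_mod_4 by presburger

lemma q_ge_5: "q \<ge> 5"
proof -
  have "q \<noteq> 1"
    using primepow_q by (auto simp: primepow_def dest: prime_gt_1_nat)
  then show ?thesis using q_mod_4 by presburger
qed

lemma q_CHAR: "\<exists>k. q = CHAR('a) ^ k"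
proof -
  obtain p k where p: "Factorial_Ring.prime p" "k > 0" "q = p ^ k"
    using primepow_q by (auto simp: primepow_def)
  have "Factorial_Ring.prime CHAR('a)"
    by (intro prime_CHAR_semidom finite_imp_CHAR_pos) auto
  moreover have "CHAR('a) dvd p ^ (2 * k)"
    using CHAR_dvd_CARD[where 'a='a] card_field p by (simp add: power_mult mult.commute)
  ultimately have "CHAR('a) = p"
    using p(1) by (metis prime_dvd_power primes_dvd_imp_eq)
  then show ?thesis
    using p by blast
qed

lemma prime_CHAR: "Factorial_Ring.prime CHAR('a)"
  by (intro prime_CHAR_semidom finite_imp_CHAR_pos) auto

lemma odd_CHAR: "odd CHAR('a)"
proof
  assume "even CHAR('a)"
  moreover obtain k where k: "q = CHAR('a) ^ k"
    using q_CHAR by blast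
  moreover have "k \<noteq> 0"
    using k q_ge_5 by (intro notI) simp
  ultimately have "even q"
    by simp
  then show False
    using q_mod_4 by presburger
qed

lemma cj_add [simp]: "cj (x + y) = cj x + cj y"
  unfolding cj_def using q_CHAR freshmans_dream'[OF prime_CHAR] by metis

lemma cj_0 [simp]: "cj 0 = 0" and cj_1 [simp]: "cj 1 = 1"
  using q_ge_5 by (auto simp: cj_def)

lemma cj_mult [simp]: "cj (x * y) = cj x * cj y"
  by (simp add: cj_def power_mult_distrib)

lemma cj_power [simp]: "cj (x ^ k) = cj x ^ k"
  by (simp add: cj_def mult.commute flip: power_mult)

lemma cj_minus [simp]: "cj (- x) = - cj x"
  using cj_add[of x "- x"] by (simp add: eq_neg_iff_add_eq_0 add.commute)

lemma cj_diff [simp]: "cj (x - y) = cj x - cj y"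
  using cj_add[of x "- y"] by simp

lemma cj_inverse [simp]: "cj (inverse x) = inverse (cj x)"
  by (simp add: cj_def power_inverse)

lemma cj_divide [simp]: "cj (x / y) = cj x / cj y"
  by (simp add: cj_def power_divide)

lemma cj_cj [simp]: "cj (cj x) = x"
proof (cases "x = 0")
  case False
  have "cj (cj x) = x ^ q\<^sup>2"
    by (simp add: cj_def power2_eq_square flip: power_mult)
  also have "q\<^sup>2 = Suc (CARD('a) - 1)"
    using card_field zero_less_card_finite[where 'a='a] by simp
  finally show ?thesis
    unfolding power_Suc finite_field_power_card_minus_1[OF False] by simp
qed simp

lemma cj_of_nat: "cj (of_nat k) = of_nat k"
  by (induction k) auto

lemma cj_numeral [simp]: "cj (numeral k) = numeral k"
  using cj_of_nat[of "numeral k"] by simp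

lemma cj_eq_0_iff [simp]: "cj x = 0 \<longleftrightarrow> x = 0"
  using q_ge_5 by (simp add: cj_def)

lemma cj_eq_iff [simp]: "cj x = cj y \<longleftrightarrow> x = y"
  by (metis cj_cj)

lemma Fq_iff: "x \<in> Fq q \<longleftrightarrow> cj x = x"
  by (simp add: Fq_def cj_def)

lemma power_q1: "x ^ (q + 1) = x * cj x"
  by (simp add: cj_def)

lemma power_h_sq: "x ^ h * x ^ h = x * cj x"
  by (metis h2 mult_2 power_add power_q1)

lemma power_h_2: "(x ^ h)\<^sup>2 = x * cj x"
  by (simp add: power2_eq_square power_h_sq)

lemma h_pos: "h > 0"
  using odd_h by (cases h) auto

lemma neg1_h: "(- 1 :: 'a) ^ h = - 1"
  using odd_h by simp

lemma minus_power_h: "(- x :: 'a) ^ h = - (x ^ h)"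
  using odd_h by (simp add: power_minus_odd)

lemma two_neq_0 [simp]: "(2::'a) \<noteq> 0"
proof
  assume "(2::'a) = 0"
  then have "of_nat 2 = (0::'a)" by simp
  then have "CHAR('a) dvd 2"
    by (simp only: of_nat_eq_0_iff_char_dvd)
  then have "CHAR('a) = 2"
    using prime_CHAR by (metis primes_dvd_imp_eq two_is_prime_nat)
  then show False using odd_CHAR by simp
qed

lemma neg_eq_self_iff [simp]: "- x = (x::'a) \<longleftrightarrow> x = 0" "x = - x \<longleftrightarrow> x = 0"
  using two_neq_0 by (metis add.right_inverse mult_2 mult_eq_0_iff neg_0_equal_iff_equal)+

lemma four_neq_0 [simp]: "(4::'a) \<noteq> 0"
proof -
  have "(4::'a) = 2 * 2" by simp
  then show ?thesis using two_neq_0 by (metis mult_eq_0_iff)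
qed

lemma card_minus_1: "(q - 1) * (q + 1) = CARD('a) - 1"
  unfolding card_field by (simp add: power2_eq_square algebra_simps)

definition m :: nat where
  "m = (q - 1) div 2"

lemma m2: "2 * m = q - 1"
  unfolding m_def using q_mod_4 by presburger

lemma even_m: "even m"
  unfolding m_def using q_mod_4 by presburger

lemma h_m: "h = m + 1"
  using h2 m2 q_ge_5 by linarith

lemma m_pos: "m > 0"
  using m2 q_ge_5 by linarith

text \<open>Euler's criterion in the field of order q^2, phrased with the norm: the m-th power of
  the norm of w is w^((q^2-1)/2). Since m > 0, the assumption also excludes w = 0.\<close>

lemma ex_square_root:
  assumes "(w * cj w) ^ m = (1::'a)"
  shows "\<exists>x. x\<^sup>2 = w"
proof -
  have "2 * (m * (q + 1)) = CARD('a) - 1"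
    using m2 card_minus_1 by (simp flip: mult.assoc)
  note kp = finite_field_kth_powers(1)[OF this]
  have "w ^ (m * (q + 1)) = 1"
    unfolding mult.commute[of m] power_mult power_q1 using assms .
  then have "w \<in> (\<lambda>x. x\<^sup>2) ` (UNIV - {0})"
    unfolding kp by simp
  then show ?thesis by blast
qed

text \<open>The nonzero elements of F_q are the (q-1)-th roots of unity, hence the (q+1)-th
  powers.\<close>

lemma ex_norm:
  assumes "w \<in> Fq q" 
  shows "\<exists>x. x * cj x = (w::'a)"
proof (cases "w = 0")
  case False
  have "(q + 1) * (q - 1) = CARD('a) - 1"
    using card_minus_1 by (simp add: mult.commute)
  note kp = finite_field_kth_powers(1)[OF this]
  have "w * w ^ (q - 1) = w"
    using assms q_ge_5 by (simp add: Fq_def flip: power_Suc)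
  then have "w \<in> (\<lambda>x. x ^ (q + 1)) ` (UNIV - {0})"
    unfolding kp using False by simp
  then show ?thesis by (auto simp: cj_def)
qed auto

text \<open>A nonzero w with square in F_q satisfies w^(2(q-1)) = 1, and h * 2(q-1) = q^2 - 1. This
  supplies curve points above a given y, and elements e with prescribed e^h.\<close>

lemma ex_power_h:
  assumes "cj (w\<^sup>2) = (w::'a)\<^sup>2"
  shows "\<exists>x. x ^ h = w"
proof (cases "w = 0")
  case True
  then show ?thesis using h_pos by (intro exI[of _ 0]) simp
next
  case False
  have "h * (2 * (q - 1)) = CARD('a) - 1"
    unfolding card_minus_1[symmetric] h2[symmetric] by simp
  note kp = finite_field_kth_powers(1)[OF this]
  have "w\<^sup>2 * (w\<^sup>2) ^ (q - 1) = w\<^sup>2"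
    using assms q_ge_5 by (simp add: cj_def flip: power_Suc)
  then have "(w\<^sup>2) ^ (q - 1) = 1"
    using False by simp
  then have "w ^ (2 * (q - 1)) = 1"
    by (simp add: power_mult)
  then have "w \<in> (\<lambda>x. x ^ h) ` (UNIV - {0})"
    unfolding kp by simp
  then show ?thesis by auto
qed

lemma card_Fq: "card (Fq q :: 'a set) = q"
proof -
  have "(q + 1) * (q - 1) = CARD('a) - 1"
    using card_minus_1 by (simp add: mult.commute)
  note kp = finite_field_kth_powers(2)[OF this]
  have "x \<in> Fq q \<longleftrightarrow> x = 0 \<or> x ^ (q - 1) = 1" for x :: 'a
  proof -
    have "x ^ q = x * x ^ (q - 1)"
      using q_ge_5 by (simp flip: power_Suc)
    then show ?thesis by (auto simp: Fq_def)
  qed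
  then have "Fq q = insert (0::'a) {x. x ^ (q - 1) = 1}"
    by auto
  moreover have "(0::'a) \<notin> {x. x ^ (q - 1) = 1}"
    using q_ge_5 by (auto simp: power_0_left)
  ultimately show ?thesis
    using kp q_ge_5 by simp
qed

lemma Fq_closed [simp, intro]:
  "x \<in> Fq q \<Longrightarrow> y \<in> Fq q \<Longrightarrow> (x::'a) + y \<in> Fq q"
  "x \<in> Fq q \<Longrightarrow> y \<in> Fq q \<Longrightarrow> (x::'a) - y \<in> Fq q"
  "x \<in> Fq q \<Longrightarrow> y \<in> Fq q \<Longrightarrow> (x::'a) * y \<in> Fq q"
  "x \<in> Fq q \<Longrightarrow> y \<in> Fq q \<Longrightarrow> (x::'a) / y \<in> Fq q"
  "x \<in> Fq q \<Longrightarrow> - (x::'a) \<in> Fq q"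
  "x \<in> Fq q \<Longrightarrow> inverse (x::'a) \<in> Fq q"
  "x \<in> Fq q \<Longrightarrow> (x::'a) ^ k \<in> Fq q"
  "(0::'a) \<in> Fq q" "(1::'a) \<in> Fq q" "(numeral w :: 'a) \<in> Fq q"
  by (simp_all add: Fq_iff)

lemma norm_Fq [simp]: "x * cj x \<in> Fq q"
  by (simp add: Fq_iff mult.commute)

section \<open>The quadratic character of F_q, with integer values\<close>

definition chi :: "'a \<Rightarrow> int" where
  "chi x = (if x = 0 then 0 else if x ^ m = 1 then 1 else - 1)"

lemma Fq_power_m:
  assumes "x \<in> Fq q" "x \<noteq> (0::'a)"
  shows "x ^ m = 1 \<or> x ^ m = - 1"
proof -
  have "x * x ^ (q - 1) = x"
    using assms q_ge_5 by (simp add: Fq_def flip: power_Suc)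
  then have "(x ^ m)\<^sup>2 = 1"
    using assms m2 by (simp add: mult.commute flip: power_mult)
  then show ?thesis
    by (simp add: power2_eq_1_iff)
qed

lemma of_int_chi: "x \<in> Fq q \<Longrightarrow> of_int (chi x) = (x ^ m :: 'a)"
  using Fq_power_m[of x] m_pos by (auto simp: chi_def power_0_left)

text \<open>In odd characteristic -1, 0 and 1 stay distinct, so an identity between signs can be
  proved for powers in the field and read off in the integers.\<close>

lemma of_int_sign_inj:
  assumes "a \<in> {-1, 0, 1::int}" "b \<in> {-1, 0, 1}" "of_int a = (of_int b :: 'a)"
  shows "a = b"
  using assms by auto

lemma chi_cases: "chi x \<in> {-1, 0, 1}"
  by (auto simp: chi_def)

lemma chi_mult:
  assumes "x \<in> Fq q" "y \<in> Fq q"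
  shows "chi (x * y) = chi x * chi y"
proof (rule of_int_sign_inj)
  show "chi x * chi y \<in> {-1, 0, 1}"
    by (auto simp: chi_def)
  have "of_int (chi (x * y)) = (x * y) ^ m"
    using assms by (intro of_int_chi) auto
  then show "of_int (chi (x * y)) = (of_int (chi x * chi y) :: 'a)"
    using assms by (simp add: of_int_chi power_mult_distrib)
qed (rule chi_cases)

lemma chi_0 [simp]: "chi 0 = 0" and chi_1 [simp]: "chi 1 = 1"
  by (simp_all add: chi_def)

lemma chi_eq_0_iff [simp]: "chi x = 0 \<longleftrightarrow> x = 0"
  by (simp add: chi_def)

lemma chi_minus_1: "chi (- 1) = 1"
  using even_m by (simp add: chi_def)

lemma chi_minus: "x \<in> Fq q \<Longrightarrow> chi (- x) = chi x"
  using chi_mult[of "- 1" x] by (simp add: chi_minus_1)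

lemma chi_square: "x \<in> Fq q \<Longrightarrow> x \<noteq> 0 \<Longrightarrow> chi (x\<^sup>2) = 1"
  using chi_mult[of x x] chi_cases[of x] by (auto simp: power2_eq_square)

text \<open>To extract a root in F_q, write x as the norm of w. Then x^m = 1 makes w a square t^2 in
  the large field, and the norm of t is a square root of x.\<close>

lemma chi_eq_1_iff:
  assumes "x \<in> Fq q" "x \<noteq> 0"
  shows "chi x = 1 \<longleftrightarrow> (\<exists>s \<in> Fq q. s\<^sup>2 = x)"
proof
  assume "chi x = 1"
  then have "x ^ m = 1"
    using assms of_int_chi[of x] by simp
  moreover obtain w where w: "w * cj w = x"
    using ex_norm[OF assms(1)] by blast
  ultimately obtain t where t: "t\<^sup>2 = w"
    using ex_square_root[of w] by blast
  have "(t * cj t)\<^sup>2 = x"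
    using w t by (simp add: power_mult_distrib flip: cj_power)
  then show "\<exists>s \<in> Fq q. s\<^sup>2 = x"
    by (intro bexI[of _ "t * cj t"]) auto
next
  assume "\<exists>s \<in> Fq q. s\<^sup>2 = x"
  then show "chi x = 1"
    using assms(2) by (auto simp: chi_square)
qed

lemma chi_mult_square:
  "x \<in> Fq q \<Longrightarrow> s \<in> Fq q \<Longrightarrow> s \<noteq> 0 \<Longrightarrow> chi (s\<^sup>2 * x) = chi x"
  by (simp add: chi_mult chi_square)

lemma card_square_roots:
  assumes "x \<in> Fq q"
  shows "int (card {r \<in> Fq q. r\<^sup>2 = x}) = 1 + chi x"
proof (cases "x = 0")
  case True
  then have "{r \<in> Fq q. r\<^sup>2 = x} = {0}" by auto
  then show ?thesis using True by simp
next
  case False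
  show ?thesis
  proof (cases "chi x = 1")
    case True
    then obtain s where s: "s \<in> Fq q" "s\<^sup>2 = x"
      using chi_eq_1_iff[OF assms False] by blast
    then have "{r \<in> Fq q. r\<^sup>2 = x} = {s, - s}"
      by (auto simp: power2_eq_iff)
    moreover have "s \<noteq> - s"
      using s False by auto
    ultimately show ?thesis using True by simp
  next
    case F: False
    then have "{r \<in> Fq q. r\<^sup>2 = x} = {}"
      using chi_eq_1_iff[OF assms False] by auto
    moreover have "chi x = -1"
      using F False chi_cases[of x] by auto
    ultimately show ?thesis by simp
  qed
qed

lemma nonsquare_iff:
  assumes "d \<in> Fq q" "t\<^sup>2 = d" "t \<noteq> 0"
  shows "chi d = (if t \<in> Fq q then 1 else - 1)"
proof -
  have "d \<noteq> 0" using assms by auto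
  have "(\<exists>s \<in> Fq q. s\<^sup>2 = d) \<longleftrightarrow> t \<in> Fq q"
    using assms by (metis Fq_closed(5) minus_minus power2_eq_iff)
  then show ?thesis
    using chi_eq_1_iff[OF assms(1) \<open>d \<noteq> 0\<close>] chi_cases[of d] \<open>d \<noteq> 0\<close> by auto
qed

lemma ex_nonrational: "\<exists>y::'a. y \<notin> Fq q"
proof (rule ccontr)
  assume "\<nexists>y::'a. y \<notin> Fq q"
  then have "Fq q = (UNIV :: 'a set)" by auto
  then have "q = q\<^sup>2" using card_Fq card_field by simp
  then show False using q_ge_5 by (simp add: power2_eq_square)
qed

lemma ex_nonsquare: "\<exists>d \<in> Fq q. chi d = - 1"
proof -
  obtain y :: 'a where y: "y \<notin> Fq q" using ex_nonrational by blast
  \<comment> \<open>Conjugation negates this element: its square lies in F_q while the element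
    itself does not, so the square is a nonsquare of F_q.\<close>
  let ?t = "y - cj y"
  have "cj ?t = - ?t" by simp
  moreover have "?t \<noteq> 0" using y by (auto simp: Fq_iff)
  ultimately have "?t\<^sup>2 \<in> Fq q" "?t \<notin> Fq q"
    unfolding Fq_iff by (auto simp only: cj_power power2_minus neg_eq_self_iff)
  then show ?thesis
    using nonsquare_iff[of "?t\<^sup>2" ?t] \<open>?t \<noteq> 0\<close> by auto
qed

lemma sum_chi: "(\<Sum>x\<in>Fq q. chi x) = 0"
proof -
  obtain d where d: "d \<in> Fq q" "chi d = -1" using ex_nonsquare by blast
  then have d0: "d \<noteq> 0" by auto
  have "(\<Sum>x\<in>Fq q. chi x) = (\<Sum>x\<in>Fq q. chi (d * x))"
    by (rule sum.reindex_bij_witness[of _ "\<lambda>x. d * x" "\<lambda>x. x / d"]) (use d d0 in auto)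
  also have "\<dots> = - (\<Sum>x\<in>Fq q. chi x)"
    using d by (simp add: chi_mult sum_negf)
  finally show ?thesis by simp
qed

lemma sum_chi_quadratic:
  assumes "a \<in> Fq q" "b \<in> Fq q" "a \<noteq> b"
  shows "(\<Sum>x\<in>Fq q. chi ((x - a) * (x - b))) = - 1"
proof -
  define c where "c = a - b"
  have c: "c \<in> Fq q" "c \<noteq> 0" using assms by (auto simp: c_def)
  have "(\<Sum>x\<in>Fq q. chi ((x - a) * (x - b))) = (\<Sum>t\<in>Fq q. chi (t * (t + c)))"
    by (rule sum.reindex_bij_witness[of _ "\<lambda>t. t + a" "\<lambda>x. x - a"]) (use assms in \<open>auto simp: c_def\<close>)
  also have "\<dots> = (\<Sum>t\<in>Fq q - {0}. chi (t * (t + c)))"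
    by (intro sum.mono_neutral_right) auto
  \<comment> \<open>t (t + c) = t^2 (1 + c/t), and w = 1 + c/t takes every value except 1. The
    missing value is what leaves -1 of a full sum equal to 0.\<close>
  also have "\<dots> = (\<Sum>w\<in>Fq q - {1}. chi w)"
  proof (rule sum.reindex_bij_witness[of _ "\<lambda>w. c / (w - 1)" "\<lambda>t. 1 + c / t"])
    fix t :: 'a assume t: "t \<in> Fq q - {0}"
    have "t * (t + c) = t\<^sup>2 * (1 + c / t)"
      using t by (simp add: power2_eq_square field_simps)
    then show "chi (1 + c / t) = chi (t * (t + c))"
      using chi_mult_square[of "1 + c / t" t] t c by auto
  qed (use c in auto)
  also have "\<dots> = (\<Sum>w\<in>Fq q. chi w) - chi 1"
    by (subst sum_diff1) auto
  finally show ?thesis by (simp add: sum_chi)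
qed

end

subsection \<open>Character sums\<close>

declare left_diff_distrib_numeral [simp del] right_diff_distrib_numeral [simp del]
  distrib_left_numeral [simp del] distrib_right_numeral [simp del]

context hermitian_field
begin

text \<open>The m-th power of the norm of v is v^((q^2-1)/2), so composing \<open>chi\<close> with
  the norm gives the quadratic character of the large field.\<close>

definition eta :: "'a \<Rightarrow> int" where
  "eta v = chi (v * cj v)"

lemma eta_mult: "eta (v * w) = eta v * eta w"
proof -
  have "v * w * cj (v * w) = (v * cj v) * (w * cj w)"
    by simp
  then show ?thesis
    unfolding eta_def by (simp only: chi_mult norm_Fq)
qed

lemma eta_cj [simp]: "eta (cj v) = eta v"
  by (simp add: eta_def mult.commute)

lemma eta_minus [simp]: "eta (- v) = eta v"
  by (simp add: eta_def)

lemma eta_cases: "v \<noteq> 0 \<Longrightarrow> eta v = 1 \<or> eta v = - 1"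
  using chi_cases[of "v * cj v"] by (auto simp: eta_def)

lemma eta_Fq: "v \<in> Fq q \<Longrightarrow> v \<noteq> 0 \<Longrightarrow> eta v = 1"
  using chi_square[of v] by (simp add: eta_def Fq_iff power2_eq_square)

definition cubic_sum :: int where
  "cubic_sum = (\<Sum>x\<in>Fq q. chi (x ^ 3 - x))"

lemma N_E_eq: "int (N_E TYPE('a) q) = int q + 1 + cubic_sum"
proof -
  have "{(x, y). x \<in> (Fq q :: 'a set) \<and> y \<in> Fq q \<and> y\<^sup>2 = x ^ 3 - x}
      = Sigma (Fq q) (\<lambda>x. {y \<in> Fq q. y\<^sup>2 = x ^ 3 - x})"
    by auto
  then have "int (N_E TYPE('a) q) = (\<Sum>x\<in>(Fq q :: 'a set). int (card {y \<in> Fq q. y\<^sup>2 = x ^ 3 - x})) + 1"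
    by (simp add: N_E_def)
  also have "(\<Sum>x\<in>(Fq q :: 'a set). int (card {y \<in> Fq q. y\<^sup>2 = x ^ 3 - x}))
      = (\<Sum>x\<in>Fq q. 1 + chi (x ^ 3 - x))"
    by (intro sum.cong refl card_square_roots) auto
  also have "\<dots> = int q + cubic_sum"
    by (simp add: sum.distrib card_Fq cubic_sum_def)
  finally show ?thesis by simp
qed

text \<open>Summing over \<open>S\<close> a function of \<open>S\<^sup>2\<close> weights \<open>U = S\<^sup>2\<close> by \<open>1 + \<chi>(U)\<close>; the cubic
  \<open>U (U - 1) (U - 2)\<close> that appears is \<open>X\<^sup>3 - X\<close> at \<open>X = U - 1\<close>.\<close>

lemma sum_chi_quartic:
  "(\<Sum>S\<in>Fq q. chi ((2 - S\<^sup>2) * (S\<^sup>2 - 1))) = cubic_sum - 1"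
proof -
  let ?f = "\<lambda>U. chi ((2 - U) * (U - 1))"
  have "(\<Sum>S\<in>Fq q. ?f (S\<^sup>2)) = (\<Sum>U\<in>Fq q. \<Sum>S\<in>{S \<in> Fq q. S\<^sup>2 = U}. ?f (S\<^sup>2))"
    by (rule sum.group[symmetric]) auto
  also have "\<dots> = (\<Sum>U\<in>Fq q. int (card {S \<in> Fq q. S\<^sup>2 = U}) * ?f U)"
    by (intro sum.cong refl) simp
  also have "\<dots> = (\<Sum>U\<in>Fq q. (1 + chi U) * ?f U)"
    by (intro sum.cong refl) (simp add: card_square_roots)
  also have "\<dots> = (\<Sum>U\<in>Fq q. ?f U) + (\<Sum>U\<in>Fq q. chi U * ?f U)"
    by (simp add: algebra_simps sum.distrib)
  also have "(\<Sum>U\<in>Fq q. ?f U) = (\<Sum>U\<in>Fq q. chi ((U - 1) * (U - 2)))"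
  proof (intro sum.cong refl)
    fix U :: 'a assume U: "U \<in> Fq q"
    have "(2 - U) * (U - 1) = - ((U - 1) * (U - 2))" by (simp add: algebra_simps)
    then show "?f U = chi ((U - 1) * (U - 2))" using U by (simp add: chi_minus)
  qed
  also have "\<dots> = - 1"
  proof (rule sum_chi_quadratic)
    have "(2::'a) - 1 = 1" by simp
    then show "(1::'a) \<noteq> 2" by (metis diff_self zero_neq_one)
  qed auto
  also have "(\<Sum>U\<in>Fq q. chi U * ?f U) = cubic_sum"
    unfolding cubic_sum_def
  proof (rule sum.reindex_bij_witness[of _ "\<lambda>x. x + 1" "\<lambda>U. U - 1"])
    fix U :: 'a assume U: "U \<in> Fq q"
    have "(U - 1) ^ 3 - (U - 1) = - (U * ((2 - U) * (U - 1)))"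
      by (simp add: power3_eq_cube algebra_simps)
    then show "chi ((U - 1) ^ 3 - (U - 1)) = chi U * ?f U"
      using U by (simp add: chi_minus chi_mult)
  qed auto
  finally show ?thesis by simp
qed

text \<open>Squaring the equation of \<open>Yset e n\<close> below removes the h-th power when e^2 =
  -2, because (z^h)^2 is the norm of z. What remains is a conic in the two F_q-coordinates of
  y.\<close>

definition Yfull :: "'a \<Rightarrow> 'a set" where
  "Yfull n = {y. (cj y - y)\<^sup>2 = - 2 * (y - n) * (cj y - cj n)}"

text \<open>Write y = cj(n) + r + S del with r, S in F_q, where del has trace zero. The origin cj(n)
  is chosen so that the linear term in S cancels and the conic becomes r^2 = d (2 - S^2). The
  summand depends on S only and each S has 1 - chi(2 - S^2) values of r, which leaves a quartic sum
  and a quadratic sum; their contributions -1 and +1 cancel.\<close>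

lemma sum_eta_Yfull:
  assumes n: "n \<notin> Fq q"
  shows "(\<Sum>y\<in>Yfull n. eta (y + cj y - 2 * n)) = cubic_sum"
proof -
  define del where "del = (n - cj n) / 2"
  define d where "d = del\<^sup>2"
  have cdel: "cj del = - del" by (simp add: del_def minus_divide_left)
  have del0: "del \<noteq> 0" using n by (auto simp: del_def Fq_iff)
  have nn: "n = cj n + 2 * del" by (simp add: del_def del: right_diff_distrib_numeral)
  have dF: "d \<in> Fq q" by (simp add: d_def Fq_iff cdel)
  have d0: "d \<noteq> 0" using del0 by (simp add: d_def)
  have "del \<notin> Fq q" using cdel del0 by (simp add: Fq_iff)
  then have chid: "chi d = - 1"
    using nonsquare_iff[OF dF d_def[symmetric] del0] by simp
  let ?Z = "SIGMA S:Fq q. {r \<in> Fq q. r\<^sup>2 = d * (2 - S\<^sup>2)}"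
  let ?y = "\<lambda>(S, r). cj n + r + S * del"
  let ?SR = "\<lambda>y. ((y - cj y + n - cj n) / (2 * del), (y + cj y - n - cj n) / 2)"
  have dd: "del * del = d" by (simp add: d_def power2_eq_square)
  have key: "?y (S, r) \<in> Yfull n \<longleftrightarrow> r\<^sup>2 = d * (2 - S\<^sup>2)"
    if "S \<in> Fq q" "r \<in> Fq q" for S r
  proof -
    have c: "cj S = S" "cj r = r" using that by (simp_all add: Fq_iff)
    have 1: "cj (?y (S, r)) = n + r - S * del" by (simp add: c cdel)
    have "cj (?y (S, r)) - ?y (S, r) = 2 * (1 - S) * del"
      unfolding 1 by (subst nn) (simp add: algebra_simps)
    then have e1: "(cj (?y (S, r)) - ?y (S, r))\<^sup>2 = 4 * (1 - S)\<^sup>2 * d"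
      by (simp only: power_mult_distrib d_def) simp
    have "?y (S, r) - n = r + (S - 2) * del"
      by (subst nn) (simp add: algebra_simps)
    moreover have "cj (?y (S, r)) - cj n = r - (S - 2) * del"
      unfolding 1 by (subst nn) (simp add: algebra_simps)
    ultimately have "- 2 * (?y (S, r) - n) * (cj (?y (S, r)) - cj n) = - 2 * (r + (S - 2) * del) * (r - (S - 2) * del)"
      by (simp only:)
    also have "\<dots> = - 2 * (r\<^sup>2 - (S - 2)\<^sup>2 * d)"
      by (simp add: d_def power2_eq_square algebra_simps)
    finally have e2: "- 2 * (?y (S, r) - n) * (cj (?y (S, r)) - cj n) = - 2 * (r\<^sup>2 - (S - 2)\<^sup>2 * d)" .
    have "?y (S, r) \<in> Yfull n \<longleftrightarrow> 4 * (1 - S)\<^sup>2 * d = - 2 * (r\<^sup>2 - (S - 2)\<^sup>2 * d)"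
      unfolding Yfull_def mem_Collect_eq e1 e2 ..
    also have "\<dots> \<longleftrightarrow> 2 * r\<^sup>2 = 2 * (d * (2 - S\<^sup>2))"
    proof -
      have "4 * (1 - S)\<^sup>2 * d - (- 2 * (r\<^sup>2 - (S - 2)\<^sup>2 * d)) = 2 * r\<^sup>2 - 2 * (d * (2 - S\<^sup>2))"
        by (simp add: power2_eq_square algebra_simps)
      then show ?thesis by (metis eq_iff_diff_eq_0)
    qed
    finally show ?thesis by simp
  qed
  have inv1: "?SR y \<in> Fq q \<times> Fq q" "?y (?SR y) = y" for y
  proof -
    show "?SR y \<in> Fq q \<times> Fq q"
      by (auto simp: Fq_iff cdel add.commute field_simps del0)
    show "?y (?SR y) = y"
      using del0 by (simp add: field_simps)
  qed
  have inv2: "?SR (?y (S, r)) = (S, r)" if "S \<in> Fq q" "r \<in> Fq q" for S r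
  proof -
    have c: "cj S = S" "cj r = r" using that by (simp_all add: Fq_iff)
    have 1: "cj (?y (S, r)) = n + r - S * del" by (simp add: c cdel)
    have "?y (S, r) - cj (?y (S, r)) + n - cj n = S * (2 * del)"
      unfolding 1 by (simp add: algebra_simps)
    moreover have "?y (S, r) + cj (?y (S, r)) - n - cj n = r * 2"
      unfolding 1 by (simp add: algebra_simps)
    ultimately show ?thesis using del0 by (metis nonzero_mult_div_cancel_right mult_eq_0_iff two_neq_0)
  qed
  \<comment> \<open>The argument is 2 (r - del). Its norm is, up to a square, r^2 - d = d (1 - S^2)
    on the conic, and d is a nonsquare.\<close>
  have val: "eta (?y (S, r) + cj (?y (S, r)) - 2 * n) = - chi (S\<^sup>2 - 1)"
    if "S \<in> Fq q" "r \<in> Fq q" "r\<^sup>2 = d * (2 - S\<^sup>2)" for S r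
  proof -
    have c: "cj S = S" "cj r = r" using that by (simp_all add: Fq_iff)
    have 1: "cj (?y (S, r)) = n + r - S * del" by (simp add: c cdel)
    have "?y (S, r) + cj (?y (S, r)) - 2 * n = 2 * (r - del)"
    proof -
      have "2 * del = n - cj n" using nn by (metis add_diff_cancel_left')
      then show ?thesis unfolding 1 by (simp add: right_diff_distrib)
    qed
    moreover have "eta (2 * (r - del)) = eta (r - del)"
      by (simp add: eta_mult eta_Fq)
    moreover have "(r - del) * cj (r - del) = d * (- (S\<^sup>2 - 1))"
      using that(3) by (simp add: c cdel dd algebra_simps power2_eq_square)
    moreover have "chi (d * (- (S\<^sup>2 - 1))) = - chi (S\<^sup>2 - 1)"
      using that dF by (subst chi_mult) (auto simp: chid chi_minus simp del: minus_diff_eq)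
    ultimately show ?thesis by (simp add: eta_def)
  qed
  have "(\<Sum>y\<in>Yfull n. eta (y + cj y - 2 * n)) = (\<Sum>(S, r)\<in>?Z. - chi (S\<^sup>2 - 1))"
  proof (rule sum.reindex_bij_witness[of _ ?y ?SR])
    fix y assume y: "y \<in> Yfull n"
    show "?y (?SR y) = y" by (rule inv1)
    have "(?SR y) \<in> ?Z \<longleftrightarrow> ?y (?SR y) \<in> Yfull n"
      using key[of "fst (?SR y)" "snd (?SR y)"] inv1(1)[of y] by auto
    then show Z: "?SR y \<in> ?Z" using y inv1(2)[of y] by simp
    show "(case ?SR y of (S, r) \<Rightarrow> - chi (S\<^sup>2 - 1)) = eta (y + cj y - 2 * n)"
    proof -
      obtain S r where Sr: "?SR y = (S, r)" by (meson surj_pair)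
      then have "eta (?y (S, r) + cj (?y (S, r)) - 2 * n) = - chi (S\<^sup>2 - 1)"
        using Z by (intro val) auto
      moreover have "?y (S, r) = y" using inv1(2)[of y] unfolding Sr .
      ultimately show ?thesis unfolding Sr by (simp only: prod.case)
    qed
  next
    fix p assume "p \<in> ?Z"
    then obtain S r where p: "p = (S, r)" "S \<in> Fq q" "r \<in> Fq q" "r\<^sup>2 = d * (2 - S\<^sup>2)"
      by auto
    show "?SR (?y p) = p" using inv2[OF p(2,3)] p(1) by simp
    show "?y p \<in> Yfull n" using key[OF p(2,3)] p(1,4) by simp
  qed
  also have "\<dots> = (\<Sum>S\<in>Fq q. \<Sum>r\<in>{r \<in> Fq q. r\<^sup>2 = d * (2 - S\<^sup>2)}. - chi (S\<^sup>2 - 1))"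
    by (subst sum.Sigma) auto
  also have "\<dots> = (\<Sum>S\<in>Fq q. int (card {r \<in> Fq q. r\<^sup>2 = d * (2 - S\<^sup>2)}) * (- chi (S\<^sup>2 - 1)))"
    by simp
  also have "\<dots> = (\<Sum>S\<in>Fq q. chi ((2 - S\<^sup>2) * (S\<^sup>2 - 1)) - chi (S\<^sup>2 - 1))"
  proof (intro sum.cong refl)
    fix S :: 'a assume S: "S \<in> Fq q"
    have "int (card {r \<in> Fq q. r\<^sup>2 = d * (2 - S\<^sup>2)}) = 1 + chi (d * (2 - S\<^sup>2))"
      using S dF by (intro card_square_roots) auto
    also have "\<dots> = 1 - chi (2 - S\<^sup>2)"
      using S dF by (subst chi_mult) (auto simp: chid)
    finally have c: "int (card {r \<in> Fq q. r\<^sup>2 = d * (2 - S\<^sup>2)}) = 1 - chi (2 - S\<^sup>2)" .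
    have "chi ((2 - S\<^sup>2) * (S\<^sup>2 - 1)) = chi (2 - S\<^sup>2) * chi (S\<^sup>2 - 1)"
      using S by (intro chi_mult) auto
    then show "int (card {r \<in> Fq q. r\<^sup>2 = d * (2 - S\<^sup>2)}) * (- chi (S\<^sup>2 - 1))
        = chi ((2 - S\<^sup>2) * (S\<^sup>2 - 1)) - chi (S\<^sup>2 - 1)"
      unfolding c by (simp add: left_diff_distrib)
  qed
  also have "\<dots> = cubic_sum - 1 - (\<Sum>S\<in>Fq q. chi ((S - 1) * (S - (- 1))))"
  proof -
    have "(S - 1) * (S - (- 1)) = S\<^sup>2 - 1" for S :: 'a
      by (simp add: power2_eq_square algebra_simps)
    then show ?thesis by (simp only: sum_subtractf sum_chi_quartic)
  qed
  also have "(\<Sum>S\<in>Fq q. chi ((S - 1) * (S - (- 1)))) = - 1"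
    by (rule sum_chi_quadratic) auto
  finally show ?thesis by simp
qed

definition Yset :: "'a \<Rightarrow> 'a \<Rightarrow> 'a set" where
  "Yset e n = {y. cj y - y = e * (y - n) ^ h}"

text \<open>The involution \<open>y \<mapsto> 2 n\<^sup>q - y\<close> of the conic \<open>Yfull n\<close> exchanges the two sign classes,
  because \<open>(y - n) (2 n\<^sup>q - y - n) = (y\<^sup>q - n)\<^sup>2\<close> there.\<close>

lemma Yset_reflect:
  assumes e2: "e\<^sup>2 = - 2" and n: "n \<notin> Fq q" and y: "y \<in> Yset e n"
  shows "2 * cj n - y \<in> Yset (- e) n"
proof -
  have e0: "e \<noteq> 0" using e2 two_neq_0 by (metis neg_0_equal_iff_equal zero_power2)
  have yF: "(cj y - y)\<^sup>2 = - 2 * (y - n) * (cj y - cj n)"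
    using y e2 by (simp add: Yset_def power_mult_distrib power_h_2)
  have i0: "(cj y - n)\<^sup>2 - (y - n) * (2 * cj n - y - n)
     = (cj y - y)\<^sup>2 + 2 * (y - n) * (cj y - cj n)"
    by (simp add: power2_eq_square algebra_simps)
  then have i1: "(y - n) * (2 * cj n - y - n) = (cj y - n)\<^sup>2"
    using yF by simp
  \<comment> \<open>The second factor on the left is cj(y') - y' for the reflected point y' = 2
    cj(n) - y.\<close>
  have i2: "(cj y - y) * (2 * n - 2 * cj n - cj y + y) = 2 * (cj y - n) * (y - cj n)"
  proof -
    have "(cj y - y) * (2 * n - 2 * cj n - cj y + y) - 2 * (cj y - n) * (y - cj n)
      = - ((cj y - y)\<^sup>2 + 2 * (y - n) * (cj y - cj n))"
      by (simp add: power2_eq_square algebra_simps)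
    then show ?thesis using yF by simp
  qed
  have "y \<noteq> n"
    using y n h_pos by (auto simp: Yset_def Fq_iff power_0_left)
  then have yn: "(y - n) ^ h \<noteq> 0" by simp
  \<comment> \<open>The h-th power of \<open>i1\<close>: on the right it becomes a norm, the same
    one as in \<open>i2\<close>. Comparing the two gives the equation for the reflected point after
    division by e (y - n)^h.\<close>
  have "(y - n) ^ h * (2 * cj n - y - n) ^ h = ((cj y - n)\<^sup>2) ^ h"
    by (simp add: i1 flip: power_mult_distrib)
  also have "\<dots> = ((cj y - n) ^ h)\<^sup>2"
    by (simp add: mult.commute flip: power_mult)
  also have "\<dots> = (cj y - n) * (y - cj n)"
    by (simp add: power_h_2)
  finally have 3: "(y - n) ^ h * (2 * cj n - y - n) ^ h = (cj y - n) * (y - cj n)" .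
  have "e * (y - n) ^ h * (2 * n - 2 * cj n - cj y + y) = 2 * ((cj y - n) * (y - cj n))"
    using i2 y by (simp add: Yset_def mult.assoc)
  also have "\<dots> = - e * e * ((y - n) ^ h * (2 * cj n - y - n) ^ h)"
    using 3 e2 by (simp add: power2_eq_square flip: minus_mult_left)
  finally have "e * (y - n) ^ h * (2 * n - 2 * cj n - cj y + y) = e * (y - n) ^ h * (- e * (2 * cj n - y - n) ^ h)"
    by (simp add: algebra_simps)
  then have "2 * n - 2 * cj n - cj y + y = - e * (2 * cj n - y - n) ^ h"
    using e0 yn by (simp only: mult_cancel_left mult_eq_0_iff) simp
  then show ?thesis
    by (simp add: Yset_def algebra_simps)
qed

lemma sum_eta_Yset:
  assumes e2: "e\<^sup>2 = - 2" and n: "n \<notin> Fq q"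
  shows "2 * (\<Sum>y\<in>Yset e n. eta (y + cj y - 2 * n)) = cubic_sum"
proof -
  let ?f = "\<lambda>y. eta (y + cj y - 2 * n)"
  have me2: "(- e)\<^sup>2 = - 2" using e2 by simp
  have e0: "e \<noteq> 0" using e2 two_neq_0 by (metis neg_0_equal_iff_equal zero_power2)
  \<comment> \<open>The reflection turns the argument of \<open>eta\<close> into minus its
    conjugate, which has the same norm.\<close>
  have f: "?f (2 * cj n - y) = ?f y" for y
  proof -
    have "2 * cj n - y + cj (2 * cj n - y) - 2 * n = - cj (y + cj y - 2 * n)"
      by simp
    then show ?thesis by (simp only: eta_minus eta_cj)
  qed
  have "(\<Sum>y\<in>Yset e n. ?f y) = (\<Sum>y\<in>Yset (- e) n. ?f y)"
    by (rule sum.reindex_bij_witness[of _ "\<lambda>y. 2 * cj n - y" "\<lambda>y. 2 * cj n - y"])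
      (use Yset_reflect[OF e2 n] Yset_reflect[OF me2 n] f in auto)
  moreover have "Yfull n = Yset e n \<union> Yset (- e) n"
  proof -
    have "(e * (y - n) ^ h)\<^sup>2 = - 2 * (y - n) * (cj y - cj n)" for y
      by (simp add: power_mult_distrib e2 power_h_2)
    then have "y \<in> Yfull n \<longleftrightarrow> (cj y - y)\<^sup>2 = (e * (y - n) ^ h)\<^sup>2" for y
      by (simp add: Yfull_def)
    then show ?thesis
      by (auto simp: Yset_def power2_eq_iff)
  qed
  moreover have "Yset e n \<inter> Yset (- e) n = {}"
  proof -
    have "False" if "cj y - y = e * (y - n) ^ h" "cj y - y = - e * (y - n) ^ h" for y
    proof -
      have "e * (y - n) ^ h = - (e * (y - n) ^ h)"
        using that by simp
      then have "e * (y - n) ^ h = 0" by (simp only: neg_eq_self_iff)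
      then have "y = n" "cj y - y = 0" using e0 that(1) by (simp_all only: mult_eq_0_iff power_eq_0_iff right_minus_eq) auto
      then show False using n by (simp add: Fq_iff)
    qed
    then show ?thesis unfolding Yset_def by blast
  qed
  ultimately have "(\<Sum>y\<in>Yfull n. ?f y) = 2 * (\<Sum>y\<in>Yset e n. ?f y)"
    by (simp add: sum.union_disjoint)
  then show ?thesis using sum_eta_Yfull[OF n] by simp
qed

end

subsection \<open>Coordinates\<close>

lemma vec4_collapse: "vec4 (v $ 0) (v $ 1) (v $ 2) (v $ 3) = v"
proof -
  have "vec4 (v $ 0) (v $ 1) (v $ 2) (v $ 3) $ i = v $ i" for i :: 4
  proof -
    \<comment> \<open>\<open>exhaust_4\<close> lists the indices as 1, 2, 3, 4, while coordinates
      are numbered from 0 to 3.\<close>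
    have "(4 :: 4) = 0" by simp
    then show ?thesis using exhaust_4[of i] by (metis vec4_nth)
  qed
  then show ?thesis by (simp add: vec_eq_iff)
qed

lemma vec4_eq_iff [simp]:
  "vec4 a b c d = vec4 a' b' c' d' \<longleftrightarrow> a = a' \<and> b = b' \<and> c = c' \<and> d = d'"
  by (metis vec4_nth)

lemma vec4_eq_0_iff [simp]: "vec4 a b c d = 0 \<longleftrightarrow> a = 0 \<and> b = 0 \<and> c = 0 \<and> d = (0 :: 'b :: zero)"
  by (metis vec4_collapse vec4_eq_iff zero_index)

lemma vec4_add: "vec4 a b c d + vec4 a' b' c' d' = vec4 (a + a') (b + b') (c + c') (d + d')"
  and vec4_smult: "k *s vec4 a b c d = vec4 (k * a) (k * b) (k * c) (k * d)"
proof -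
  let ?u = "vec4 a b c d + vec4 a' b' c' d'" and ?v = "k *s vec4 a b c d"
  show "?u = vec4 (a + a') (b + b') (c + c') (d + d')"
    by (subst vec4_collapse[of ?u, symmetric]) simp
  show "?v = vec4 (k * a) (k * b) (k * c) (k * d)"
    by (subst vec4_collapse[of ?v, symmetric]) simp
qed

lemma vec4_cases: obtains a b c d where "v = vec4 a b c d"
  using vec4_collapse[of v] by metis

lemma matrix_vec4_mult:
  "vec4 r0 r1 r2 r3 *v vec4 x0 x1 x2 x3 =
     vec4 (r0 $ 0 * x0 + r0 $ 1 * x1 + r0 $ 2 * x2 + r0 $ 3 * x3)
          (r1 $ 0 * x0 + r1 $ 1 * x1 + r1 $ 2 * x2 + r1 $ 3 * x3)
          (r2 $ 0 * x0 + r2 $ 1 * x1 + r2 $ 2 * x2 + r2 $ 3 * x3)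
          (r3 $ 0 * x0 + r3 $ 1 * x1 + r3 $ 2 * x2 + r3 $ 3 * (x3 :: 'b :: comm_semiring_1))"
proof -
  let ?v = "vec4 r0 r1 r2 r3 *v vec4 x0 x1 x2 x3"
  have four: "(4 :: 4) = 0" by simp
  have "sum f (UNIV :: 4 set) = f 0 + f 1 + f 2 + f 3" for f :: "4 \<Rightarrow> 'b"
    unfolding sum_4 four by (simp add: ac_simps)
  then show ?thesis
    by (subst vec4_collapse[of ?v, symmetric]) (simp add: matrix_vector_mult_def)
qed

subsection \<open>Points and lines\<close>

definition indep2 :: "'a::{field,finite} ^ 4 \<Rightarrow> 'a ^ 4 \<Rightarrow> bool" where
  "indep2 v w \<longleftrightarrow> v \<noteq> 0 \<and> (\<forall>k. w \<noteq> k *s v)"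

definition Lin :: "'a::{field,finite} ^ 4 \<Rightarrow> 'a ^ 4 \<Rightarrow> ('a ^ 4) set set" where
  "Lin v w = {P \<in> PG3_points. P \<subseteq> vec.span {v, w}}"

lemma mem_span_1: "u \<in> vec.span {v} \<longleftrightarrow> (\<exists>k. u = k *s v)"
  by (auto simp: vec.span_singleton)

lemma mem_span_2: "u \<in> vec.span {v, w} \<longleftrightarrow> (\<exists>s t. u = s *s v + t *s w)"
proof -
  have "u \<in> vec.span {v, w} \<longleftrightarrow> (\<exists>s. u - s *s v \<in> vec.span {w})"
    by (rule vec.span_breakdown_eq)
  then show ?thesis by (simp add: mem_span_1 algebra_simps)
qed

lemma indep2_iff: "indep2 v w \<longleftrightarrow> v \<noteq> w \<and> vec.independent {w, v}"
proof -
  have "v \<noteq> w" if "indep2 v w" using that by (metis indep2_def vec.scale_one)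
  moreover have "vec.independent {w, v} \<longleftrightarrow> v \<noteq> 0 \<and> w \<notin> vec.span {v}" if "v \<noteq> w"
    using that by (auto simp: vec.independent_insert)
  ultimately show ?thesis by (auto simp: indep2_def mem_span_1)
qed

lemma indep2_dim: "indep2 v w \<Longrightarrow> vec.dim (vec.span {v, w}) = 2"
  using vec.dim_eq_card_independent[of "{w, v}"]
  by (auto simp: indep2_iff insert_commute vec.dim_span)

lemma point_span: "v \<noteq> 0 \<Longrightarrow> vec.span {v} \<in> PG3_points"
  by (simp add: PG3_points_def vec.dim_eq_card_independent vec.independent_insert)

lemma point_cases:
  assumes "P \<in> PG3_points"
  obtains v where "v \<noteq> 0" "P = vec.span {v}"
proof -
  have P: "vec.subspace P" "vec.dim P = 1" using assms by (auto simp: PG3_points_def)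
  obtain B where B: "B \<subseteq> P" "vec.independent B" "P \<subseteq> vec.span B" "card B = vec.dim P"
    using vec.basis_exists[of P] by metis
  then obtain v where v: "B = {v}" using P by (auto simp: card_1_singleton_iff)
  have "P = vec.span {v}" using B v P by (metis vec.span_minimal subset_antisym)
  moreover have "v \<noteq> 0" using B v by (metis insertI1 vec.dependent_zero)
  ultimately show ?thesis using that by blast
qed

lemma point_nonempty: "P \<in> PG3_points \<Longrightarrow> \<exists>v \<in> P. v \<noteq> 0"
  by (metis point_cases vec.span_base singletonI)

lemma span_eq_iff: "v \<noteq> 0 \<Longrightarrow> vec.span {v} = vec.span {w} \<longleftrightarrow> (\<exists>k. k \<noteq> 0 \<and> v = k *s w)"
proof
  assume "v \<noteq> 0" "vec.span {v} = vec.span {w}"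
  then have "v \<in> vec.span {w}" using vec.span_base by blast
  then show "\<exists>k. k \<noteq> 0 \<and> v = k *s w" using \<open>v \<noteq> 0\<close> by (metis mem_span_1 vec.scale_zero_left)
next
  assume "\<exists>k. k \<noteq> 0 \<and> v = k *s w"
  then show "vec.span {v} = vec.span {w}" 
    by (auto simp: mem_span_1 set_eq_iff) (metis vec.scale_scale divide_inverse nonzero_divide_eq_eq)
qed

lemma point_span_cancel: "k \<noteq> 0 \<Longrightarrow> vec.span {k *s v} = vec.span {v}"
  by (cases "v = 0") (auto simp: span_eq_iff)

lemma span_subset_iff: "vec.span {u} \<subseteq> vec.span S \<longleftrightarrow> u \<in> vec.span S"
  by (metis vec.span_base vec.span_minimal vec.subspace_span empty_subsetI insert_subset singletonI subsetD)

lemma span_in_Lin_iff: "u \<noteq> 0 \<Longrightarrow> vec.span {u} \<in> Lin v w \<longleftrightarrow> (\<exists>s t. u = s *s v + t *s w)"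
  by (simp add: Lin_def point_span span_subset_iff mem_span_2)

lemma indep2_span: "indep2 v w \<longleftrightarrow> v \<noteq> 0 \<and> w \<noteq> 0 \<and> vec.span {v} \<noteq> vec.span {w}"
  by (metis indep2_def span_eq_iff vec.scale_zero_left)

lemma Lin_in_lines: "indep2 v w \<Longrightarrow> Lin v w \<in> PG3_lines"
  unfolding PG3_lines_def Lin_def using indep2_dim vec.subspace_span by blast

lemma line_cases:
  assumes "l \<in> PG3_lines"
  obtains v w where "indep2 v w" "l = Lin v w"
proof -
  obtain W where W: "vec.subspace W" "vec.dim W = 2" "l = {P \<in> PG3_points. P \<subseteq> W}"
    using assms by (auto simp: PG3_lines_def)
  obtain B where B: "B \<subseteq> W" "vec.independent B" "W \<subseteq> vec.span B" "card B = vec.dim W"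
    using vec.basis_exists[of W] by metis
  then obtain v w where v: "B = {v, w}" "v \<noteq> w" using W by (auto simp: card_2_iff)
  have "W = vec.span {v, w}" using B v W by (metis vec.span_minimal subset_antisym)
  moreover have "indep2 v w" using B v by (simp add: indep2_iff insert_commute)
  ultimately show ?thesis using that W by (auto simp: Lin_def)
qed

lemma line_eq_Lin:
  assumes l: "l \<in> PG3_lines" and vw: "indep2 v w"
    and "vec.span {v} \<in> l" "vec.span {w} \<in> l"
  shows "l = Lin v w"
proof -
  obtain W where W: "vec.subspace W" "vec.dim W = 2" "l = {P \<in> PG3_points. P \<subseteq> W}"
    using l by (auto simp: PG3_lines_def)
  have "{v, w} \<subseteq> W" using assms W by (auto intro: vec.span_base)
  then have "vec.span {v, w} \<subseteq> W" using W vec.span_minimal by blast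
  then have "vec.span {v, w} = W"
    using W indep2_dim[OF vw] by (intro vec.subspace_dim_equal) auto
  then show ?thesis using W by (simp add: Lin_def)
qed

lemma span_in_Lin: "indep2 v w \<Longrightarrow> vec.span {v} \<in> Lin v w" "indep2 v w \<Longrightarrow> vec.span {w} \<in> Lin v w"
  by (auto simp: Lin_def indep2_span point_span intro!: vec.span_mono)

lemma Lin_eqI:
  assumes "indep2 v w" "indep2 v' w'" "v' = a *s v + b *s w" "w' = c *s v + d *s w"
  shows "Lin v w = Lin v' w'"
proof (rule line_eq_Lin)
  show "vec.span {v'} \<in> Lin v w"
    using assms by (subst span_in_Lin_iff) (auto simp: indep2_span)
  show "vec.span {w'} \<in> Lin v w"
    using assms by (subst span_in_Lin_iff) (auto simp: indep2_span)
qed (use assms Lin_in_lines in auto)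

lemma pt_span: "pt a b c d = vec.span {vec4 a b c d}"
  by (simp add: pt_def)

subsection \<open>Collineations\<close>

lemma collineation_span:
  "v \<noteq> 0 \<Longrightarrow> collineation A (vec.span {v}) = vec.span {A *v v}"
  unfolding collineation_def vec.span_singleton using point_span[of v]
  by (simp add: vec.span_singleton image_image vector_scalar_commute)

lemma invertible_mult_eq_0_iff:
  "invertible A \<Longrightarrow> A *v v = 0 \<longleftrightarrow> v = (0 :: 'a::field ^ 'n::finite)"
  by (metis invertible_def matrix_left_invertible_ker matrix_vector_mult_0_right)

lemma indep2_matrix: "invertible A \<Longrightarrow> indep2 v w \<Longrightarrow> indep2 (A *v v) (A *v w)"
proof -
  assume A: "invertible A" and vw: "indep2 v w"
  have "A *v w \<noteq> k *s (A *v v)" for k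
  proof
    assume "A *v w = k *s (A *v v)"
    then have "A *v (w - k *s v) = 0"
      by (simp add: matrix_vector_mult_diff_distrib vector_scalar_commute)
    then show False using A vw by (simp add: invertible_mult_eq_0_iff indep2_def)
  qed
  then show ?thesis using A vw by (simp add: invertible_mult_eq_0_iff indep2_def)
qed

lemma collineation_mult:
  assumes "invertible B"
  shows "compose PG3_points (collineation A) (collineation B) = collineation (A ** B)"
proof
  fix P :: "('a ^ 4) set"
  show "compose PG3_points (collineation A) (collineation B) P = collineation (A ** B) P"
  proof (cases "P \<in> PG3_points")
    case True
    then obtain v where v: "v \<noteq> 0" "P = vec.span {v}" by (rule point_cases)
    then have "B *v v \<noteq> 0" using assms by (simp add: invertible_mult_eq_0_iff)
    then show ?thesis using v True
      by (simp add: compose_def collineation_span matrix_vector_mul_assoc)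
  qed (simp add: compose_def collineation_def)
qed

lemma collineation_1: "collineation (mat 1) = (\<lambda>P\<in>PG3_points. P)"
  by (auto simp: collineation_def restrict_def)

lemma collineation_Bij:
  assumes "invertible A"
  shows "collineation A \<in> Bij PG3_points"
proof -
  obtain B where B: "A ** B = mat 1" "B ** A = mat 1" using assms by (auto simp: invertible_def)
  then have iB: "invertible B" by (auto simp: invertible_def)
  have maps: "collineation C P \<in> PG3_points" if "invertible C" "P \<in> PG3_points" for C :: "'a ^ 4 ^ 4" and P
    using that by (metis point_cases collineation_span point_span invertible_mult_eq_0_iff)
  have "compose PG3_points (collineation A) (collineation B) = (\<lambda>P\<in>PG3_points. P)"
    "compose PG3_points (collineation B) (collineation A) = (\<lambda>P\<in>PG3_points. P)"
    using assms iB B by (simp_all add: collineation_mult collineation_1)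
  then have "collineation A (collineation B P) = P" "collineation B (collineation A P) = P"
    if "P \<in> PG3_points" for P
    using that by (metis compose_eq restrict_apply')+
  then have "bij_betw (collineation A) PG3_points PG3_points"
    using maps assms iB by (intro bij_betw_byWitness[of _ "collineation B"]) auto
  then show ?thesis by (simp add: Bij_def collineation_def)
qed

lemma collineation_Lin:
  assumes "invertible A"
  shows "collineation A ` Lin v w = Lin (A *v v) (A *v w)"
proof (intro equalityI subsetI)
  fix P assume "P \<in> collineation A ` Lin v w"
  then obtain Q where Q: "Q \<in> Lin v w" "P = collineation A Q" by blast
  then obtain u where u: "u \<noteq> 0" "Q = vec.span {u}" by (auto simp: Lin_def elim: point_cases)
  obtain s t where "u = s *s v + t *s w" using Q u span_in_Lin_iff by blast
  then have "A *v u = s *s (A *v v) + t *s (A *v w)"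
    by (simp add: matrix_vector_right_distrib vector_scalar_commute)
  then show "P \<in> Lin (A *v v) (A *v w)"
    using Q(2) u assms span_in_Lin_iff[of "A *v u" "A *v v" "A *v w"] collineation_span[OF u(1), of A]
    by (metis invertible_mult_eq_0_iff)
next
  fix P assume P: "P \<in> Lin (A *v v) (A *v w)"
  then obtain u where u: "u \<noteq> 0" "P = vec.span {u}" by (auto simp: Lin_def elim: point_cases)
  obtain s t where st: "u = s *s (A *v v) + t *s (A *v w)" using P u span_in_Lin_iff by blast
  let ?u = "s *s v + t *s w"
  have *: "A *v ?u = u"
    using st by (simp add: matrix_vector_right_distrib vector_scalar_commute)
  then have "?u \<noteq> 0" using u by auto
  then have "vec.span {?u} \<in> Lin v w" by (auto simp: span_in_Lin_iff)
  moreover have "collineation A (vec.span {?u}) = P"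
    using \<open>?u \<noteq> 0\<close> u * by (simp add: collineation_span)
  ultimately show "P \<in> collineation A ` Lin v w" by blast
qed

lemma collineation_smult: "k \<noteq> 0 \<Longrightarrow> (\<And>v. A *v v = k *s (B *v v)) \<Longrightarrow> collineation A = collineation B"
proof
  fix P :: "('a ^ 4) set"
  assume k: "k \<noteq> 0" and AB: "\<And>v. A *v v = k *s (B *v v)"
  show "collineation A P = collineation B P"
  proof (cases "P \<in> PG3_points")
    case True
    then obtain v where v: "v \<noteq> 0" "P = vec.span {v}" by (rule point_cases)
    then show ?thesis by (simp add: collineation_span AB point_span_cancel k)
  qed (simp add: collineation_def)
qed

subsection \<open>The symmetric square of a 2x2 matrix\<close>

text \<open>The rows come from expanding (u^2, uv, v^2) under (u, v) -> (a u + b v, c u + d v).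
  Hence products of 2x2 matrices are respected and the conic is preserved.\<close>

definition mat_S :: "'a::{field,finite} \<Rightarrow> 'a \<Rightarrow> 'a \<Rightarrow> 'a \<Rightarrow> 'a \<Rightarrow> 'a ^ 4 ^ 4" where
  "mat_S a b c d k = vec4 (vec4 (a\<^sup>2) 0 (2 * a * b) (b\<^sup>2))
                          (vec4 0 k 0 0)
                          (vec4 (a * c) 0 (a * d + b * c) (b * d))
                          (vec4 (c\<^sup>2) 0 (2 * c * d) (d\<^sup>2))"

lemma mat_S_mult_vec:
  "mat_S a b c d k *v vec4 x0 x1 x2 x3 =
     vec4 (a\<^sup>2 * x0 + 2 * a * b * x2 + b\<^sup>2 * x3) (k * x1)
       (a * c * x0 + (a * d + b * c) * x2 + b * d * x3) (c\<^sup>2 * x0 + 2 * c * d * x2 + d\<^sup>2 * x3)"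
  by (simp add: mat_S_def matrix_vec4_mult)

lemma matrix_eq_vec4I:
  fixes A B :: "'a::{field,finite} ^ 4 ^ 4"
  assumes "\<And>x0 x1 x2 x3. A *v vec4 x0 x1 x2 x3 = B *v vec4 x0 x1 x2 x3"
  shows "A = B"
  unfolding matrix_eq using assms by (metis vec4_cases)

lemma mat_S_mult:
  "mat_S a b c d k ** mat_S a' b' c' d' k' =
     mat_S (a * a' + b * c') (a * b' + b * d') (c * a' + d * c') (c * b' + d * d') (k * k')"
  by (rule matrix_eq_vec4I)
    (simp add: matrix_vector_mul_assoc[symmetric] mat_S_mult_vec, simp add: power2_eq_square algebra_simps)

lemma mat_S_1: "mat_S 1 0 0 1 1 = mat 1"
  by (rule matrix_eq_vec4I) (simp add: mat_S_mult_vec)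

lemma mat_S_inverse:
  assumes "a * d - b * c = D" "D \<noteq> 0" "k \<noteq> 0"
  shows "mat_S a b c d k ** mat_S (d / D) (- b / D) (- c / D) (a / D) (1 / k) = mat 1"
    "mat_S (d / D) (- b / D) (- c / D) (a / D) (1 / k) ** mat_S a b c d k = mat 1"
proof -
  have "a * (d / D) + b * (- c / D) = 1" "c * (- b / D) + d * (a / D) = 1"
    "a * (- b / D) + b * (a / D) = 0" "c * (d / D) + d * (- c / D) = 0"
    "(d / D) * a + (- b / D) * c = 1" "(- c / D) * b + (a / D) * d = 1"
    "(d / D) * b + (- b / D) * d = 0" "(- c / D) * a + (a / D) * c = 0"
    using assms(1,2) by (auto simp: field_simps)
  then show "mat_S a b c d k ** mat_S (d / D) (- b / D) (- c / D) (a / D) (1 / k) = mat 1"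
    "mat_S (d / D) (- b / D) (- c / D) (a / D) (1 / k) ** mat_S a b c d k = mat 1"
    using assms(3) by (simp_all only: mat_S_mult flip: mat_S_1) simp_all
qed

lemma mat_S_invertible: "a * d - b * c \<noteq> 0 \<Longrightarrow> k \<noteq> 0 \<Longrightarrow> invertible (mat_S a b c d k)"
  using mat_S_inverse[OF refl] unfolding invertible_def by blast

lemma mat_T_eq: "mat_T \<alpha> = mat_S 1 0 \<alpha> 1 1"
  by (rule matrix_eq_vec4I) (simp add: mat_T_def matrix_vec4_mult mat_S_mult_vec)

lemma mat_M_eq: "s \<noteq> 0 \<Longrightarrow> mat_M (s\<^sup>2) = mat_S (inverse s) 0 0 s 1"
  by (rule matrix_eq_vec4I) (simp add: mat_M_def matrix_vec4_mult mat_S_mult_vec power_inverse)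

lemma mat_L_eq: "mat_L lam = mat_S 1 0 0 1 lam"
  by (rule matrix_eq_vec4I) (simp add: mat_L_def matrix_vec4_mult mat_S_mult_vec)

lemma mat_N_eq: "mat_N \<sigma> = mat_S 0 1 1 0 \<sigma>"
  by (rule matrix_eq_vec4I) (simp add: mat_N_def matrix_vec4_mult mat_S_mult_vec)

text \<open>As it stands, R would need an entry b with b^2 = 1/\<mu>, which F_q lacks for a
  nonsquare \<mu>. The factor \<mu> turns the corner entries into the squares 1 and \<mu>^2.\<close>

lemma mat_R_eq: "\<mu> \<noteq> 0 \<Longrightarrow> mat_S 0 1 \<mu> 0 \<mu> *v v = \<mu> *s (mat_R \<mu> *v v)"
  by (cases v rule: vec4_cases)
    (simp add: mat_R_def matrix_vec4_mult mat_S_mult_vec vec4_smult power2_eq_square)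

subsection \<open>Hermitian generators\<close>

text \<open>Here xb, yb, eb stand for conjugates. In the notation j, W, D of
  \<open>mat_S_line1\<close>, this factors the X1-coordinate of the point where an image generator
  meets X0 = 0, as e cj(j) cj(W) up to scalars; the next identity factors the X2-coordinate as D W.
  The third one governs the argument of \<open>eta\<close> in \<open>Phi\<close>.\<close>

lemma line1_first_identity:
  fixes a :: "'a::field"
  assumes "x * xb = (yb - y)\<^sup>2" "e * eb = - 2"
  shows "e * (a + b * y)\<^sup>2 - b * (2 * a + b * (2 * yb + e * xb)) * x
    = e * (a + b * yb) * (a - b * yb + 2 * b * y + b * eb * x)" (is "?l = ?r")
proof -
  have "?l - ?r = - b\<^sup>2 * e * (x * xb - (yb - y)\<^sup>2) - b * x * (a + b * yb) * (e * eb + 2)"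
    by (simp add: power2_eq_square algebra_simps)
  then show ?thesis using assms by simp
qed

lemma line1_second_identity:
  fixes a :: "'a::field"
  shows "(a * d + b * c + b * d * m) * (a + b * y) - b * (2 * a + b * m) * (c + d * y)
    = (a * d - b * c) * (a + b * m - b * y)"
  by (simp add: algebra_simps)

lemma line1_third_identity:
  fixes a :: "'a::field"
  assumes "x * xb = (yb - y)\<^sup>2" "e * eb = - 2"
  shows "(yb - y) * (a - b * yb + 2 * b * y + b * eb * x) - eb * x * (a - b * y + 2 * b * yb + b * e * xb)
    = (a + b * yb) * (yb - y - eb * x)" (is "?l = ?r")
proof -
  have "?l - ?r = 2 * b * (x * xb - (yb - y)\<^sup>2) - b * (e * eb + 2) * (x * xb)"
    by (simp add: power2_eq_square algebra_simps)
  then show ?thesis using assms by simp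
qed

context hermitian_field
begin

definition hf :: "'a ^ 4 \<Rightarrow> 'a ^ 4 \<Rightarrow> 'a" where
  "hf v w = v $ 1 * cj (w $ 1) + 2 * v $ 2 * cj (w $ 2) - v $ 0 * cj (w $ 3) - v $ 3 * cj (w $ 0)"

lemma hf_vec4: "hf (vec4 a b c d) (vec4 a' b' c' d') = b * cj b' + 2 * c * cj c' - a * cj d' - d * cj a'"
  by (simp add: hf_def)

lemma hf_swap: "hf w v = cj (hf v w)"
  by (simp add: hf_def mult.commute algebra_simps)

lemma hf_linear: "hf (s *s v + t *s v') w = s * hf v w + t * hf v' w"
  by (simp add: hf_def algebra_simps)

lemma hf_linear2: "hf w (s *s v + t *s v') = cj s * hf w v + cj t * hf w v'"
  by (simp add: hf_def algebra_simps)

lemma hf_smult: "hf (s *s v) w = s * hf v w" "hf w (s *s v) = cj s * hf w v"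
  using hf_linear[of s v 0 0 w] hf_linear2[of w s v 0 0] by simp_all

lemma U3_iff: "v \<noteq> 0 \<Longrightarrow> vec.span {v} \<in> U3 q \<longleftrightarrow> hf v v = 0"
proof -
  assume v: "v \<noteq> 0"
  have eq: "(x $ 1) ^ (q + 1) + 2 * (x $ 2) ^ (q + 1) = (x $ 3) ^ q * (x $ 0) + (x $ 3) * (x $ 0) ^ q \<longleftrightarrow> hf x x = 0"
    for x :: "'a ^ 4"
    unfolding power_q1 cj_def[symmetric] hf_def by (auto simp: algebra_simps)
  show ?thesis
    unfolding U3_def eq using v point_span[OF v]
    by (auto simp: mem_span_1 hf_smult intro: vec.span_base)
qed

lemma generators_Lin_iff:
  assumes "indep2 v w"
  shows "Lin v w \<in> generators q \<longleftrightarrow> hf v v = 0 \<and> hf v w = 0 \<and> hf w w = 0"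
proof
  assume "Lin v w \<in> generators q"
  then have sub: "Lin v w \<subseteq> U3 q" by (simp add: generators_def)
  have hz: "hf u u = 0" if "u = s *s v + t *s w" for u s t
  proof (cases "u = 0")
    case False
    then have "vec.span {u} \<in> Lin v w" using that by (auto simp: span_in_Lin_iff)
    then show ?thesis using sub False U3_iff by blast
  qed (simp add: hf_def)
  have vv: "hf v v = 0" using hz[of v 1 0] by simp
  have ww: "hf w w = 0" using hz[of w 0 1] by simp
  \<comment> \<open>With this coefficient both cross terms equal the norm of \<open>hf v w\<close>,
    so twice that norm vanishes.\<close>
  have "hf (1 *s v + hf v w *s w) (1 *s v + hf v w *s w) = 0" by (rule hz[OF refl])
  then have "2 * (hf v w * cj (hf v w)) = 0"
    using vv ww hf_swap[of v w] unfolding hf_linear hf_linear2 by (simp add: algebra_simps)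
  then have "hf v w = 0" by simp
  then show "hf v v = 0 \<and> hf v w = 0 \<and> hf w w = 0" using vv ww by simp
next
  assume *: "hf v v = 0 \<and> hf v w = 0 \<and> hf w w = 0"
  then have wv: "hf w v = 0" using hf_swap[of v w] by simp
  have "P \<in> U3 q" if Pl: "P \<in> Lin v w" for P
  proof -
    obtain u where u: "u \<noteq> 0" "P = vec.span {u}" using Pl by (auto simp: Lin_def elim: point_cases)
    then obtain s t where "u = s *s v + t *s w" using Pl span_in_Lin_iff by blast
    then have "hf u u = 0" using * wv by (simp add: hf_linear hf_linear2)
    then show ?thesis using u U3_iff by blast
  qed
  then show "Lin v w \<in> generators q" using Lin_in_lines[OF assms] by (auto simp: generators_def)
qed

lemma generator_hf:
  assumes "l \<in> generators q" "vec.span {v} \<in> l" "vec.span {w} \<in> l" "v \<noteq> 0" "w \<noteq> 0"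
  shows "hf v w = 0"
proof (cases "indep2 v w")
  case True
  then have "l = Lin v w" using assms line_eq_Lin by (auto simp: generators_def)
  then show ?thesis using generators_Lin_iff[OF True] assms by simp
next
  case False
  then obtain k where "w = k *s v" using assms by (auto simp: indep2_def)
  moreover have "hf v v = 0" using assms U3_iff by (auto simp: generators_def)
  ultimately show ?thesis by (simp add: hf_smult)
qed

section \<open>Generators through the affine points of the curve\<close>

definition Av :: "'a \<Rightarrow> 'a \<Rightarrow> 'a ^ 4" where
  "Av x y = vec4 1 x y (y\<^sup>2)"

text \<open>The point of a generator in the plane X0 = 0, scaled to X2 = 1. Orthogonality to
  \<open>Av x y\<close> forces the last coordinate, and the point is isotropic exactly when e has
  norm -2.\<close>

definition Pv :: "'a \<Rightarrow> 'a \<Rightarrow> 'a \<Rightarrow> 'a ^ 4" where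
  "Pv x y e = vec4 0 e 1 (2 * cj y + e * cj x)"

definition curve :: "'a \<Rightarrow> 'a \<Rightarrow> bool" where
  "curve x y \<longleftrightarrow> cj y - y = x ^ h"

definition line1 :: "'a \<Rightarrow> 'a \<Rightarrow> 'a \<Rightarrow> ('a ^ 4) set set" where
  "line1 x y e = Lin (Av x y) (Pv x y e)"

lemma curve_norm: "curve x y \<Longrightarrow> x * cj x = (cj y - y)\<^sup>2"
  by (simp add: curve_def power_h_2)

lemma Av_neq_0 [simp]: "Av x y \<noteq> 0" by (simp add: Av_def)

lemma indep2_Av: "(e, f, g) \<noteq> (0, 0, 0) \<Longrightarrow> indep2 (Av x y) (vec4 0 e f g)"
  by (auto simp: indep2_def Av_def vec4_smult)

lemma indep2_line1: "indep2 (Av x y) (Pv x y e)"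
  unfolding Pv_def by (rule indep2_Av) simp

lemma hf_Av_Av: "hf (Av x y) (Av x' y') = x * cj x' - (y - cj y')\<^sup>2"
  by (simp add: Av_def hf_vec4 power2_eq_square algebra_simps)

lemma hf_Av: "hf (Av x y) (vec4 0 e f g) = x * cj e + 2 * y * cj f - cj g"
  by (simp add: Av_def hf_vec4)

lemma line1_generator:
  assumes "curve x y" "e * cj e = - 2"
  shows "line1 x y e \<in> generators q"
proof -
  have "hf (Av x y) (Av x y) = 0"
    using curve_norm[OF assms(1)] by (simp add: hf_Av_Av power2_commute)
  moreover have "hf (Av x y) (Pv x y e) = 0"
    unfolding Pv_def hf_Av by (simp add: mult.commute)
  moreover have "hf (Pv x y e) (Pv x y e) = 0"
    using assms by (simp add: Pv_def hf_vec4)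
  ultimately show ?thesis
    unfolding line1_def generators_Lin_iff[OF indep2_line1] by simp
qed

lemma generator_eq_line1:
  assumes l: "l \<in> generators q" and A: "vec.span {Av x y} \<in> l"
    and w: "vec.span {vec4 0 e f g} \<in> l" "(e, f, g) \<noteq> (0, 0, 0)"
  shows "f \<noteq> 0" "(e / f) * cj (e / f) = - 2" "l = line1 x y (e / f)" "g / f = 2 * cj y + (e / f) * cj x"
proof -
  let ?w = "vec4 0 e f g"
  have w0: "?w \<noteq> 0" using w(2) by simp
  have i: "indep2 (Av x y) ?w" using w(2) by (rule indep2_Av)
  have "l \<in> PG3_lines" using l by (simp add: generators_def)
  then have lL: "l = Lin (Av x y) ?w" using i A w(1) by (rule line_eq_Lin)
  have "hf ?w ?w = 0" "hf (Av x y) ?w = 0"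
    using generator_hf[OF l] A w(1) w0 by auto
  then have ee: "e * cj e = - 2 * (f * cj f)" and g: "cj g = x * cj e + 2 * y * cj f"
    by (simp_all add: hf_vec4 hf_Av eq_neg_iff_add_eq_0 mult.assoc)
  have g': "g = cj x * e + 2 * cj y * f"
    using arg_cong[OF g, of cj] by simp
  show f: "f \<noteq> 0"
  proof
    assume "f = 0"
    then have "e = 0" "g = 0" using ee g' by auto
    then show False using w(2) \<open>f = 0\<close> by simp
  qed
  show "(e / f) * cj (e / f) = - 2" using ee f by (simp add: field_simps)
  show gf: "g / f = 2 * cj y + (e / f) * cj x" using g' f by (simp add: field_simps)
  have "?w = f *s Pv x y (e / f)"
    using f gf by (simp add: Pv_def vec4_smult field_simps)
  then show "l = line1 x y (e / f)"
    unfolding lL line1_def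
    using i indep2_line1 f by (intro Lin_eqI[where a=1 and b=0 and c=0 and d="1/f"]) (simp_all add: vec.scale_scale)
qed

lemma generator_line1_ex:
  assumes l: "l \<in> generators q" and A: "vec.span {Av x y} \<in> l"
  obtains e where "e * cj e = - 2" "l = line1 x y e"
proof -
  obtain v w where vw: "indep2 v w" "l = Lin v w"
    using l line_cases by (auto simp: generators_def)
  have "\<exists>w. indep2 (Av x y) w \<and> vec.span {w} \<in> l"
    using vw span_in_Lin[OF vw(1)] by (metis indep2_span Av_neq_0)
  then obtain w where w: "indep2 (Av x y) w" "vec.span {w} \<in> l" by blast
  have lL: "l = Lin (Av x y) w"
    using l w A line_eq_Lin by (auto simp: generators_def)
  \<comment> \<open>The intersection of the line with the plane X0 = 0.\<close>
  define u where "u = (- (w $ 0)) *s Av x y + 1 *s w"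
  have "u \<noteq> 0"
    using w(1) by (auto simp: u_def indep2_def add_eq_0_iff)
  moreover have "u $ 0 = 0" by (simp add: u_def Av_def)
  moreover have "vec.span {u} \<in> l"
    unfolding lL using span_in_Lin_iff[OF \<open>u \<noteq> 0\<close>] u_def by blast
  ultimately have *: "vec.span {vec4 0 (u $ 1) (u $ 2) (u $ 3)} \<in> l" "(u $ 1, u $ 2, u $ 3) \<noteq> (0, 0, 0)"
    using vec4_collapse[of u] by (metis, metis prod.inject vec4_eq_0_iff)
  show ?thesis
    using that generator_eq_line1[OF l A *] by blast
qed

lemma Av_in_line1: "vec.span {Av x y} \<in> line1 x y e"
  unfolding line1_def using span_in_Lin indep2_line1 by blast

text \<open>Orthogonality reads x cj(x') = (y - cj(y'))^2. Raised to the power h, both sides become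
  expressions in y and y' alone, and their difference is the norm of y - y'. So no generator
  contains two affine points of the curve.\<close>

lemma curve_orthogonal_unique:
  assumes "curve x y" "curve x' y'" "hf (Av x y) (Av x' y') = 0"
  shows "x = x' \<and> y = y'"
proof -
  have c: "cj y - y = x ^ h" "cj y' - y' = x' ^ h" using assms by (simp_all add: curve_def)
  have xx: "x * cj x' = (y - cj y')\<^sup>2" using assms(3) by (simp add: hf_Av_Av)
  have "(cj y - y) * cj (cj y' - y') = (x * cj x') ^ h"
    unfolding c by (simp add: power_mult_distrib)
  also have "\<dots> = ((y - cj y') ^ h)\<^sup>2"
    unfolding xx by (simp add: mult.commute flip: power_mult)
  also have "\<dots> = (y - cj y') * (cj y - y')"
    by (simp add: power_h_2)
  finally have "(y - y') * cj (y - y') = 0" by (simp add: algebra_simps)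
  then have y: "y = y'" by simp
  have "x = x'"
  proof (cases "x = 0")
    case True
    then have "x' ^ h = 0" using c y h_pos by (simp add: power_0_left)
    then show ?thesis using True by simp
  next
    case False
    have "x * cj x' = x * cj x"
      using xx y curve_norm[OF assms(1)] by (simp add: power2_commute)
    then show ?thesis using False by simp
  qed
  then show ?thesis using y by simp
qed

lemma line1_curve_point_unique:
  assumes "curve x y" "e * cj e = - 2" "curve x' y'" "vec.span {Av x' y'} \<in> line1 x y e"
  shows "x = x' \<and> y = y'"
  using assms curve_orthogonal_unique generator_hf[OF line1_generator Av_in_line1]
  by (metis Av_neq_0)

lemma line1_at_infinity:
  assumes "vec.span {vec4 0 a 1 r} \<in> line1 x y e"
  shows "a = e" "r = 2 * cj y + e * cj x"
proof -
  obtain s t where "vec4 0 a 1 r = s *s Av x y + t *s Pv x y e"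
    using assms span_in_Lin_iff[of "vec4 0 a 1 r"] by (auto simp: line1_def)
  then show "a = e" "r = 2 * cj y + e * cj x"
    by (auto simp: Av_def Pv_def vec4_smult vec4_add)
qed

lemma line1_eq_iff:
  assumes "curve x y" "e * cj e = - 2" "curve x' y'" "e' * cj e' = - 2"
  shows "line1 x y e = line1 x' y' e' \<longleftrightarrow> x = x' \<and> y = y' \<and> e = e'"
proof
  assume eq: "line1 x y e = line1 x' y' e'"
  then have xy: "x = x' \<and> y = y'"
    using line1_curve_point_unique[OF assms(1,2,3)] Av_in_line1 by blast
  have "vec.span {Pv x y e} \<in> line1 x' y' e'"
    using eq span_in_Lin indep2_line1 unfolding line1_def by blast
  then show "x = x' \<and> y = y' \<and> e = e'"
    using xy line1_at_infinity(1) unfolding Pv_def by blast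
qed simp

text \<open>The \<open>eta\<close> factor is there to compensate the sign \<open>eta (j * W)\<close>
  that e^h acquires in \<open>mat_S_line1\<close>.\<close>

definition Phi :: "'a \<Rightarrow> 'a \<Rightarrow> 'a \<Rightarrow> 'a" where
  "Phi x y e = e ^ h * of_int (eta (cj y - y - cj e * x))"

definition flag :: "'a \<Rightarrow> 'a \<Rightarrow> 'a \<Rightarrow> bool" where
  "flag x y e \<longleftrightarrow> curve x y \<and> x \<noteq> 0 \<and> e * cj e = - 2"

definition G1set :: "'a \<Rightarrow> ('a ^ 4) set set set" where
  "G1set \<phi> = {line1 x y e | x y e. flag x y e \<and> Phi x y e = \<phi>}"

text \<open>The exponent of v is (q-1)(q+1)/2 = (q^2-1)/2, so this is Euler's criterion in the large
  field.\<close>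

lemma power_h_quotient: "v \<noteq> 0 \<Longrightarrow> (cj v / v) ^ h = of_int (eta v)"
proof -
  assume v: "v \<noteq> 0"
  let ?N = "v * cj v"
  have "(cj v / v) ^ h * (v ^ h)\<^sup>2 = ?N ^ h"
    using v by (simp add: power_divide power_mult_distrib power2_eq_square)
  then have "(cj v / v) ^ h * ?N = ?N ^ h"
    unfolding power_h_2 .
  moreover have "?N ^ h = ?N ^ m * ?N"
    by (simp add: h_m mult.commute)
  ultimately have "(cj v / v) ^ h * ?N = ?N ^ m * ?N"
    by (simp only:)
  then have "(cj v / v) ^ h = ?N ^ m" using v by simp
  then show ?thesis by (simp add: eta_def of_int_chi)
qed

lemma eta_divide: "w \<noteq> 0 \<Longrightarrow> eta (v / w) = eta v * eta w"
proof -
  assume w: "w \<noteq> 0"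
  have "eta (v / w * w) = eta (v / w) * eta w" by (rule eta_mult)
  then show ?thesis using w eta_cases[OF w] by auto
qed

text \<open>The relation \<open>k\<^sup>h = det\<close> holds for every generator of the group, once \<open>R\<close> is rescaled.\<close>

definition admissible :: "'a \<Rightarrow> 'a \<Rightarrow> 'a \<Rightarrow> 'a \<Rightarrow> 'a \<Rightarrow> bool" where
  "admissible a b c d k \<longleftrightarrow> a \<in> Fq q \<and> b \<in> Fq q \<and> c \<in> Fq q \<and> d \<in> Fq q
     \<and> a * d - b * c \<noteq> 0 \<and> k ^ h = a * d - b * c"

section \<open>Action of the group on the first family\<close>

lemma admissible_k_neq_0: "admissible a b c d k \<Longrightarrow> k \<noteq> 0"
  using h_pos by (auto simp: admissible_def power_0_left)

lemma admissible_invertible: "admissible a b c d k \<Longrightarrow> invertible (mat_S a b c d k)"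
  by (metis admissible_def admissible_k_neq_0 mat_S_invertible)

lemma admissible_norm: "admissible a b c d k \<Longrightarrow> k * cj k = (a * d - b * c)\<^sup>2"
  by (metis admissible_def power_h_2)

text \<open>On (X0, X2, X3) the form is, up to sign, the polar form of X0 X3 - X2^2 with one
  argument conjugated. The symmetric square scales it by the squared determinant, and the norm of k
  is the same square.\<close>

lemma hf_mat_S:
  assumes "admissible a b c d k"
  shows "hf (mat_S a b c d k *v v) (mat_S a b c d k *v w) = (a * d - b * c)\<^sup>2 * hf v w"
proof -
  have cj: "cj a = a" "cj b = b" "cj c = c" "cj d = d"
    using assms by (auto simp: admissible_def Fq_iff)
  obtain v0 v1 v2 v3 w0 w1 w2 w3 where vw: "v = vec4 v0 v1 v2 v3" "w = vec4 w0 w1 w2 w3"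
    by (meson vec4_cases)
  have k: "k * v1 * (cj k * cj w1) = (a * d - b * c)\<^sup>2 * (v1 * cj w1)"
    using admissible_norm[OF assms] by (simp add: ac_simps)
  show ?thesis
    unfolding vw mat_S_mult_vec hf_vec4 cj_mult k cj_add cj_power cj cj_numeral
    by (simp add: power2_eq_square algebra_simps)
qed

lemma collineation_generator:
  assumes "admissible a b c d k" "l \<in> generators q"
  shows "collineation (mat_S a b c d k) ` l \<in> generators q"
proof -
  let ?S = "mat_S a b c d k"
  obtain v w where vw: "indep2 v w" "l = Lin v w"
    using assms line_cases by (auto simp: generators_def)
  have inv: "invertible ?S" using assms admissible_invertible by blast
  have "hf (?S *v v) (?S *v v) = 0 \<and> hf (?S *v v) (?S *v w) = 0 \<and> hf (?S *v w) (?S *v w) = 0"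
    using assms vw generators_Lin_iff[OF vw(1)] by (simp add: hf_mat_S)
  then show ?thesis
    unfolding vw(2) collineation_Lin[OF inv] generators_Lin_iff[OF indep2_matrix[OF inv vw(1)]] .
qed


text \<open>k^h = D and D^h = D^m D, so the quotient is the inverse of the sign D^m.\<close>

lemma chi_det: "admissible a b c d k \<Longrightarrow> k ^ h / (a * d - b * c) ^ h = of_int (chi (a * d - b * c))"
proof -
  assume adm: "admissible a b c d k"
  define D where "D = a * d - b * c"
  have D: "D \<in> Fq q" "D \<noteq> 0" "k ^ h = D" using adm by (auto simp: admissible_def D_def)
  have "D ^ m * D ^ m = 1" using Fq_power_m[OF D(1,2)] by auto
  then have "k ^ h / D ^ h = D ^ m" using D unfolding D(3) unfolding h_m by (simp add: field_simps)
  then show ?thesis using of_int_chi[OF D(1)] by (simp add: D_def)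
qed

text \<open>On y the group acts by the fractional linear map (c + d y)/(a + b y), with denominator
  j; W plays the role of j for the point at infinity of the generator. The last two displayed
  relations are what makes \<open>Phi\<close> change by chi(D) only.\<close>

lemma mat_S_line1:
  assumes adm: "admissible a b c d k" and fl: "flag x y e"
  defines "j \<equiv> a + b * y" and "W \<equiv> a - b * y + 2 * b * cj y + b * e * cj x"
    and "D \<equiv> a * d - b * c"
  obtains e' where "collineation (mat_S a b c d k) ` line1 x y e = line1 (k * x / j\<^sup>2) ((c + d * y) / j) e'"
    and "flag (k * x / j\<^sup>2) ((c + d * y) / j) e'"
    and "cj ((c + d * y) / j) - (c + d * y) / j - cj e' * (k * x / j\<^sup>2) = D * (cj y - y - cj e * x) / (j * cj W)"
    and "j * W \<noteq> 0"
    and "e' ^ h = of_int (chi D * eta (j * W)) * e ^ h"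
proof -
  let ?S = "mat_S a b c d k"
  define x' where "x' = k * x / j\<^sup>2"
  define y' where "y' = (c + d * y) / j"
  define r where "r = 2 * cj y + e * cj x"
  have F: "a \<in> Fq q" "b \<in> Fq q" "c \<in> Fq q" "d \<in> Fq q" and D0: "D \<noteq> 0" and kh: "k ^ h = D"
    using adm by (auto simp: admissible_def D_def)
  have cjF: "cj a = a" "cj b = b" "cj c = c" "cj d = d" using F by (simp_all add: Fq_iff)
  have DF: "D \<in> Fq q" using F by (auto simp: D_def)
  then have cjD: "cj D = D" by (simp add: Fq_iff)
  have k0: "k \<noteq> 0" using adm admissible_k_neq_0 by blast
  have kk: "k * cj k = D\<^sup>2" using adm admissible_norm by (simp add: D_def)
  have inv: "invertible ?S" using adm admissible_invertible by blast
  have cur: "curve x y" and x0: "x \<noteq> 0" and ee: "e * cj e = - 2" using fl by (auto simp: flag_def)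
  have xx: "x * cj x = (cj y - y)\<^sup>2" using cur by (rule curve_norm)
  have yF: "cj y \<noteq> y" using cur x0 by (auto simp: curve_def)
  \<comment> \<open>y lies outside F_q because x is nonzero, so 1 and y are independent over
    F_q.\<close>
  have j0: "j \<noteq> 0"
  proof
    assume j: "j = 0"
    have "cj j - j = b * (cj y - y)" by (simp add: j_def cjF algebra_simps)
    then have "b * (cj y - y) = 0" unfolding j by simp
    then have "b = 0" using yF by simp
    then have "a = 0" using j by (simp add: j_def)
    then show False using D0 \<open>b = 0\<close> by (simp add: D_def)
  qed
  have cjj: "cj j = a + b * cj y" by (simp add: j_def cjF)
  have cW: "cj W = a - b * cj y + 2 * b * y + b * cj e * x" by (simp add: W_def cjF)
  have num: "(c + d * cj y) * j - (c + d * y) * cj j = D * (cj y - y)"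
    unfolding cjj by (simp add: j_def D_def algebra_simps)
  have "cj y' - y' = ((c + d * cj y) * j - (c + d * y) * cj j) / (cj j * j)"
    using j0 by (simp add: y'_def cjF diff_frac_eq)
  then have dy: "cj y' - y' = D * (cj y - y) / (j * cj j)"
    unfolding num by (simp only: mult.commute[of j])
  have "x' ^ h = k ^ h * x ^ h / (j ^ h)\<^sup>2"
    by (simp add: x'_def power_mult_distrib power_divide mult.commute flip: power_mult)
  also have "\<dots> = D * (cj y - y) / (j * cj j)"
    using cur by (simp add: kh power_h_2 curve_def)
  finally have cur': "curve x' y'" using dy by (simp add: curve_def)
  have x'0: "x' \<noteq> 0" using x0 k0 j0 by (simp add: x'_def)
  have j2: "j\<^sup>2 * x' = k * x" "j\<^sup>2 * y' = j * (c + d * y)" "j\<^sup>2 * y'\<^sup>2 = (c + d * y)\<^sup>2"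
    using j0 by (simp_all add: x'_def y'_def power_divide power2_eq_square)
  have SA: "?S *v Av x y = j\<^sup>2 *s Av x' y'"
    unfolding Av_def mat_S_mult_vec vec4_smult vec4_eq_iff j2
    by (simp add: j_def power2_eq_square algebra_simps)
  have SP: "?S *v Pv x y e = vec4 (b * (2 * a + b * r)) (k * e) (a * d + b * c + b * d * r) (2 * c * d + d\<^sup>2 * r)"
    unfolding Pv_def mat_S_mult_vec r_def[symmetric] by (simp add: power2_eq_square algebra_simps)
  let ?l = "collineation ?S ` line1 x y e"
  have l: "?l \<in> generators q"
    using collineation_generator[OF adm line1_generator[OF cur ee]] .
  have lL: "?l = Lin (?S *v Av x y) (?S *v Pv x y e)"
    unfolding line1_def by (rule collineation_Lin[OF inv])
  have ind: "indep2 (?S *v Av x y) (?S *v Pv x y e)"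
    using indep2_matrix[OF inv indep2_line1] .
  have A': "vec.span {Av x' y'} \<in> ?l"
    using span_in_Lin(1)[OF ind] j0 unfolding lL SA by (simp add: point_span_cancel)
  \<comment> \<open>The multiple of the image point to subtract in order to return to the plane X0 =
    0.\<close>
  define t where "t = b * (2 * a + b * r) / j\<^sup>2"
  have tj: "t * j\<^sup>2 = b * (2 * a + b * r)" using j0 by (simp add: t_def)
  define e2 where "e2 = k * e - t * (k * x)"
  define f2 where "f2 = a * d + b * c + b * d * r - t * (j * (c + d * y))"
  define g2 where "g2 = 2 * c * d + d\<^sup>2 * r - t * (j\<^sup>2 * y'\<^sup>2)"
  have u: "vec4 0 e2 f2 g2 = (- t) *s (?S *v Av x y) + 1 *s (?S *v Pv x y e)"
    unfolding SP SA unfolding Av_def vec4_smult vec4_add vec4_eq_iff e2_def f2_def g2_def j2 mult_1 mult_1_right tj[symmetric]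
    by simp
  have "vec4 0 e2 f2 g2 \<noteq> 0"
  proof
    assume "vec4 0 e2 f2 g2 = 0"
    then have "?S *v Pv x y e = t *s (?S *v Av x y)"
      using u by (simp add: add_eq_0_iff)
    then show False using ind by (auto simp: indep2_def)
  qed
  moreover from this have "vec.span {vec4 0 e2 f2 g2} \<in> ?l"
    unfolding lL using span_in_Lin_iff u by blast
  ultimately have u': "vec.span {vec4 0 e2 f2 g2} \<in> ?l" "(e2, f2, g2) \<noteq> (0, 0, 0)" by auto
  define e' where "e' = e2 / f2"
  note gen = generator_eq_line1[OF l A' u', folded e'_def]
  have jf: "j * f2 = D * W"
  proof -
    have "j * f2 = (a * d + b * c + b * d * r) * j - b * (2 * a + b * r) * (c + d * y)"
      unfolding f2_def tj[symmetric] by (simp add: power2_eq_square algebra_simps)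
    also have "\<dots> = D * (a + b * r - b * y)"
      unfolding j_def D_def by (rule line1_second_identity)
    also have "a + b * r - b * y = W" by (simp add: W_def r_def algebra_simps)
    finally show ?thesis .
  qed
  have je: "j\<^sup>2 * e2 = k * (e * cj j * cj W)"
  proof -
    have "j\<^sup>2 * e2 = k * (e * j\<^sup>2 - b * (2 * a + b * r) * x)"
      unfolding e2_def tj[symmetric] by (simp add: algebra_simps)
    also have "e * j\<^sup>2 - b * (2 * a + b * r) * x = e * cj j * cj W"
      unfolding r_def cjj cW unfolding j_def by (rule line1_first_identity[OF xx ee])
    finally show ?thesis .
  qed
  have W0: "W \<noteq> 0" using jf gen(1) j0 by auto
  \<comment> \<open>The shape cj(v)/v is the point: its h-th power is the sign \<open>eta v\<close>,
    and that of k/D is chi(D).\<close>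
  have e': "e' = (k / D) * e * (cj (j * W) / (j * W))"
  proof -
    have "e' = (j\<^sup>2 * e2) / (j * (j * f2))" using j0 by (simp add: e'_def power2_eq_square)
    also have "\<dots> = (k / D) * e * ((cj j * cj W) / (j * W))" unfolding je jf by (simp add: ac_simps)
    finally show ?thesis by simp
  qed
  have "e' ^ h = (k ^ h / D ^ h) * e ^ h * (cj (j * W) / (j * W)) ^ h"
    unfolding e' by (simp only: power_mult_distrib power_divide)
  also have "(cj (j * W) / (j * W)) ^ h = of_int (eta (j * W))"
    using j0 W0 by (intro power_h_quotient) simp
  also have "k ^ h / D ^ h = of_int (chi D)"
    unfolding D_def by (rule chi_det[OF adm])
  finally have eh: "e' ^ h = of_int (chi D * eta (j * W)) * e ^ h" by simp
  have "cj e' = (cj k / D) * cj e * (j * W / (cj j * cj W))"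
    unfolding e' by (simp add: cjD)
  then have "cj e' * x' = (k * cj k / D) * (cj e * x) * W / (j * cj j * cj W)"
    using j0 by (simp add: x'_def power2_eq_square) (simp add: ac_simps)
  also have "k * cj k / D = D" using D0 unfolding kk by (simp add: power2_eq_square)
  finally have "cj e' * x' = D * (cj e * x) * W / (j * cj j * cj W)" .
  then have "cj y' - y' - cj e' * x' = D * ((cj y - y) * cj W - cj e * x * W) / (j * cj j * cj W)"
  proof -
    assume *: "cj e' * x' = D * (cj e * x) * W / (j * cj j * cj W)"
    have "D * (cj y - y) / (j * cj j) = D * (cj y - y) * cj W / (j * cj j * cj W)"
      using W0 by simp
    then show ?thesis unfolding dy *
      by (simp only: diff_divide_distrib[symmetric] right_diff_distrib[symmetric] mult.assoc)
  qed
  also have "(cj y - y) * cj W - cj e * x * W = cj j * (cj y - y - cj e * x)"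
    unfolding cW cjj unfolding W_def by (rule line1_third_identity[OF xx ee])
  finally have g: "cj y' - y' - cj e' * x' = D * (cj y - y - cj e * x) / (j * cj W)"
    using j0 by simp
  have "flag x' y' e'" using gen(2) cur' x'0 by (simp add: flag_def)
  moreover have "j * W \<noteq> 0" using j0 W0 by simp
  ultimately show ?thesis
    using that[of e', folded x'_def y'_def] gen(3) g eh by blast
qed

text \<open>Compare norms. With t = cj(y) - y, conjugation negates t, so t and 2t have norms -t^2
  and -4 t^2, whereas cj(e) x has norm -2 t^2.\<close>

lemma flag_g_neq_0:
  assumes "flag x y e"
  shows "cj y - y - cj e * x \<noteq> 0" "2 * (cj y - y) - cj e * x \<noteq> 0"
    and "cj e * x * cj (cj e * x) = - 2 * (cj y - y)\<^sup>2" "cj y - y \<noteq> 0"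
proof -
  have cur: "curve x y" and x0: "x \<noteq> 0" and ee: "e * cj e = - 2" using assms by (auto simp: flag_def)
  show t: "cj y - y \<noteq> 0" using cur x0 by (simp add: curve_def)
  have "cj e * x * cj (cj e * x) = (e * cj e) * (x * cj x)" by simp
  then show n: "cj e * x * cj (cj e * x) = - 2 * (cj y - y)\<^sup>2"
    unfolding ee curve_norm[OF cur] .
  have t2: "(cj y - y)\<^sup>2 \<noteq> 0" using t by simp
  show "cj y - y - cj e * x \<noteq> 0"
  proof
    assume "cj y - y - cj e * x = 0"
    then have *: "cj e * x = cj y - y" by simp
    have "- (cj y - y)\<^sup>2 = - 2 * (cj y - y)\<^sup>2"
      using n unfolding * by (simp add: power2_eq_square algebra_simps)
    then have "(cj y - y)\<^sup>2 = 2 * (cj y - y)\<^sup>2" by (simp only: mult_minus_left neg_equal_iff_equal)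
    then have "(cj y - y)\<^sup>2 = 0" by (simp only: mult_2 add_cancel_right_right)
    then show False using t2 by simp
  qed
  show "2 * (cj y - y) - cj e * x \<noteq> 0"
  proof
    assume "2 * (cj y - y) - cj e * x = 0"
    then have *: "cj e * x = 2 * (cj y - y)" by simp
    have "2 * (cj y - y) * cj (2 * (cj y - y)) - - 2 * (cj y - y)\<^sup>2 = - 2 * (cj y - y)\<^sup>2"
      by (simp add: power2_eq_square algebra_simps)
    then have "- 2 * (cj y - y)\<^sup>2 = 0" using n unfolding * by simp
    then show False using t2 by simp
  qed
qed

lemma mat_S_G1set:
  assumes adm: "admissible a b c d k" and l: "l \<in> G1set \<phi>"
  shows "collineation (mat_S a b c d k) ` l \<in> G1set (of_int (chi (a * d - b * c)) * \<phi>)"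
proof -
  obtain x y e where fl: "flag x y e" and ph: "Phi x y e = \<phi>" and le: "l = line1 x y e"
    using l by (auto simp: G1set_def)
  let ?j = "a + b * y" and ?W = "a - b * y + 2 * b * cj y + b * e * cj x" and ?D = "a * d - b * c"
  obtain e' where e': "collineation (mat_S a b c d k) ` line1 x y e = line1 (k * x / ?j\<^sup>2) ((c + d * y) / ?j) e'"
    "flag (k * x / ?j\<^sup>2) ((c + d * y) / ?j) e'"
    and g: "cj ((c + d * y) / ?j) - (c + d * y) / ?j - cj e' * (k * x / ?j\<^sup>2) = ?D * (cj y - y - cj e * x) / (?j * cj ?W)"
    and jW: "?j * ?W \<noteq> 0"
    and eh: "e' ^ h = of_int (chi ?D * eta (?j * ?W)) * e ^ h"
    using mat_S_line1[OF adm fl] by metis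
  have D: "?D \<in> Fq q" "?D \<noteq> 0" using adm by (auto simp: admissible_def)
  have nz: "?j * cj ?W \<noteq> 0"
    using jW by (simp only: mult_eq_0_iff cj_eq_0_iff simp_thms)
  have "eta (?D * (cj y - y - cj e * x) / (?j * cj ?W)) = eta ?D * eta (cj y - y - cj e * x) * eta (?j * cj ?W)"
    using eta_divide[OF nz] by (simp only: eta_mult[of ?D])
  also have "\<dots> = eta (cj y - y - cj e * x) * eta (?j * ?W)"
    unfolding eta_Fq[OF D] eta_mult[of ?j] eta_cj by simp
  finally have "Phi (k * x / ?j\<^sup>2) ((c + d * y) / ?j) e'
      = of_int (chi ?D * eta (?j * ?W) * (eta (cj y - y - cj e * x) * eta (?j * ?W))) * e ^ h"
    unfolding Phi_def eh g by simp
  also have "eta (?j * ?W) * eta (?j * ?W) = 1"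
    using eta_cases[OF jW] by auto
  then have "chi ?D * eta (?j * ?W) * (eta (cj y - y - cj e * x) * eta (?j * ?W)) = chi ?D * eta (cj y - y - cj e * x)"
    by (metis (no_types, opaque_lifting) mult.assoc mult.left_commute mult.right_neutral)
  finally have "Phi (k * x / ?j\<^sup>2) ((c + d * y) / ?j) e' = of_int (chi ?D) * \<phi>"
    unfolding ph[symmetric] Phi_def by simp
  then show ?thesis unfolding le using e' by (auto simp: G1set_def)
qed


section \<open>Transitivity on each level set of \<open>Phi\<close>\<close>

lemma zero_neq_two [simp]: "(0::'a) \<noteq> 2"
  using two_neq_0 by metis

text \<open>-1 is a square in F_q as q = 1 mod 4, and 2 is one by assumption. Consequently e^h is
  fixed by conjugation for every e of norm -2.\<close>

lemma neg2_root_Fq: "(w::'a)\<^sup>2 = - 2 \<Longrightarrow> w \<in> Fq q"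
proof -
  assume w: "w\<^sup>2 = - 2"
  obtain s where s: "s \<in> Fq q" "(2::'a) = s\<^sup>2" using two_square by (auto simp: squares_Fq_def)
  have "chi (- 1) = 1" by (rule chi_minus_1)
  then obtain i :: 'a where i: "i \<in> Fq q" "i\<^sup>2 = - 1"
    using chi_eq_1_iff[of "- 1"] by auto
  have "w\<^sup>2 = (i * s)\<^sup>2" using w i s by (simp add: power_mult_distrib)
  then have "w = i * s \<or> w = - (i * s)" by (simp only: power2_eq_iff)
  then show ?thesis using i s by auto
qed

lemma flag_power_h: "e * cj e = - 2 \<Longrightarrow> e ^ h \<in> Fq q" "e * cj e = - 2 \<Longrightarrow> (e ^ h)\<^sup>2 = - 2"
  using neg2_root_Fq[of "e ^ h"] by (simp_all add: power_h_2)

text \<open>Dividing by the trace-zero element t condenses a flag into an element z of norm 2. The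
  norm of t is -t^2, a nonsquare of F_q, which gives the minus sign in the formula for
  \<open>Phi\<close>.\<close>

lemma flag_z:
  assumes fl: "flag x y e"
  defines "t \<equiv> cj y - y"
  defines "z \<equiv> cj e * x / t"
  shows "t \<noteq> 0" "z * cj z = 2" "1 - z \<noteq> 0" "2 - z \<noteq> 0" "2 - z = - z * cj (1 - z)" "z \<noteq> 0"
    "cj y - y - cj e * x = t * (1 - z)" "z ^ h * t ^ h = e ^ h * t" "Phi x y e = - (e ^ h * of_int (eta (1 - z)))"
proof -
  note g = flag_g_neq_0[OF fl, folded t_def]
  show t0: "t \<noteq> 0" by (rule g)
  have cjt: "cj t = - t" by (simp add: t_def)
  have "z * cj z = (cj e * x * cj (cj e * x)) / (t * cj t)" by (simp add: z_def)
  also have "\<dots> = 2" unfolding g(3) cjt using t0 by (simp add: power2_eq_square)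
  finally show zz: "z * cj z = 2" .
  then show z0: "z \<noteq> 0" by auto
  show ga: "cj y - y - cj e * x = t * (1 - z)" using t0 by (simp add: z_def t_def[symmetric] right_diff_distrib)
  show "1 - z \<noteq> 0" using g(1) ga t_def by auto
  have "2 * t - cj e * x = t * (2 - z)" using t0 by (simp add: z_def right_diff_distrib mult.commute)
  then show "2 - z \<noteq> 0" using g(2) by auto
  show "2 - z = - z * cj (1 - z)" using zz by (simp add: right_diff_distrib)
  have "z ^ h * t ^ h = cj (e ^ h) * x ^ h"
    using t0 by (simp add: z_def power_divide power_mult_distrib)
  also have "cj (e ^ h) = e ^ h" using fl flag_power_h(1) Fq_iff by (auto simp: flag_def)
  also have "x ^ h = t" using fl by (simp add: flag_def curve_def t_def)
  finally show "z ^ h * t ^ h = e ^ h * t" .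
  have "t \<notin> Fq q" using t0 cjt by (simp add: Fq_iff)
  moreover have t2: "t\<^sup>2 \<in> Fq q" by (simp add: Fq_iff cjt)
  ultimately have "chi (t\<^sup>2) = - 1" using nonsquare_iff[of "t\<^sup>2" t] t0 by simp
  moreover have "t * cj t = - t\<^sup>2" by (simp add: cjt power2_eq_square)
  ultimately have "eta t = - 1" using t2 by (simp add: eta_def chi_minus)
  then show "Phi x y e = - (e ^ h * of_int (eta (1 - z)))"
    unfolding Phi_def ga eta_mult by simp
qed

text \<open>The matrix is found by reading \<open>mat_S_line1\<close> backwards. With j = a + b y,
  the image point fixes a, b, c, d as the F_q-coordinates of j and j y0 in the basis 1, y, and fixes
  k. Determinant 1 means that j has norm \<nu>, and the image line is the wanted one if moreover j^2
  = w. Both can be met because equality of \<open>Phi\<close> gives w^h = \<nu>: then w is a square,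
  and its root j has norm j^(2h) = w^h.\<close>

lemma flags_connected:
  assumes fl: "flag x y e" and fl0: "flag x0 y0 e0" and ph: "Phi x y e = Phi x0 y0 e0"
  obtains a b c d k where "a \<in> Fq q" "b \<in> Fq q" "c \<in> Fq q" "d \<in> Fq q" "a * d - b * c = 1" "k ^ h = 1"
    "collineation (mat_S a b c d k) ` line1 x y e = line1 x0 y0 e0"
proof -
  define t where "t = cj y - y"
  define t0 where "t0 = cj y0 - y0"
  define z where "z = cj e * x / t"
  define z0 where "z0 = cj e0 * x0 / t0"
  note Z = flag_z[OF fl, folded t_def, folded z_def]
  note Z0 = flag_z[OF fl0, folded t0_def, folded z0_def]
  have cjt: "cj t = - t" "cj t0 = - t0" by (simp_all add: t_def t0_def)
  define \<nu> where "\<nu> = t / t0"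
  have nuF: "\<nu> \<in> Fq q" by (simp add: \<nu>_def Fq_iff cjt)
  have nu0: "\<nu> \<noteq> 0" using Z(1) Z0(1) by (simp add: \<nu>_def)
  define \<gamma> where "\<gamma> = 1 - z"
  define \<gamma>0 where "\<gamma>0 = 1 - z0"
  have ga0: "\<gamma> \<noteq> 0" "\<gamma>0 \<noteq> 0" using Z(3) Z0(3) by (simp_all add: \<gamma>_def \<gamma>0_def)
  have ga1: "1 + \<gamma> = - z * cj \<gamma>" "1 + \<gamma>0 = - z0 * cj \<gamma>0"
    using Z(5) Z0(5) by (simp_all add: \<gamma>_def \<gamma>0_def)
  \<comment> \<open>The required value of j^2: for determinant 1, cj(W) = j - (cj(j) - j) \<gamma>,
    and e' = e0 asks for j cj(W) = \<nu> \<gamma>/\<gamma>0. If j has norm \<nu>, this is linear in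
    j^2.\<close>
  define w where "w = \<nu> * (\<gamma> * (1 + \<gamma>0) / (\<gamma>0 * (1 + \<gamma>)))"
  have e0: "e ^ h \<noteq> 0" "e0 ^ h \<noteq> 0" using fl fl0 by (auto simp: flag_def)
  have "w = \<nu> * (z0 / z) * (cj \<gamma>0 / \<gamma>0) / (cj \<gamma> / \<gamma>)"
    unfolding w_def ga1 using Z(6) Z0(6) ga0 by (simp add: ac_simps)
  then have "w ^ h = \<nu> ^ h * (z0 ^ h / z ^ h) * (cj \<gamma>0 / \<gamma>0) ^ h / (cj \<gamma> / \<gamma>) ^ h"
    by (simp only: power_mult_distrib power_divide)
  also have "\<dots> = \<nu> ^ h * (z0 ^ h / z ^ h) * (of_int (eta \<gamma>0) / of_int (eta \<gamma>))"
    using ga0 by (simp add: power_h_quotient)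
  also have "z0 ^ h / z ^ h = (e0 ^ h / e ^ h) * (\<nu> ^ h / \<nu>)"
  proof -
    have "z ^ h = e ^ h * t / t ^ h" "z0 ^ h = e0 ^ h * t0 / t0 ^ h"
      using Z(1,8) Z0(1,8) by (simp_all add: field_simps)
    then show ?thesis using Z(1) Z0(1) e0 by (simp add: \<nu>_def power_divide ac_simps)
  qed
  \<comment> \<open>Here the equality of the two values of \<open>Phi\<close> enters; the quotient
    cancels the one coming from z0^h / z^h.\<close>
  also have "of_int (eta \<gamma>0) / of_int (eta \<gamma>) = (e ^ h / e0 ^ h :: 'a)"
  proof -
    have "e ^ h * of_int (eta \<gamma>) = e0 ^ h * of_int (eta \<gamma>0)"
      using ph unfolding Z(9) Z0(9) \<gamma>_def[symmetric] \<gamma>0_def[symmetric] by simp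
    moreover have "of_int (eta \<gamma>) * of_int (eta \<gamma>) = (1 :: 'a)"
      using eta_cases[OF ga0(1)] by auto
    ultimately show ?thesis using e0 eta_cases[OF ga0(1)]
      by (auto simp: field_simps) (metis minus_minus)
  qed
  finally have wh': "w ^ h = \<nu> ^ h * \<nu> ^ h / \<nu>" using e0 h_pos by auto
  have "\<nu> ^ h * \<nu> ^ h = \<nu> * \<nu>" using power_h_sq[of \<nu>] nuF by (simp add: Fq_iff)
  then have wh: "w ^ h = \<nu>" using wh' nu0 by simp
  have "w * cj w = \<nu>\<^sup>2" using power_h_2[of w] wh by simp
  moreover have "(\<nu>\<^sup>2) ^ m = 1"
  proof -
    have "(\<nu>\<^sup>2) ^ m = (\<nu> ^ m)\<^sup>2" by (simp add: mult.commute flip: power_mult)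
    then show ?thesis using Fq_power_m[OF nuF nu0] by auto
  qed
  ultimately obtain j where j: "j\<^sup>2 = w" using ex_square_root[of w] by auto
  have jj: "j * cj j = \<nu>"
    unfolding power_h_sq[symmetric] using j wh by (simp add: power2_eq_square flip: power_mult_distrib)
  have j0: "j \<noteq> 0" using jj nu0 by auto
  have t': "cj y - y \<noteq> 0" "y - cj y \<noteq> 0" using Z(1) by (auto simp: t_def)
  \<comment> \<open>Cramer's rule for a + b y = j together with its conjugate; d solves c + d y = j
    y0 in the same way.\<close>
  define b where "b = (j - cj j) / (y - cj y)"
  define a where "a = j - b * y"
  define d where "d = (j * y0 - cj (j * y0)) / (y - cj y)"
  define c where "c = j * y0 - d * y"
  have cjb: "cj b = b" unfolding b_def cj_divide cj_diff cj_cj by (metis minus_diff_eq minus_divide_divide)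
  have cjd: "cj d = d" unfolding d_def cj_divide cj_diff cj_cj by (metis minus_diff_eq minus_divide_divide)
  have bt: "b * (y - cj y) = j - cj j" using t' by (simp add: b_def)
  have dt: "d * (y - cj y) = j * y0 - cj (j * y0)" using t' by (simp add: d_def)
  have cja: "cj a = a" using bt by (simp add: a_def cjb algebra_simps)
  have cjc: "cj c = c" using dt by (simp add: c_def cjd algebra_simps)
  have F: "a \<in> Fq q" "b \<in> Fq q" "c \<in> Fq q" "d \<in> Fq q" using cja cjb cjc cjd by (simp_all add: Fq_iff)
  have ab: "a + b * y = j" "c + d * y = j * y0" by (simp_all add: a_def c_def)
  have cab: "a + b * cj y = cj j" "c + d * cj y = cj j * cj y0"
    using arg_cong[OF ab(1), of cj] arg_cong[OF ab(2), of cj] by (simp_all add: cja cjb cjc cjd)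
  have "(a * d - b * c) * t = (a + b * y) * (c + d * cj y) - (a + b * cj y) * (c + d * y)"
    by (simp add: t_def algebra_simps)
  also have "\<dots> = j * cj j * t0" unfolding ab cab by (simp add: t0_def algebra_simps)
  also have "\<dots> = t" unfolding jj using Z0(1) by (simp add: \<nu>_def)
  finally have det: "a * d - b * c = 1" using Z(1) by simp
  define k where "k = x0 * j\<^sup>2 / x"
  have x0: "x \<noteq> 0" "x0 \<noteq> 0" using fl fl0 by (auto simp: flag_def)
  have xh: "x ^ h = t" "x0 ^ h = t0" using fl fl0 by (simp_all add: flag_def curve_def t_def t0_def)
  have "k ^ h = x0 ^ h * (j ^ h)\<^sup>2 / x ^ h"
    by (simp add: k_def power_mult_distrib power_divide mult.commute flip: power_mult)
  also have "\<dots> = t0 * \<nu> / t" unfolding xh power_h_2 jj ..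
  also have "\<dots> = 1" using Z(1) Z0(1) by (simp add: \<nu>_def)
  finally have kh: "k ^ h = 1" .
  have adm: "admissible a b c d k" using F det kh by (simp add: admissible_def)
  have kx: "k * x / j\<^sup>2 = x0" using x0 j0 by (simp add: k_def)
  have yy: "(c + d * y) / j = y0" using ab j0 by simp
  obtain e' where e': "collineation (mat_S a b c d k) ` line1 x y e = line1 x0 y0 e'"
    and fl': "flag x0 y0 e'"
    and g: "cj y0 - y0 - cj e' * x0 = (cj y - y - cj e * x) / (j * cj (a - b * y + 2 * b * cj y + b * e * cj x))"
    using mat_S_line1[OF adm fl] unfolding ab(1) kx yy det by (metis mult_1)
  have cW: "cj (a - b * y + 2 * b * cj y + b * e * cj x) = j - b * (t * \<gamma>)"
    unfolding \<gamma>_def Z(7)[symmetric] by (simp add: cja cjb) (simp add: ab(1)[symmetric] t_def algebra_simps)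
  have btj: "b * t = cj j - j" using bt by (simp add: t_def algebra_simps)
  have "j * cj (a - b * y + 2 * b * cj y + b * e * cj x) = j * (j - (b * t) * \<gamma>)"
    unfolding cW by (simp only: mult.assoc)
  also have "\<dots> = w * (1 + \<gamma>) - \<nu> * \<gamma>"
    unfolding btj j[symmetric] jj[symmetric] by (simp add: power2_eq_square algebra_simps)
  also have "w * (1 + \<gamma>) = \<nu> * \<gamma> * (1 + \<gamma>0) / \<gamma>0"
  proof -
    have "1 + \<gamma> \<noteq> 0" using Z(4) by (simp add: \<gamma>_def)
    then show ?thesis by (simp add: w_def)
  qed
  also have "\<dots> - \<nu> * \<gamma> = \<nu> * \<gamma> / \<gamma>0" using ga0 by (simp add: field_simps)
  finally have jW: "j * cj (a - b * y + 2 * b * cj y + b * e * cj x) = \<nu> * \<gamma> / \<gamma>0" .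
  have Zg: "cj y - y - cj e * x = t * \<gamma>" "cj y0 - y0 - cj e0 * x0 = t0 * \<gamma>0"
    unfolding \<gamma>_def \<gamma>0_def Z(7)[symmetric] Z0(7)[symmetric] by (simp_all add: t_def t0_def)
  have "cj y0 - y0 - cj e' * x0 = t * \<gamma> / (\<nu> * \<gamma> / \<gamma>0)"
    unfolding g jW Zg ..
  also have "\<dots> = t0 * \<gamma>0" using Z(1) Z0(1) ga0 by (simp add: \<nu>_def)
  also have "\<dots> = cj y0 - y0 - cj e0 * x0" by (simp only: Zg)
  finally have "cj e' * x0 = cj e0 * x0" by simp
  then have "e' = e0" using x0 by simp
  then show ?thesis using that[OF F det kh] e' by simp
qed

end

subsection \<open>Generators through the conic\<close>

context hermitian_field
begin

definition Qv :: "'a \<Rightarrow> 'a \<Rightarrow> 'a ^ 4" where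
  "Qv u v = vec4 (u\<^sup>2) 0 (u * v) (v\<^sup>2)"

text \<open>Apart from X1, this is the derivative of (u^2, uv, v^2) in the direction (s, t): a
  generator through a point of \<open>Omega\<close> projects to the tangent of the conic
  there.\<close>

definition Rv :: "'a \<Rightarrow> 'a \<Rightarrow> 'a \<Rightarrow> 'a \<Rightarrow> 'a \<Rightarrow> 'a ^ 4" where
  "Rv u v s t e = vec4 (2 * u * s) e (u * t + v * s) (2 * v * t)"

definition line2 :: "'a \<Rightarrow> 'a \<Rightarrow> 'a \<Rightarrow> 'a \<Rightarrow> 'a \<Rightarrow> ('a ^ 4) set set" where
  "line2 u v s t e = Lin (Qv u v) (Rv u v s t e)"

definition flag2 :: "'a \<Rightarrow> 'a \<Rightarrow> 'a \<Rightarrow> 'a \<Rightarrow> 'a \<Rightarrow> bool" where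
  "flag2 u v s t e \<longleftrightarrow> u \<in> Fq q \<and> v \<in> Fq q \<and> s \<in> Fq q \<and> t \<in> Fq q
     \<and> u * t - v * s \<noteq> 0 \<and> e * cj e = - 2 * (u * t - v * s)\<^sup>2"

text \<open>Dividing e by the determinant makes the label insensitive to rescaling (s, t, e), which
  is how \<open>flag2_normal\<close> reaches determinant 1.\<close>

definition G2set :: "'a \<Rightarrow> ('a ^ 4) set set set" where
  "G2set \<psi> = {line2 u v s t e | u v s t e. flag2 u v s t e \<and> (e / (u * t - v * s)) ^ h = \<psi>}"

lemma indep2_line2: "flag2 u v s t e \<Longrightarrow> indep2 (Qv u v) (Rv u v s t e)"
proof -
  assume f: "flag2 u v s t e"
  then have "e * cj e \<noteq> 0" by (simp add: flag2_def)
  then have "e \<noteq> 0" by auto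
  moreover have "u \<noteq> 0 \<or> v \<noteq> 0" using f by (auto simp: flag2_def)
  ultimately show ?thesis by (auto simp: indep2_def Qv_def Rv_def vec4_smult)
qed

lemma line2_generator: "flag2 u v s t e \<Longrightarrow> line2 u v s t e \<in> generators q"
proof -
  assume f: "flag2 u v s t e"
  then have cj: "cj u = u" "cj v = v" "cj s = s" "cj t = t" by (simp_all add: flag2_def Fq_iff)
  have ee: "e * cj e = - 2 * (u * t - v * s)\<^sup>2" using f by (simp add: flag2_def)
  show ?thesis
    unfolding line2_def generators_Lin_iff[OF indep2_line2[OF f]] unfolding Qv_def Rv_def hf_vec4
    by (simp add: cj ee) (simp add: power2_eq_square algebra_simps)
qed

lemma flag2_normal:
  assumes f: "flag2 u v s t e"
  defines "D \<equiv> u * t - v * s"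
  shows "line2 u v s t e = line2 u v (s / D) (t / D) (e / D)" "flag2 u v (s / D) (t / D) (e / D)"
    "u * (t / D) - v * (s / D) = 1"
proof -
  have D0: "D \<noteq> 0" and F: "u \<in> Fq q" "v \<in> Fq q" "s \<in> Fq q" "t \<in> Fq q" and ee: "e * cj e = - 2 * D\<^sup>2"
    using f by (auto simp: flag2_def D_def)
  have DF: "D \<in> Fq q" using F by (auto simp: D_def)
  have "(u * t - v * s) / D = 1" using D0 by (simp add: D_def)
  then show d1: "u * (t / D) - v * (s / D) = 1" by (simp add: diff_divide_distrib)
  have "e / D * cj (e / D) = - 2" using DF D0 ee by (simp add: Fq_iff power2_eq_square)
  then show f': "flag2 u v (s / D) (t / D) (e / D)" unfolding flag2_def d1 using F DF by auto
  have "Rv u v (s / D) (t / D) (e / D) = 0 *s Qv u v + (1 / D) *s Rv u v s t e"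
    using D0 by (simp add: Rv_def Qv_def vec4_smult field_simps)
  then show "line2 u v s t e = line2 u v (s / D) (t / D) (e / D)"
    unfolding line2_def using indep2_line2[OF f] indep2_line2[OF f']
    by (intro Lin_eqI[where a=1 and b=0 and c=0 and d="1/D"]) simp_all
qed

lemma G2set_normal:
  assumes "l \<in> G2set \<psi>"
  obtains u v s t e where "flag2 u v s t e" "u * t - v * s = 1" "e ^ h = \<psi>" "l = line2 u v s t e"
proof -
  obtain u v s t e where f: "flag2 u v s t e" "(e / (u * t - v * s)) ^ h = \<psi>" "l = line2 u v s t e"
    using assms by (auto simp: G2set_def)
  then show ?thesis using that flag2_normal[OF f(1)] by metis
qed

lemma mat_S_line2:
  assumes adm: "admissible a b c d k" and f: "flag2 u v s t e"
  shows "collineation (mat_S a b c d k) ` line2 u v s t e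
      = line2 (a * u + b * v) (c * u + d * v) (a * s + b * t) (c * s + d * t) (k * e)" (is ?l)
    and "flag2 (a * u + b * v) (c * u + d * v) (a * s + b * t) (c * s + d * t) (k * e)" (is ?f)
    and "(a * u + b * v) * (c * s + d * t) - (c * u + d * v) * (a * s + b * t)
      = (a * d - b * c) * (u * t - v * s)" (is ?d)
proof -
  have "mat_S a b c d k *v Qv u v = Qv (a * u + b * v) (c * u + d * v)"
    unfolding Qv_def mat_S_mult_vec vec4_eq_iff by (simp add: power2_eq_square algebra_simps)
  moreover have "mat_S a b c d k *v Rv u v s t e
      = Rv (a * u + b * v) (c * u + d * v) (a * s + b * t) (c * s + d * t) (k * e)"
    unfolding Rv_def mat_S_mult_vec vec4_eq_iff by (simp add: power2_eq_square algebra_simps)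
  ultimately show ?l
    unfolding line2_def by (simp add: collineation_Lin[OF admissible_invertible[OF adm]])
  show d: ?d by (simp add: algebra_simps)
  have "k * e * cj (k * e) = (k * cj k) * (e * cj e)" by simp
  also have "\<dots> = - 2 * ((a * d - b * c) * (u * t - v * s))\<^sup>2"
    using f unfolding admissible_norm[OF adm] by (simp add: flag2_def power_mult_distrib)
  finally have "k * e * cj (k * e) = - 2 * ((a * d - b * c) * (u * t - v * s))\<^sup>2" .
  then show ?f unfolding flag2_def d using adm f by (auto simp: flag2_def admissible_def)
qed

lemma mat_S_G2set:
  assumes adm: "admissible a b c d k" and l: "l \<in> G2set \<psi>"
  shows "collineation (mat_S a b c d k) ` l \<in> G2set (of_int (chi (a * d - b * c)) * \<psi>)"
proof -
  obtain u v s t e where f: "flag2 u v s t e" "(e / (u * t - v * s)) ^ h = \<psi>" "l = line2 u v s t e"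
    using l by (auto simp: G2set_def)
  note S = mat_S_line2[OF adm f(1)]
  have "(k * e / ((a * d - b * c) * (u * t - v * s))) ^ h = (k ^ h / (a * d - b * c) ^ h) * (e / (u * t - v * s)) ^ h"
    by (simp add: power_divide power_mult_distrib)
  then show ?thesis
    unfolding f(3) S(1) chi_det[OF adm] f(2) G2set_def mem_Collect_eq using S(2,3) by metis
qed

lemma flags2_connected:
  assumes l: "l \<in> G2set \<psi>" and l0: "l0 \<in> G2set \<psi>"
  obtains a b c d k where "a \<in> Fq q" "b \<in> Fq q" "c \<in> Fq q" "d \<in> Fq q" "a * d - b * c = 1" "k ^ h = 1"
    "collineation (mat_S a b c d k) ` l = l0"
proof -
  obtain u v s t e where f: "flag2 u v s t e" and d1: "u * t - v * s = 1" and e1: "e ^ h = \<psi>" and l1: "l = line2 u v s t e"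
    using G2set_normal[OF l] by metis
  obtain u0 v0 s0 t0 e0 where f0: "flag2 u0 v0 s0 t0 e0" and d0: "u0 * t0 - v0 * s0 = 1" and e0: "e0 ^ h = \<psi>" and l2: "l0 = line2 u0 v0 s0 t0 e0"
    using G2set_normal[OF l0] by metis
  \<comment> \<open>The matrix with columns (u0, v0), (s0, t0) times the inverse of the one with
    columns (u, v), (s, t).\<close>
  define a where "a = u0 * t - s0 * v"
  define b where "b = s0 * u - u0 * s"
  define c where "c = v0 * t - t0 * v"
  define d where "d = t0 * u - v0 * s"
  have F: "a \<in> Fq q" "b \<in> Fq q" "c \<in> Fq q" "d \<in> Fq q"
    using f f0 by (auto simp: a_def b_def c_def d_def flag2_def)
  have "a * d - b * c = (u0 * t0 - v0 * s0) * (u * t - v * s)"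
    by (simp add: a_def b_def c_def d_def algebra_simps)
  then have det: "a * d - b * c = 1" by (simp add: d0 d1)
  have "a * u + b * v = u0 * (u * t - v * s)" "a * s + b * t = s0 * (u * t - v * s)"
    "c * u + d * v = v0 * (u * t - v * s)" "c * s + d * t = t0 * (u * t - v * s)"
    by (simp_all add: a_def b_def c_def d_def algebra_simps)
  then have eqs: "a * u + b * v = u0" "a * s + b * t = s0" "c * u + d * v = v0" "c * s + d * t = t0"
    by (simp_all add: d1)
  have "e * cj e \<noteq> 0" using f by (simp add: flag2_def)
  then have ne: "e \<noteq> 0" by auto
  define k where "k = e0 / e"
  have kh: "k ^ h = 1" using e0 ne by (simp add: k_def power_divide flip: e1)
  have ke: "k * e = e0" using ne by (simp add: k_def)
  have adm: "admissible a b c d k" using F det kh by (simp add: admissible_def)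
  show ?thesis
    using that[OF F det kh] mat_S_line2(1)[OF adm f] unfolding eqs ke l1 l2 by blast
qed

subsection \<open>The two families of generators\<close>

lemma span_in_pi_plane: "v \<noteq> 0 \<Longrightarrow> vec.span {v} \<in> pi_plane \<longleftrightarrow> v $ 1 = 0"
  by (auto simp: pi_plane_def point_span mem_span_1 intro: vec.span_base)

lemma Xplus_eq: "Xplus q = {vec.span {Av x y} | x y. curve x y} \<union> {vec.span {Qv 0 1}}"
  by (simp add: Xplus_def pt_span Av_def Qv_def curve_def cj_def h_def)

lemma Omega_eq: "Omega q = {vec.span {Qv u v} | u v. u \<in> Fq q \<and> v \<in> Fq q \<and> (u, v) \<noteq> (0, 0)}"
proof (intro equalityI subsetI)
  fix P :: "('a ^ 4) set" assume "P \<in> Omega q"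
  then consider y where "y \<in> Fq q" "P = vec.span {Qv 1 y}" | "P = vec.span {Qv 0 1}"
    using q_ge_5 by (auto simp: Omega_explicit pt_span Qv_def)
  then show "P \<in> {vec.span {Qv u v} | u v. u \<in> Fq q \<and> v \<in> Fq q \<and> (u, v) \<noteq> (0, 0)}"
  proof cases
    case 1
    then show ?thesis by (intro CollectI exI[of _ 1] exI[of _ y]) auto
  next
    case 2
    then show ?thesis by (intro CollectI exI[of _ 0] exI[of _ 1]) auto
  qed
next
  fix P :: "('a ^ 4) set" assume "P \<in> {vec.span {Qv u v} | u v. u \<in> Fq q \<and> v \<in> Fq q \<and> (u, v) \<noteq> (0, 0)}"
  then obtain u v where uv: "u \<in> Fq q" "v \<in> Fq q" "(u, v) \<noteq> (0, 0)" "P = vec.span {Qv u v}" by blast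
  show "P \<in> Omega q"
  proof (cases "u = 0")
    case True
    then have "Qv u v = v\<^sup>2 *s Qv 0 1" by (simp add: Qv_def vec4_smult)
    then have "P = vec.span {Qv 0 1}" using uv True by (simp add: point_span_cancel)
    then show ?thesis using q_ge_5 by (simp add: Omega_explicit pt_span Qv_def)
  next
    case False
    then have "Qv u v = u\<^sup>2 *s Qv 1 (v / u)" by (simp add: Qv_def vec4_smult power2_eq_square)
    then have "P = vec.span {Qv 1 (v / u)}" using uv False by (simp add: point_span_cancel)
    moreover have "v / u \<in> Fq q" using uv by auto
    ultimately show ?thesis using q_ge_5 by (auto simp: Omega_explicit pt_span Qv_def)
  qed
qed

lemma Delta_plus_eq: "Delta_plus q = {vec.span {Av x y} | x y. curve x y \<and> x \<noteq> 0}"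
proof -
  have "vec.span {Av x y} \<in> pi_plane \<longleftrightarrow> x = 0" for x y
    by (simp add: span_in_pi_plane) (simp add: Av_def)
  moreover have "vec.span {Qv 0 1} \<in> pi_plane"
    by (subst span_in_pi_plane) (simp_all add: Qv_def)
  ultimately show ?thesis
    unfolding Delta_plus_def Omega_def Xplus_eq by auto metis
qed

lemma G1_eq: "G1 q = (\<Union>\<phi>. G1set \<phi>)"
proof (intro equalityI subsetI)
  fix l :: "('a ^ 4) set set" assume "l \<in> G1 q"
  then obtain x y where l: "l \<in> generators q" "vec.span {Av x y} \<in> l" "curve x y" "x \<noteq> 0"
    by (auto simp: G1_def Delta_plus_eq)
  then obtain e where "e * cj e = - 2" "l = line1 x y e" using generator_line1_ex by metis
  then show "l \<in> (\<Union>\<phi>. G1set \<phi>)" using l by (auto simp: G1set_def flag_def)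
next
  fix l :: "('a ^ 4) set set" assume "l \<in> (\<Union>\<phi>. G1set \<phi>)"
  then obtain x y e where "flag x y e" "l = line1 x y e" by (auto simp: G1set_def)
  then show "l \<in> G1 q"
    using line1_generator[of x y e] Av_in_line1[of x y e] by (auto simp: G1_def Delta_plus_eq flag_def)
qed

lemma line1_eq_line2: "line1 0 y e = line2 1 y 0 1 e" if "y \<in> Fq q"
  using that by (simp add: line1_def line2_def Av_def Pv_def Qv_def Rv_def Fq_iff)

lemma generator_at_infinity:
  assumes l: "l \<in> generators q" and P: "vec.span {Qv 0 1} \<in> l"
  obtains e where "e * cj e = - 2" "l = line2 0 1 1 0 e"
proof -
  have Q: "Qv 0 1 = vec4 0 0 0 1" by (simp add: Qv_def)
  have Q0: "Qv 0 1 \<noteq> 0" by (simp add: Qv_def)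
  obtain v w where vw: "indep2 v w" "l = Lin v w"
    using l line_cases by (auto simp: generators_def)
  have "\<exists>w. indep2 (Qv 0 1) w \<and> vec.span {w} \<in> l"
    using vw span_in_Lin[OF vw(1)] Q0 by (metis indep2_span)
  then obtain w where w: "indep2 (Qv 0 1) w" "vec.span {w} \<in> l" by blast
  have lL: "l = Lin (Qv 0 1) w"
    using l w P line_eq_Lin by (auto simp: generators_def)
  obtain w0 w1 w2 w3 where w4: "w = vec4 w0 w1 w2 w3" by (rule vec4_cases)
  have h: "hf (Qv 0 1) w = 0" "hf w w = 0"
    using generators_Lin_iff[OF w(1)] l lL by auto
  then have w00: "w0 = 0" by (simp add: w4 Q hf_vec4)
  then have ww: "w1 * cj w1 = - 2 * (w2 * cj w2)"
    using h(2) by (simp add: w4 hf_vec4 eq_neg_iff_add_eq_0 mult.assoc)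
  have w2: "w2 \<noteq> 0"
  proof
    assume "w2 = 0"
    then have "w1 = 0" using ww by simp
    then have "w = w3 *s Qv 0 1" using \<open>w2 = 0\<close> w00 by (simp add: w4 Q vec4_smult)
    then show False using w(1) by (simp add: indep2_def)
  qed
  define e where "e = w1 / w2"
  have ee: "e * cj e = - 2" using ww w2 by (simp add: e_def)
  then have f: "flag2 0 1 1 0 e" by (simp add: flag2_def)
  have "Rv 0 1 1 0 e = (- w3 / w2) *s Qv 0 1 + (1 / w2) *s w"
    using w2 by (simp add: Rv_def Q w4 w00 vec4_smult vec4_add e_def)
  then have "l = line2 0 1 1 0 e"
    unfolding lL line2_def using w(1) indep2_line2[OF f]
    by (intro Lin_eqI[where a=1 and b=0 and c="- w3 / w2" and d="1 / w2"]) simp_all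
  then show ?thesis using that ee by blast
qed

lemma G2_eq: "G2 q = (\<Union>\<psi>. G2set \<psi>)"
proof (intro equalityI subsetI)
  fix l :: "('a ^ 4) set set" assume "l \<in> G2 q"
  then have l: "l \<in> generators q" and "l \<inter> Omega q \<noteq> {}" by (auto simp: G2_def)
  then consider y where "y \<in> Fq q" "vec.span {Av 0 y} \<in> l" | "vec.span {Qv 0 1} \<in> l"
    using q_ge_5 by (auto simp: Omega_explicit pt_span Qv_def Av_def)
  then show "l \<in> (\<Union>\<psi>. G2set \<psi>)"
  proof cases
    case 1
    then obtain e where e: "e * cj e = - 2" "l = line1 0 y e" using generator_line1_ex[OF l] by metis
    then have "flag2 1 y 0 1 e" "l = line2 1 y 0 1 e" using 1 line1_eq_line2 by (auto simp: flag2_def)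
    then show ?thesis unfolding G2set_def by blast
  next
    case 2
    then obtain e where e: "e * cj e = - 2" "l = line2 0 1 1 0 e" using generator_at_infinity[OF l] by metis
    then have "flag2 0 1 1 0 e" by (simp add: flag2_def)
    then show ?thesis using e unfolding G2set_def by blast
  qed
next
  fix l :: "('a ^ 4) set set" assume "l \<in> (\<Union>\<psi>. G2set \<psi>)"
  then obtain u v s t e where f: "flag2 u v s t e" "l = line2 u v s t e" by (auto simp: G2set_def)
  have "vec.span {Qv u v} \<in> l" unfolding f(2) line2_def using span_in_Lin indep2_line2[OF f(1)] by blast
  moreover have "vec.span {Qv u v} \<in> Omega q"
  proof -
    have "u \<in> Fq q" "v \<in> Fq q" "(u, v) \<noteq> (0, 0)" using f(1) by (auto simp: flag2_def)
    then show ?thesis unfolding Omega_eq by blast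
  qed
  ultimately show "l \<in> G2 q" using f line2_generator by (auto simp: G2_def)
qed

lemma generators_meeting_Xplus: "{l \<in> generators q. l \<inter> Xplus q \<noteq> {}} = G1 q \<union> G2 q"
proof -
  have "Xplus q = Delta_plus q \<union> Omega q" by (auto simp: Delta_plus_def Omega_def)
  then show ?thesis by (auto simp: G1_def G2_def)
qed

end

subsection \<open>Generators through a point of Case (III)\<close>

context hermitian_field
begin

text \<open>A generator through this point has e = a, and its last coordinate gives r = 2 cj(y) + a
  cj(x). Since a has norm -2, this solves to x = a (y - n), leaving y as the only unknown. Then
  cj(a) x = -2 (y - n), whence the argument y + cj(y) - 2n of \<open>eta\<close>.\<close>

lemma G1set_through:
  assumes aa: "a * cj a = - 2" and r: "r \<notin> Fq q"
  defines "n \<equiv> cj r / 2"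
  shows "{l \<in> G1set \<phi>. vec.span {vec4 0 a 1 r} \<in> l}
     = (\<lambda>y. line1 (a * (y - n)) y a) ` {y \<in> Yset (a ^ h) n. a ^ h * of_int (eta (y + cj y - 2 * n)) = \<phi>}"
    (is "?L = ?f ` ?Y")
    and "inj_on (\<lambda>y. line1 (a * (y - n)) y a) (Yset (a ^ h) n)"
    and "n \<notin> Fq q"
proof -
  have n2: "2 * cj n = r" by (simp add: n_def)
  show n: "n \<notin> Fq q" using r by (auto simp: n_def Fq_iff)
  have fl: "flag (a * (y - n)) y a" and g: "cj y - y - cj a * (a * (y - n)) = y + cj y - 2 * n"
    if y: "y \<in> Yset (a ^ h) n" for y
  proof -
    have "curve (a * (y - n)) y" using y by (simp add: curve_def Yset_def power_mult_distrib)
    moreover have "a \<noteq> 0" using aa by auto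
    moreover have "y \<noteq> n" using y n h_pos by (auto simp: Yset_def Fq_iff power_0_left)
    ultimately show "flag (a * (y - n)) y a" using aa by (simp add: flag_def)
    have "cj a * (a * (y - n)) = (a * cj a) * (y - n)" by simp
    then show "cj y - y - cj a * (a * (y - n)) = y + cj y - 2 * n" unfolding aa by (simp add: algebra_simps)
  qed
  show "inj_on ?f (Yset (a ^ h) n)"
  proof (rule inj_onI)
    fix y y' assume y: "y \<in> Yset (a ^ h) n" "y' \<in> Yset (a ^ h) n" and "?f y = ?f y'"
    then show "y = y'" using fl[OF y(1)] fl[OF y(2)] line1_eq_iff by (auto simp: flag_def)
  qed
  show "?L = ?f ` ?Y"
  proof (intro equalityI subsetI)
    fix l assume "l \<in> ?L"
    then obtain x y e where f: "flag x y e" and ph: "Phi x y e = \<phi>" and l: "l = line1 x y e"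
      and P: "vec.span {vec4 0 a 1 r} \<in> line1 x y e" by (auto simp: G1set_def)
    have e: "e = a" and rr: "r = 2 * cj y + a * cj x" using line1_at_infinity[OF P] by auto
    have "2 * n = 2 * y + cj a * x" using rr by (simp add: n_def)
    then have "a * (2 * n) = a * (2 * y) + (a * cj a) * x" by (simp add: algebra_simps)
    then have "2 * x = 2 * (a * (y - n))" unfolding aa by (simp add: algebra_simps)
    then have x: "x = a * (y - n)" by simp
    have "cj y - y = a ^ h * (y - n) ^ h"
      using f by (simp add: flag_def curve_def x power_mult_distrib)
    then have y: "y \<in> Yset (a ^ h) n" by (simp add: Yset_def)
    moreover have "a ^ h * of_int (eta (y + cj y - 2 * n)) = \<phi>"
      using ph unfolding Phi_def e x g[OF y] .
    ultimately show "l \<in> ?f ` ?Y" using l e x by blast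
  next
    fix l assume "l \<in> ?f ` ?Y"
    then obtain y where y: "y \<in> Yset (a ^ h) n" "a ^ h * of_int (eta (y + cj y - 2 * n)) = \<phi>" "l = ?f y" by blast
    have "Phi (a * (y - n)) y a = \<phi>" unfolding Phi_def g[OF y(1)] by (rule y(2))
    moreover have "vec4 0 a 1 r = Pv (a * (y - n)) y a"
    proof -
      have "a * cj (a * (y - n)) = (a * cj a) * (cj y - cj n)" by simp
      then have "2 * cj y + a * cj (a * (y - n)) = 2 * cj n" unfolding aa by (simp add: algebra_simps)
      then show ?thesis unfolding Pv_def n2[symmetric] by simp
    qed
    then have "vec.span {vec4 0 a 1 r} \<in> l"
      unfolding y(3) line1_def using span_in_Lin(2)[OF indep2_line1] by simp
    ultimately show "l \<in> ?L" using fl[OF y(1)] y(3) by (auto simp: G1set_def)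
  qed
qed

text \<open>A generator through an affine point (1, 0, y, y^2) of \<open>Omega\<close> meets X0 = 0
  with r = 2y in F_q, so only the point (0,0,0,1) is left. The minus sign in the label is the
  determinant -1 of the parameters 0, 1, 1, 0.\<close>

lemma G2set_through:
  assumes aa: "a * cj a = - 2" and r: "r \<notin> Fq q"
  shows "{l \<in> G2set \<psi>. vec.span {vec4 0 a 1 r} \<in> l} = (if \<psi> = - (a ^ h) then {line2 0 1 1 0 a} else {})"
proof -
  have f0: "flag2 0 1 1 0 a" using aa by (simp add: flag2_def)
  have in0: "vec.span {vec4 0 a 1 r} \<in> line2 0 1 1 0 a"
  proof -
    have *: "vec4 0 a 1 r = r *s Qv 0 1 + 1 *s Rv 0 1 1 0 a"
      by (simp add: Qv_def Rv_def vec4_smult vec4_add)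
    show ?thesis unfolding line2_def by (subst span_in_Lin_iff) (simp, use * in blast)
  qed
  have psi0: "line2 0 1 1 0 a \<in> G2set (- (a ^ h))"
  proof -
    have "(a / (0 * 0 - 1 * 1)) ^ h = - (a ^ h)" using minus_power_h[of a] by simp
    then show ?thesis unfolding G2set_def using f0 by blast
  qed
  have key: "\<psi> = - (a ^ h) \<and> l = line2 0 1 1 0 a"
    if lin: "l \<in> G2set \<psi>" and P: "vec.span {vec4 0 a 1 r} \<in> l" for l
  proof -
    obtain u v s t e where f: "flag2 u v s t e" and d: "u * t - v * s = 1" and e: "e ^ h = \<psi>" and l: "l = line2 u v s t e"
      using G2set_normal[OF lin] by metis
    have F: "u \<in> Fq q" "v \<in> Fq q" using f by (auto simp: flag2_def)
    have gen: "l \<in> generators q" using l line2_generator[OF f] by simp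
    have Ql: "vec.span {Qv u v} \<in> l" unfolding l line2_def using span_in_Lin(1)[OF indep2_line2[OF f]] .
    have u0: "u = 0"
    proof (rule ccontr)
      assume u: "u \<noteq> 0"
      have "Qv u v = u\<^sup>2 *s Av 0 (v / u)" using u by (simp add: Qv_def Av_def vec4_smult power2_eq_square)
      then have "vec.span {Av 0 (v / u)} \<in> l" using Ql u by (simp add: point_span_cancel)
      then have "r / 1 = 2 * cj (v / u) + (a / 1) * cj 0"
        by (intro generator_eq_line1(4)[OF gen _ P]) simp_all
      then show False using r F by (auto simp: Fq_iff)
    qed
    obtain c1 c2 where "vec4 0 a 1 r = c1 *s Qv u v + c2 *s Rv u v s t e"
      using P span_in_Lin_iff[of "vec4 0 a 1 r"] unfolding l line2_def by auto
    then have c: "a = c2 * e" "1 = c2 * (v * s)"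
      by (simp_all add: u0 Qv_def Rv_def vec4_smult vec4_add)
    have "- (v * s) = 1" using d u0 by simp
    then have vs: "v * s = - 1" by (metis minus_minus)
    have "- c2 = 1" using c(2) unfolding vs by simp
    then have c2: "c2 = - 1" by (metis minus_minus)
    then have ea: "e = - a" using c(1) by simp
    then have psi: "\<psi> = - (a ^ h)" using e by (simp add: minus_power_h)
    have "v \<noteq> 0" using vs by auto
    have "l = line2 0 1 1 0 a"
    proof -
      have "Qv u v = v\<^sup>2 *s Qv 0 1" by (simp add: u0 Qv_def vec4_smult)
      then have "vec.span {Qv 0 1} \<in> l" using Ql \<open>v \<noteq> 0\<close> by (simp add: point_span_cancel)
      then obtain e' where e': "e' * cj e' = - 2" "l = line2 0 1 1 0 e'" using generator_at_infinity[OF gen] by metis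
      obtain d1 d2 where "vec4 0 a 1 r = d1 *s Qv 0 1 + d2 *s Rv 0 1 1 0 e'"
        using P span_in_Lin_iff[of "vec4 0 a 1 r"] unfolding e'(2) line2_def by auto
      then have "a = d2 * e'" "1 = d2" by (simp_all add: Qv_def Rv_def vec4_smult vec4_add)
      then have "a = e'" by (metis mult_1)
      then show ?thesis using e' by simp
    qed
    then show ?thesis using psi by blast
  qed
  show ?thesis
  proof (cases "\<psi> = - (a ^ h)")
    case True
    show ?thesis
      unfolding if_P[OF True]
    proof (intro equalityI subsetI)
      fix l assume "l \<in> {l \<in> G2set \<psi>. vec.span {vec4 0 a 1 r} \<in> l}"
      then show "l \<in> {line2 0 1 1 0 a}" using key[of l] by blast
    next
      fix l assume "l \<in> {line2 0 1 1 0 a}"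
      then show "l \<in> {l \<in> G2set \<psi>. vec.span {vec4 0 a 1 r} \<in> l}"
        using psi0 in0 unfolding True by simp
    qed
  next
    case False
    show ?thesis
      unfolding if_not_P[OF False] using key False by blast
  qed
qed

lemma line2_infinity_not_G1set: "a * cj a = - 2 \<Longrightarrow> line2 0 1 1 0 a \<notin> G1set \<phi>"
proof
  assume aa: "a * cj a = - 2" and "line2 0 1 1 0 a \<in> G1set \<phi>"
  then obtain x y e where f: "flag x y e" and l: "line2 0 1 1 0 a = line1 x y e" by (auto simp: G1set_def)
  have f0: "flag2 0 1 1 0 a" using aa by (simp add: flag2_def)
  have "vec.span {Qv 0 1} \<in> line1 x y e" unfolding l[symmetric] line2_def
    using span_in_Lin(1)[OF indep2_line2[OF f0]] .
  then have P: "vec.span {vec4 0 0 0 1} \<in> line1 x y e" by (simp add: Qv_def)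
  have "line1 x y e \<in> generators q" using f line1_generator by (simp add: flag_def)
  from generator_eq_line1(1)[OF this Av_in_line1 P] show False by simp
qed

text \<open>Writing \<open>C\<close> for the sum of \<open>\<eta>\<close> over the generators of the first family through \<open>P\<close>,
  the two \<open>\<Phi>\<close>-classes have sizes \<open>(|Y| + C)/2\<close> and \<open>(|Y| - C)/2\<close>, while the generator through
  \<open>(0,0,0,1)\<close> contributes one line to one of the two classes of the second family.\<close>

lemma condition_B_normal:
  assumes aa: "a * cj a = - 2" and r: "r \<notin> Fq q" and ph: "\<phi>\<^sup>2 = - 2" and ps: "\<psi>\<^sup>2 = - 2"
  shows "condition_B q (G1set \<phi> \<union> G2set \<psi>) (vec.span {vec4 0 a 1 r})
    \<longleftrightarrow> (if \<phi> = \<psi> then cubic_sum = 2 else cubic_sum = - 2)"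
proof -
  define n where "n = cj r / 2"
  define \<epsilon> where "\<epsilon> = a ^ h"
  let ?P = "vec.span {vec4 0 a 1 r}"
  let ?f = "\<lambda>y. line1 (a * (y - n)) y a"
  let ?g = "\<lambda>y. eta (y + cj y - 2 * n)"
  note T1 = G1set_through[OF aa r, folded n_def \<epsilon>_def]
  note T2 = G2set_through[OF aa r, folded \<epsilon>_def]
  have n: "n \<notin> Fq q" by (rule T1)
  have e2: "\<epsilon>\<^sup>2 = - 2" using aa by (simp add: \<epsilon>_def power_h_2)
  have e0: "\<epsilon> \<noteq> 0" using e2 by auto
  have pe: "\<phi> = \<epsilon> \<or> \<phi> = - \<epsilon>" using ph e2 by (metis power2_eq_iff)
  have se: "\<psi> = \<epsilon> \<or> \<psi> = - \<epsilon>" using ps e2 by (metis power2_eq_iff)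
  have ne: "- \<epsilon> \<noteq> \<epsilon>" "\<epsilon> \<noteq> - \<epsilon>" using e0 by (simp_all only: neg_eq_self_iff) auto
  define Y where "Y = Yset \<epsilon> n"
  have g: "?g y = 1 \<or> ?g y = - 1" for y
  proof (rule eta_cases)
    show "y + cj y - 2 * n \<noteq> 0"
    proof
      assume "y + cj y - 2 * n = 0"
      then have "n = (y + cj y) / 2" by (simp add: field_simps)
      moreover have "(y + cj y) / 2 \<in> Fq q" by (simp add: Fq_iff add.commute)
      ultimately show False using n by metis
    qed
  qed
  define p where "p = card {y \<in> Y. ?g y = 1}"
  define k where "k = card {y \<in> Y. ?g y = - 1}"
  have Ysplit: "Y = {y \<in> Y. ?g y = 1} \<union> {y \<in> Y. ?g y = - 1}" using g by blast
  have disj: "{y \<in> Y. ?g y = 1} \<inter> {y \<in> Y. ?g y = - 1} = {}" by auto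
  have cardY: "card Y = p + k"
  proof -
    have "card ({y \<in> Y. ?g y = 1} \<union> {y \<in> Y. ?g y = - 1}) = p + k"
      unfolding p_def k_def by (rule card_Un_disjoint[OF _ _ disj]) simp_all
    then show ?thesis unfolding Ysplit[symmetric] .
  qed
  have "(\<Sum>y\<in>{y \<in> Y. ?g y = 1} \<union> {y \<in> Y. ?g y = - 1}. ?g y)
      = (\<Sum>y\<in>{y \<in> Y. ?g y = 1}. ?g y) + (\<Sum>y\<in>{y \<in> Y. ?g y = - 1}. ?g y)"
    by (rule sum.union_disjoint[OF _ _ disj]) simp_all
  also have "\<dots> = int p - int k" by (simp add: p_def k_def)
  finally have C: "2 * (int p - int k) = cubic_sum"
    using sum_eta_Yset[OF e2 n] unfolding Ysplit[symmetric] unfolding Y_def by (simp only:)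
  have n_gen: "n_gen q ?P = p + k + 1"
  proof -
    have "{l \<in> generators q. ?P \<in> l \<and> l \<inter> Xplus q \<noteq> {}}
        = {l \<in> {l \<in> generators q. l \<inter> Xplus q \<noteq> {}}. ?P \<in> l}"
      by blast
    also have "\<dots> = (\<Union>\<phi>. {l \<in> G1set \<phi>. ?P \<in> l}) \<union> (\<Union>\<psi>. {l \<in> G2set \<psi>. ?P \<in> l})"
      unfolding generators_meeting_Xplus G1_eq G2_eq by blast
    also have "(\<Union>\<phi>. {l \<in> G1set \<phi>. ?P \<in> l}) = ?f ` Y"
      unfolding T1(1) Y_def by blast
    also have "(\<Union>\<psi>. {l \<in> G2set \<psi>. ?P \<in> l}) = {line2 0 1 1 0 a}"
      unfolding T2 by auto
    finally have "n_gen q ?P = card (?f ` Y \<union> {line2 0 1 1 0 a})" by (simp only: n_gen_def)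
    also have "\<dots> = card (?f ` Y) + 1"
    proof -
      have "line2 0 1 1 0 a \<notin> ?f ` Y"
      proof
        assume "line2 0 1 1 0 a \<in> ?f ` Y"
        then have "line2 0 1 1 0 a \<in> (\<Union>\<phi>. {l \<in> G1set \<phi>. ?P \<in> l})"
          unfolding T1(1) Y_def by blast
        then show False using line2_infinity_not_G1set[OF aa] by blast
      qed
      then show ?thesis by simp
    qed
    also have "card (?f ` Y) = p + k" using card_image[OF T1(2)] cardY by (simp add: Y_def)
    finally show ?thesis .
  qed
  have c1: "card {l \<in> G1set \<phi>. ?P \<in> l} = (if \<phi> = \<epsilon> then p else k)"
  proof -
    have "card {l \<in> G1set \<phi>. ?P \<in> l} = card {y \<in> Y. \<epsilon> * of_int (?g y) = \<phi>}"
      unfolding T1(1) Y_def by (rule card_image) (rule inj_on_subset[OF T1(2)], blast)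
    moreover have "\<epsilon> * of_int (?g y) = \<phi> \<longleftrightarrow> ?g y = (if \<phi> = \<epsilon> then 1 else - 1)" for y
    proof (cases "?g y = 1")
      case True
      show ?thesis unfolding True by auto
    next
      case False
      then have g1: "?g y = - 1" using g by blast
      show ?thesis unfolding g1 using pe ne by auto
    qed
    ultimately show ?thesis by (simp add: p_def k_def)
  qed
  have c2: "card {l \<in> G2set \<psi>. ?P \<in> l} = (if \<psi> = \<epsilon> then 0 else 1)"
    unfolding T2 using se ne by auto
  have "{l \<in> G1set \<phi>. ?P \<in> l} \<inter> {l \<in> G2set \<psi>. ?P \<in> l} = {}"
    unfolding T2 using line2_infinity_not_G1set[OF aa] by auto
  then have "card ({l \<in> G1set \<phi>. ?P \<in> l} \<union> {l \<in> G2set \<psi>. ?P \<in> l})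
      = (if \<phi> = \<epsilon> then p else k) + (if \<psi> = \<epsilon> then 0 else 1)"
    by (subst card_Un_disjoint) (simp_all add: c1 c2)
  moreover have "{l \<in> G1set \<phi> \<union> G2set \<psi>. ?P \<in> l} = {l \<in> G1set \<phi>. ?P \<in> l} \<union> {l \<in> G2set \<psi>. ?P \<in> l}"
    by blast
  ultimately have "condition_B q (G1set \<phi> \<union> G2set \<psi>) ?P \<longleftrightarrow>
      2 * ((if \<phi> = \<epsilon> then p else k) + (if \<psi> = \<epsilon> then 0 else 1)) = p + k + 1"
  proof -
    have half: "real i = 1 / 2 * real j \<longleftrightarrow> 2 * i = j" for i j :: nat
      by linarith
    assume "card ({l \<in> G1set \<phi>. ?P \<in> l} \<union> {l \<in> G2set \<psi>. ?P \<in> l})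
        = (if \<phi> = \<epsilon> then p else k) + (if \<psi> = \<epsilon> then 0 else 1)"
      and "{l \<in> G1set \<phi> \<union> G2set \<psi>. ?P \<in> l} = {l \<in> G1set \<phi>. ?P \<in> l} \<union> {l \<in> G2set \<psi>. ?P \<in> l}"
    then show ?thesis unfolding condition_B_def n_gen half by (simp only:)
  qed
  also have "\<dots> \<longleftrightarrow> (if \<phi> = \<psi> then cubic_sum = 2 else cubic_sum = - 2)"
  proof -
    have aux: "2 * ((if A then p else k) + (if B then 0 else 1)) = p + k + 1
        \<longleftrightarrow> (if A = B then cubic_sum = 2 else cubic_sum = - 2)" for A B
      unfolding C[symmetric] by (cases A; cases B) auto
    have eqv: "\<phi> = \<psi> \<longleftrightarrow> (\<phi> = \<epsilon>) = (\<psi> = \<epsilon>)" using pe se by metis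
    show ?thesis unfolding aux eqv ..
  qed
  finally show ?thesis .
qed

end

subsection \<open>The group\<close>

text \<open>As s is an involution, the injective map gives card F(x) <= card F(s x) <= card F(x), so
  the inclusion of finite sets is an equality.\<close>

lemma swap_image_eq:
  fixes F :: "'b::monoid_mult \<Rightarrow> 'c set"
  assumes fin: "\<And>x. finite (F x)" and inj: "\<And>x. inj_on f (F x)"
    and sub: "\<And>x. f ` F x \<subseteq> F (s * x)" and s: "s * s = 1"
  shows "f ` F x = F (s * x)"
proof (rule card_subset_eq[OF fin sub])
  have le: "card (F y) \<le> card (F (s * y))" for y
    using card_mono[OF fin sub[of y]] by (simp add: card_image[OF inj])
  have "s * (s * x) = x" by (metis mult.assoc mult_1 s)
  then have "card (F x) = card (F (s * x))"
    using le[of x] le[of "s * x"] by simp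
  then show "card (f ` F x) = card (F (s * x))" by (simp add: card_image[OF inj])
qed

abbreviation BG :: "(('a::{field,finite} ^ 4) set \<Rightarrow> ('a ^ 4) set) monoid" where
  "BG \<equiv> BijGroup PG3_points"

lemma BG_simps: "carrier BG = Bij PG3_points" "\<one>\<^bsub>BG\<^esub> = (\<lambda>x\<in>PG3_points. x)"
  "f \<in> Bij PG3_points \<Longrightarrow> g \<in> Bij PG3_points \<Longrightarrow> f \<otimes>\<^bsub>BG\<^esub> g = compose PG3_points f g"
  by (simp_all add: BijGroup_def)

lemma image_mult:
  assumes "f \<in> Bij PG3_points" "g \<in> Bij PG3_points" "L \<subseteq> Pow PG3_points"
  shows "(`) (f \<otimes>\<^bsub>BG\<^esub> g) ` L = (`) f ` ((`) g ` L)"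
proof -
  have *: "(f \<otimes>\<^bsub>BG\<^esub> g) ` l = f ` (g ` l)" if "l \<subseteq> PG3_points" for l
    unfolding BG_simps(3)[OF assms(1,2)] image_image using that by (intro image_cong) (auto simp: compose_def)
  have "(`) (f \<otimes>\<^bsub>BG\<^esub> g) ` L = (\<lambda>l. f ` (g ` l)) ` L"
    by (rule image_cong[OF refl], rule *) (use assms(3) in blast)
  then show ?thesis by (simp add: image_image)
qed

lemma image_one:
  assumes "L \<subseteq> Pow PG3_points"
  shows "(`) \<one>\<^bsub>BG\<^esub> ` L = L"
proof -
  have "\<one>\<^bsub>BG\<^esub> ` l = l" if "l \<subseteq> PG3_points" for l
    unfolding BG_simps(2) using that by (auto simp: image_iff subset_iff)
  then have "(`) \<one>\<^bsub>BG\<^esub> ` L = id ` L"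
    using assms by (intro image_cong) auto
  then show ?thesis by simp
qed

lemma Bij_inj_on_lines:
  assumes "g \<in> Bij PG3_points" "L \<subseteq> Pow PG3_points"
  shows "inj_on ((`) g) L"
proof (rule inj_on_image)
  show "inj_on g (\<Union> L)"
    using assms by (auto simp: Bij_def bij_betw_def intro: inj_on_subset)
qed

lemma card_through_image:
  assumes g: "g \<in> Bij PG3_points" and L: "L \<subseteq> Pow PG3_points" and gL: "(`) g ` L = L" and P: "P \<in> PG3_points"
  shows "card {l \<in> L. g P \<in> l} = card {l \<in> L. P \<in> l}"
proof -
  have inj: "inj_on g PG3_points" using g by (auto simp: Bij_def bij_betw_def)
  have "{l \<in> L. g P \<in> l} = (`) g ` {l \<in> L. P \<in> l}"
  proof (intro equalityI subsetI)
    fix l assume l: "l \<in> {l \<in> L. g P \<in> l}"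
    then obtain l' where l': "l' \<in> L" "l = g ` l'" using gL by blast
    then have "P \<in> l'" using l L P inj by (auto simp: inj_on_def)
    then show "l \<in> (`) g ` {l \<in> L. P \<in> l}" using l' by blast
  next
    fix l assume "l \<in> (`) g ` {l \<in> L. P \<in> l}"
    then show "l \<in> {l \<in> L. g P \<in> l}" using gL by blast
  qed
  then show ?thesis
    using card_image[OF inj_on_subset[OF Bij_inj_on_lines[OF g L]], of "{l \<in> L. P \<in> l}"] by simp
qed

context hermitian_field
begin

section \<open>Signs of collineations: bounding the orbits from above\<close>

lemma generators_Pow: "generators q \<subseteq> Pow (PG3_points :: ('a ^ 4) set set)"
  by (auto simp: generators_def PG3_lines_def)

lemma G1set_Pow: "G1set \<phi> \<subseteq> Pow PG3_points" and G2set_Pow: "G2set \<phi> \<subseteq> Pow PG3_points"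
proof -
  have "G1set \<phi> \<subseteq> generators q" "G2set \<phi> \<subseteq> generators q"
    using G1_eq G2_eq by (auto simp: G1_def G2_def)
  then show "G1set \<phi> \<subseteq> Pow PG3_points" "G2set \<phi> \<subseteq> Pow PG3_points"
    using generators_Pow by auto
qed

text \<open>A sign is attached to a collineation through its effect on all labels at once. As a
  relation it passes along words in the generators without a choice of representing matrix.\<close>

definition pres :: "'a \<Rightarrow> (('a ^ 4) set \<Rightarrow> ('a ^ 4) set) \<Rightarrow> bool" where
  "pres s g \<longleftrightarrow> g \<in> Bij PG3_points \<and> s * s = 1
    \<and> (\<forall>\<phi>. (`) g ` G1set \<phi> = G1set (s * \<phi>)) \<and> (\<forall>\<psi>. (`) g ` G2set \<psi> = G2set (s * \<psi>))"

lemma pres_Bij: "pres s g \<Longrightarrow> g \<in> Bij PG3_points"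
  by (simp add: pres_def)

lemma pres_one: "pres 1 \<one>\<^bsub>BG\<^esub>"
  unfolding pres_def image_one[OF G1set_Pow] image_one[OF G2set_Pow]
  by (simp add: BG_simps id_Bij)

lemma pres_mult: "pres s f \<Longrightarrow> pres s' g \<Longrightarrow> pres (s * s') (f \<otimes>\<^bsub>BG\<^esub> g)"
proof -
  assume f: "pres s f" and g: "pres s' g"
  have B: "f \<in> Bij PG3_points" "g \<in> Bij PG3_points" using f g by (auto simp: pres_def)
  have ss: "s * s = 1" "s' * s' = 1" using f g by (auto simp: pres_def)
  have "s * s' * (s * s') = (s * s) * (s' * s')" by (simp only: ac_simps)
  then have "s * s' * (s * s') = 1" unfolding ss by simp
  then show ?thesis
    unfolding pres_def image_mult[OF B G1set_Pow] image_mult[OF B G2set_Pow]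
    using f g B by (simp add: pres_def BG_simps compose_Bij mult.assoc)
qed

lemma pres_inv: "pres s g \<Longrightarrow> pres s (inv\<^bsub>BG\<^esub> g)"
proof -
  assume g: "pres s g"
  interpret BG: group "BG :: (('a ^ 4) set \<Rightarrow> ('a ^ 4) set) monoid" by (rule group_BijGroup)
  have B: "g \<in> Bij PG3_points" using g by (simp add: pres_def)
  then have gc: "g \<in> carrier BG" by (simp add: BG_simps)
  then have Bi: "inv\<^bsub>BG\<^esub> g \<in> Bij PG3_points" using BG.inv_closed BG_simps(1) by blast
  have s: "s * (s * x) = x" for x using g by (metis pres_def mult.assoc mult_1)
  have *: "(`) (inv\<^bsub>BG\<^esub> g) ` ((`) g ` L) = L" if "L \<subseteq> Pow PG3_points" for L
    using image_mult[OF Bi B that] image_one[OF that] BG.l_inv[OF gc] by simp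
  have "(`) (inv\<^bsub>BG\<^esub> g) ` G1set \<phi> = G1set (s * \<phi>)" for \<phi>
  proof -
    have "(`) g ` G1set (s * \<phi>) = G1set (s * (s * \<phi>))" using g unfolding pres_def by blast
    then show ?thesis using *[OF G1set_Pow[of "s * \<phi>"]] unfolding s by (simp only:)
  qed
  moreover have "(`) (inv\<^bsub>BG\<^esub> g) ` G2set \<phi> = G2set (s * \<phi>)" for \<phi>
  proof -
    have "(`) g ` G2set (s * \<phi>) = G2set (s * (s * \<phi>))" using g unfolding pres_def by blast
    then show ?thesis using *[OF G2set_Pow[of "s * \<phi>"]] unfolding s by (simp only:)
  qed
  ultimately show ?thesis using g Bi by (simp add: pres_def)
qed

lemma pres_pow: "pres s g \<Longrightarrow> pres (s ^ n) (g [^]\<^bsub>BG\<^esub> (n::nat))"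
proof (induction n)
  case 0
  then show ?case by (simp add: pres_one)
next
  case (Suc n)
  then have "pres (s ^ n * s) (g [^]\<^bsub>BG\<^esub> n \<otimes>\<^bsub>BG\<^esub> g)" by (intro pres_mult) auto
  then show ?case by (simp add: mult.commute)
qed

lemma pres_admissible:
  assumes adm: "admissible a b c d k"
  shows "pres (of_int (chi (a * d - b * c))) (collineation (mat_S a b c d k))"
proof -
  let ?g = "collineation (mat_S a b c d k)" and ?s = "of_int (chi (a * d - b * c)) :: 'a"
  have B: "?g \<in> Bij PG3_points" using collineation_Bij[OF admissible_invertible[OF adm]] .
  have "a * d - b * c \<noteq> 0" using adm by (simp add: admissible_def)
  then have ss: "?s * ?s = 1" using chi_cases[of "a * d - b * c"] by auto
  have "(`) ?g ` G1set \<phi> = G1set (?s * \<phi>)" for \<phi>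
    by (rule swap_image_eq) (use mat_S_G1set[OF adm] Bij_inj_on_lines[OF B G1set_Pow] ss in auto)
  moreover have "(`) ?g ` G2set \<phi> = G2set (?s * \<phi>)" for \<phi>
    by (rule swap_image_eq) (use mat_S_G2set[OF adm] Bij_inj_on_lines[OF B G2set_Pow] ss in auto)
  ultimately show ?thesis using B ss by (simp add: pres_def)
qed

lemma pres_G_generators:
  fixes \<alpha> \<rho> lam \<sigma> \<mu> :: 'a
  shows "\<alpha> \<in> Fq q \<Longrightarrow> \<exists>s. pres s (collineation (mat_T \<alpha>))"
    and "\<rho> \<in> squares_Fq q \<Longrightarrow> \<rho> \<noteq> 0 \<Longrightarrow> \<exists>s. pres s (collineation (mat_M \<rho>))"
    and "lam ^ ((q + 1) div 2) = 1 \<Longrightarrow> pres 1 (collineation (mat_L lam))"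
    and "\<sigma> ^ ((q + 1) div 2) = - 1 \<Longrightarrow> \<exists>s. pres s (collineation (mat_N \<sigma>))"
    and "\<mu> \<in> Fq q \<Longrightarrow> \<mu> \<notin> squares_Fq q \<Longrightarrow> \<exists>s. pres s (collineation (mat_R \<mu>))"
proof -
  show "\<exists>s. pres s (collineation (mat_T \<alpha>))" if "\<alpha> \<in> Fq q"
    unfolding mat_T_eq by (rule exI, rule pres_admissible) (use that in \<open>simp add: admissible_def\<close>)
  show "\<exists>s. pres s (collineation (mat_M \<rho>))" if rho: "\<rho> \<in> squares_Fq q" "\<rho> \<noteq> 0"
  proof -
    obtain s where s: "s \<in> Fq q" "\<rho> = s\<^sup>2" using rho(1) by (auto simp: squares_Fq_def)
    then have "s \<noteq> 0" using rho(2) by auto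
    then show ?thesis
      unfolding s(2) mat_M_eq[OF \<open>s \<noteq> 0\<close>]
      by (intro exI) (rule pres_admissible, use s in \<open>simp add: admissible_def\<close>)
  qed
  show "pres 1 (collineation (mat_L lam))" if "lam ^ ((q + 1) div 2) = 1"
    using pres_admissible[of 1 0 0 1 lam] that unfolding mat_L_eq by (simp add: admissible_def h_def)
  show "\<exists>s. pres s (collineation (mat_N \<sigma>))" if "\<sigma> ^ ((q + 1) div 2) = - 1"
    unfolding mat_N_eq by (rule exI, rule pres_admissible) (use that in \<open>simp add: admissible_def h_def\<close>)
  show "\<exists>s. pres s (collineation (mat_R \<mu>))" if mu: "\<mu> \<in> Fq q" "\<mu> \<notin> squares_Fq q"
  proof -
    have mu0: "\<mu> \<noteq> 0"
    proof
      assume "\<mu> = 0"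
      then have "\<mu> = 0\<^sup>2" by simp
      then show False using mu(2) Fq_closed(8) unfolding squares_Fq_def by blast
    qed
    have "\<not> (\<exists>s\<in>Fq q. s\<^sup>2 = \<mu>)" using mu(2) unfolding squares_Fq_def by blast
    then have "chi \<mu> = - 1" using chi_eq_1_iff[OF mu(1) mu0] chi_cases[of \<mu>] mu0 by auto
    then have "\<mu> ^ m = - 1" using of_int_chi[OF mu(1)] by simp
    \<comment> \<open>This is the determinant of the matrix with rows (0, 1), (\<mu>, 0), so the
      rescaled R is admissible.\<close>
    then have "\<mu> ^ h = - \<mu>" by (simp add: h_m)
    then have "admissible 0 1 \<mu> 0 \<mu>" using mu mu0 by (simp add: admissible_def)
    moreover have "collineation (mat_S 0 1 \<mu> 0 \<mu>) = collineation (mat_R \<mu>)"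
      using mu0 mat_R_eq[OF mu0] by (rule collineation_smult)
    ultimately show ?thesis using pres_admissible by metis
  qed
qed

lemma group_G_pres:
  assumes "g \<in> group_G q"
  shows "\<exists>s. pres s g"
proof -
  let ?gens = "{collineation (mat_T \<alpha>) | \<alpha>. \<alpha> \<in> (Fq q :: 'a set)}
      \<union> {collineation (mat_M \<rho>) | \<rho>. \<rho> \<in> squares_Fq q \<and> \<rho> \<noteq> 0}
      \<union> L_collineations q
      \<union> {collineation (mat_N \<sigma>) | \<sigma>. \<sigma> ^ ((q + 1) div 2) = - 1}
      \<union> {collineation (mat_R \<mu>) | \<mu>. \<mu> \<in> Fq q \<and> \<mu> \<notin> squares_Fq q}"
  have gen: "\<exists>s. pres s g" if "g \<in> ?gens" for g
    using that
  proof (elim UnE)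
    assume "g \<in> {collineation (mat_T \<alpha>) | \<alpha>. \<alpha> \<in> (Fq q :: 'a set)}"
    then show ?thesis using pres_G_generators(1) by force
  next
    assume "g \<in> {collineation (mat_M \<rho>) | \<rho>. \<rho> \<in> squares_Fq q \<and> \<rho> \<noteq> 0}"
    then show ?thesis using pres_G_generators(2) by force
  next
    assume "g \<in> L_collineations q"
    then show ?thesis using pres_G_generators(3) by (force simp: L_collineations_def)
  next
    assume "g \<in> {collineation (mat_N \<sigma>) | \<sigma>. \<sigma> ^ ((q + 1) div 2) = - 1}"
    then show ?thesis using pres_G_generators(4) by force
  next
    assume "g \<in> {collineation (mat_R \<mu>) | \<mu>. \<mu> \<in> Fq q \<and> \<mu> \<notin> squares_Fq q}"
    then show ?thesis using pres_G_generators(5) by force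
  qed
  have "g \<in> generate BG ?gens" using assms by (simp only: group_G_def)
  then show ?thesis
  proof (induction rule: generate.induct)
    case one
    then show ?case using pres_one by (rule exI)
  next
    case (incl g)
    then show ?case by (rule gen)
  next
    case (inv g)
    obtain s where "pres s g" using gen[OF inv] by (elim exE)
    then show ?case by (intro exI[of _ s] pres_inv)
  next
    case (eng g g')
    then obtain s s' where "pres s g" "pres s' g'" by blast
    then show ?case by (intro exI[of _ "s * s'"] pres_mult)
  qed
qed

text \<open>If g has odd order, then g equals its power with exponent order plus 1. This exponent is
  even, so the sign of g is an even power of a sign. The L collineations have determinant 1.\<close>

lemma group_H_pres:
  assumes "g \<in> group_H q"
  shows "pres 1 g"
proof -
  interpret BG: group "BG :: (('a ^ 4) set \<Rightarrow> ('a ^ 4) set) monoid" by (rule group_BijGroup)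
  have gen: "pres 1 g" if gin: "g \<in> {g \<in> group_G q. \<exists>k. group.ord BG g = CHAR('a) ^ k} \<union> L_collineations q"
    for g :: "('a ^ 4) set \<Rightarrow> ('a ^ 4) set"
  proof (cases "g \<in> L_collineations q")
    case True
    then show ?thesis using pres_G_generators(3) by (auto simp: L_collineations_def)
  next
    case False
    then obtain k where g: "g \<in> group_G q" "group.ord BG g = CHAR('a) ^ k" using gin by blast
    then obtain s where s: "pres s g" using group_G_pres by blast
    then have gc: "g \<in> carrier BG" by (simp add: BG_simps pres_def)
    have "odd (group.ord BG g)" using g(2) odd_CHAR by simp
    then obtain j where j: "group.ord BG g = 2 * j + 1" by (elim oddE)
    have "g [^]\<^bsub>BG\<^esub> (group.ord BG g) = \<one>\<^bsub>BG\<^esub>" using gc by (rule BG.pow_ord_eq_1)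
    then have "g [^]\<^bsub>BG\<^esub> Suc (group.ord BG g) = g"
      using gc BG.nat_pow_Suc[of g] BG.l_one[OF gc] by (simp only:)
    then have "g [^]\<^bsub>BG\<^esub> (2 * (j + 1)) = g"
      unfolding j by simp
    moreover have "s ^ (2 * (j + 1)) = 1"
      unfolding power_mult using s by (simp add: pres_def power2_eq_square)
    ultimately show ?thesis using pres_pow[OF s, of "2 * (j + 1)"] by simp
  qed
  show ?thesis
    using assms unfolding group_H_def
  proof (induction rule: generate.induct)
    case one
    then show ?case by (rule pres_one)
  next
    case (incl g)
    then show ?case by (rule gen)
  next
    case (inv g)
    then show ?case using pres_inv[OF gen] by simp
  next
    case (eng g g')
    then show ?case using pres_mult[of 1 g 1 g'] by simp
  qed
qed

section \<open>Transvections: bounding the orbits from below\<close>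

lemma coll_S_mult:
  assumes "admissible a b c d k" "admissible a' b' c' d' k'"
  shows "collineation (mat_S a b c d k) \<otimes>\<^bsub>BG\<^esub> collineation (mat_S a' b' c' d' k') =
    collineation (mat_S (a * a' + b * c') (a * b' + b * d') (c * a' + d * c') (c * b' + d * d') (k * k'))"
proof -
  have i: "invertible (mat_S a b c d k)" "invertible (mat_S a' b' c' d' k')"
    using assms admissible_invertible by auto
  then show ?thesis
    by (simp add: BG_simps(3)[OF collineation_Bij collineation_Bij] collineation_mult mat_S_mult)
qed

lemma unipotent_pow:
  fixes \<alpha> :: 'a
  assumes "\<alpha> \<in> Fq q"
  shows "collineation (mat_S 1 0 \<alpha> 1 1) [^]\<^bsub>BG\<^esub> (n::nat) = collineation (mat_S 1 0 (of_nat n * \<alpha>) 1 1)"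
    and "collineation (mat_S 1 \<alpha> 0 1 1) [^]\<^bsub>BG\<^esub> (n::nat) = collineation (mat_S 1 (of_nat n * \<alpha>) 0 1 1)"
proof -
  have F: "of_nat k * \<alpha> \<in> Fq q" for k using assms by (simp add: Fq_iff cj_of_nat)
  have adm: "admissible 1 0 (of_nat k * \<alpha>) 1 1" "admissible 1 (of_nat k * \<alpha>) 0 1 1"
    "admissible 1 0 \<alpha> 1 1" "admissible 1 \<alpha> 0 1 1" for k
    using F assms by (simp_all add: admissible_def)
  show "collineation (mat_S 1 0 \<alpha> 1 1) [^]\<^bsub>BG\<^esub> n = collineation (mat_S 1 0 (of_nat n * \<alpha>) 1 1)"
  proof (induction n)
    case 0
    then show ?case by (simp add: BG_simps(2) mat_S_1 collineation_1)
  next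
    case (Suc n)
    then show ?case
      by (simp add: coll_S_mult[OF adm(1) adm(3)] distrib_right add.commute)
  qed
  show "collineation (mat_S 1 \<alpha> 0 1 1) [^]\<^bsub>BG\<^esub> n = collineation (mat_S 1 (of_nat n * \<alpha>) 0 1 1)"
  proof (induction n)
    case 0
    then show ?case by (simp add: BG_simps(2) mat_S_1 collineation_1)
  next
    case (Suc n)
    then show ?case
      by (simp add: coll_S_mult[OF adm(2) adm(4)] distrib_right add.commute)
  qed
qed

lemma ord_prime_power:
  assumes g: "g \<in> Bij (PG3_points :: ('a ^ 4) set set)" "g [^]\<^bsub>BG\<^esub> CHAR('a) = \<one>\<^bsub>BG\<^esub>"
  shows "\<exists>k. group.ord BG g = CHAR('a) ^ k"
proof -
  interpret BG: group "BG :: (('a ^ 4) set \<Rightarrow> ('a ^ 4) set) monoid" by (rule group_BijGroup)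
  have "group.ord BG g dvd CHAR('a)" using g BG.pow_eq_id[of g] by (simp add: BG_simps)
  then have "group.ord BG g = 1 \<or> group.ord BG g = CHAR('a)"
    using prime_CHAR by (simp add: prime_nat_iff)
  then show ?thesis by (metis power_0 power_one_right)
qed

text \<open>The lower transvections are the T collineations; N with \<sigma> = -1, allowed since h
  is odd, is an involution conjugating them to the upper ones. The p-th power of a transvection is
  the identity, so its order is a power of p.\<close>

lemma unipotent_in_H:
  fixes \<alpha> :: 'a
  assumes "\<alpha> \<in> Fq q"
  shows "collineation (mat_S 1 0 \<alpha> 1 1) \<in> group_H q" "collineation (mat_S 1 \<alpha> 0 1 1) \<in> group_H q"
proof -
  have adm: "admissible 1 0 \<alpha> 1 1" "admissible 1 \<alpha> 0 1 1" "admissible 0 1 1 0 (- 1)" "admissible \<alpha> 1 1 0 (- 1)"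
    using assms by (simp_all add: admissible_def neg1_h)
  have T: "collineation (mat_S 1 0 \<alpha> 1 1) \<in> group_G q"
    unfolding group_G_def mat_T_eq[symmetric] 
    by (rule generate.incl, rule UnI1, rule UnI1, rule UnI1, rule UnI1) (use assms in \<open>auto intro!: exI[of _ \<alpha>]\<close>)
  have N: "collineation (mat_S 0 1 1 0 (- 1 :: 'a)) \<in> group_G q"
  proof -
    have "(- 1 :: 'a) ^ ((q + 1) div 2) = - 1" using neg1_h by (simp only: h_def)
    then show ?thesis unfolding group_G_def mat_N_eq[symmetric]
      by (intro generate.incl UnI1[OF UnI2] CollectI exI[of _ "- 1"] conjI) simp_all
  qed
  have "collineation (mat_S 1 \<alpha> 0 1 1) =
      collineation (mat_S 0 1 1 0 (- 1)) \<otimes>\<^bsub>BG\<^esub> collineation (mat_S 1 0 \<alpha> 1 1) \<otimes>\<^bsub>BG\<^esub> collineation (mat_S 0 1 1 0 (- 1))"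
    by (simp add: coll_S_mult[OF adm(3,1)] coll_S_mult[OF adm(4,3)])
  moreover have "collineation (mat_S 0 1 1 0 (- 1)) \<otimes>\<^bsub>BG\<^esub> collineation (mat_S 1 0 \<alpha> 1 1)
      \<otimes>\<^bsub>BG\<^esub> collineation (mat_S 0 1 1 0 (- 1)) \<in> group_G q"
    using T N unfolding group_G_def by (intro generate.eng)
  ultimately have U: "collineation (mat_S 1 \<alpha> 0 1 1) \<in> group_G q"
    by (simp only:)
  have B: "collineation (mat_S 1 0 \<alpha> 1 1) \<in> Bij PG3_points" "collineation (mat_S 1 \<alpha> 0 1 1) \<in> Bij PG3_points"
    by (intro collineation_Bij admissible_invertible adm)+
  have p: "collineation (mat_S 1 0 \<alpha> 1 1) [^]\<^bsub>BG\<^esub> CHAR('a) = \<one>\<^bsub>BG\<^esub>"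
    "collineation (mat_S 1 \<alpha> 0 1 1) [^]\<^bsub>BG\<^esub> CHAR('a) = \<one>\<^bsub>BG\<^esub>"
    unfolding unipotent_pow[OF assms] by (simp_all add: mat_S_1 collineation_1 BG_simps)
  show "collineation (mat_S 1 0 \<alpha> 1 1) \<in> group_H q" "collineation (mat_S 1 \<alpha> 0 1 1) \<in> group_H q"
    unfolding group_H_def
    by (intro generate.incl UnI1 CollectI conjI T U ord_prime_power B p)+
qed

text \<open>SL(2,q) is generated by transvections, and the factor k on X1 is split off as an L
  collineation.\<close>

lemma special_in_H:
  fixes a b c d k :: 'a
  assumes F: "a \<in> Fq q" "b \<in> Fq q" "c \<in> Fq q" "d \<in> Fq q" and det: "a * d - b * c = 1" and k: "k ^ h = 1"
  shows "collineation (mat_S a b c d k) \<in> group_H q"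
proof -
  have mult: "f \<otimes>\<^bsub>BG\<^esub> g \<in> group_H q" if "f \<in> group_H q" "g \<in> group_H q" for f g :: "('a ^ 4) set \<Rightarrow> ('a ^ 4) set"
    using that unfolding group_H_def by (rule generate.eng)
  have L: "collineation (mat_S 1 0 0 1 k) \<in> group_H q"
  proof -
    have "k ^ ((q + 1) div 2) = 1" using k by (simp only: h_def)
    then show ?thesis
      unfolding group_H_def mat_L_eq[symmetric] L_collineations_def
      by (intro generate.incl UnI2 CollectI exI[of _ k] conjI) simp_all
  qed
  have step: "collineation (mat_S a b c d 1) \<in> group_H q"
    if F: "a \<in> Fq q" "b \<in> Fq q" "c \<in> Fq q" "d \<in> Fq q" and det: "a * d - b * c = 1" and b: "b \<noteq> 0" for a b c d :: 'a
  proof -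
    \<comment> \<open>Lower(x) upper(b) lower(y) has diagonal entries 1 + b y and 1 + b x; the
      remaining entry then agrees because the determinant is 1.\<close>
    define x where "x = (d - 1) / b"
    define y where "y = (a - 1) / b"
    have xy: "x \<in> Fq q" "y \<in> Fq q" using F by (auto simp: x_def y_def)
    have bx: "b * x = d - 1" "b * y = a - 1" using b by (simp_all add: x_def y_def)
    have "b * (x + d * y) = b * c"
    proof -
      have "b * (x + d * y) = b * x + d * (b * y)" by (simp add: algebra_simps)
      also have "\<dots> = a * d - 1" unfolding bx by (simp add: algebra_simps)
      also have "\<dots> = b * c" using det by (simp add: algebra_simps)
      finally show ?thesis .
    qed
    then have c: "x + d * y = c" using b by simp
    have bd: "1 + b * y = a" "x * b + 1 = d" using bx by (simp_all add: mult.commute)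
    have "1 * d - b * x = 1" using bx by simp
    then have adm: "admissible 1 0 x 1 1" "admissible 1 b 0 1 1" "admissible 1 0 y 1 1" "admissible 1 b x d 1"
      using xy F by (simp_all add: admissible_def)
    have "collineation (mat_S 1 0 x 1 1) \<otimes>\<^bsub>BG\<^esub> collineation (mat_S 1 b 0 1 1) \<otimes>\<^bsub>BG\<^esub> collineation (mat_S 1 0 y 1 1)
        = collineation (mat_S a b c d 1)"
      by (simp add: coll_S_mult[OF adm(1,2)] bd coll_S_mult[OF adm(4,3)] c)
    then show ?thesis
      using mult[OF mult[OF unipotent_in_H(1)[OF xy(1)] unipotent_in_H(2)[OF F(2)]] unipotent_in_H(1)[OF xy(2)]]
      by (simp only:)
  qed
  have S1: "collineation (mat_S a b c d 1) \<in> group_H q"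
  proof (cases "b = 0")
    case False
    then show ?thesis using step F det by blast
  next
    case True
    then have ad: "a * d = 1" using det by simp
    then have a0: "a \<noteq> 0" by auto
    \<comment> \<open>Multiplying on the right by upper(1) puts the nonzero a into the upper right
      corner; upper(-1) undoes this afterwards.\<close>
    have "a * (c + d) - a * c = 1" using ad by (simp add: algebra_simps)
    then have 1: "collineation (mat_S a a c (c + d) 1) \<in> group_H q"
      using F a0 by (intro step) auto
    have "admissible a a c (c + d) 1" "admissible 1 (- 1) 0 1 1"
      using F \<open>a * (c + d) - a * c = 1\<close> by (simp_all add: admissible_def)
    from coll_S_mult[OF this]
    have "collineation (mat_S a a c (c + d) 1) \<otimes>\<^bsub>BG\<^esub> collineation (mat_S 1 (- 1) 0 1 1) = collineation (mat_S a 0 c d 1)"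
      by simp
    then show ?thesis using mult[OF 1 unipotent_in_H(2)[of "- 1"]] True by simp
  qed
  have "admissible a b c d 1" "admissible 1 0 0 1 k" using F det k by (simp_all add: admissible_def)
  from coll_S_mult[OF this]
  have "collineation (mat_S a b c d 1) \<otimes>\<^bsub>BG\<^esub> collineation (mat_S 1 0 0 1 k) = collineation (mat_S a b c d k)"
    by simp
  then show ?thesis using mult[OF S1 L] by simp
qed

section \<open>The orbits on the two families\<close>

lemma orbit_H: "orbit (BG\<lparr>carrier := group_H q\<rparr>) (\<lambda>g l. g ` l) l = (\<lambda>g. g ` l) ` group_H q"
  by (auto simp: orbit_def)

lemma orbit_G1set:
  assumes "l \<in> G1set \<phi>"
  shows "(\<lambda>g. g ` l) ` group_H q = G1set \<phi>"
proof (intro equalityI subsetI)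
  fix l' assume "l' \<in> (\<lambda>g. g ` l) ` group_H q"
  then obtain g where g: "g \<in> group_H q" "l' = g ` l" by blast
  then have "(`) g ` G1set \<phi> = G1set \<phi>" using group_H_pres by (simp add: pres_def)
  then show "l' \<in> G1set \<phi>" using assms g by blast
next
  fix l' assume "l' \<in> G1set \<phi>"
  then obtain x y e x0 y0 e0 where "flag x y e" "flag x0 y0 e0" "Phi x y e = Phi x0 y0 e0"
    and l: "l = line1 x y e" "l' = line1 x0 y0 e0"
    using assms by (auto simp: G1set_def)
  then show "l' \<in> (\<lambda>g. g ` l) ` group_H q"
    using flags_connected[of x y e x0 y0 e0] special_in_H by (metis imageI)
qed

lemma orbit_G2set:
  assumes "l \<in> G2set \<psi>"
  shows "(\<lambda>g. g ` l) ` group_H q = G2set \<psi>"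
proof (intro equalityI subsetI)
  fix l' assume "l' \<in> (\<lambda>g. g ` l) ` group_H q"
  then obtain g where g: "g \<in> group_H q" "l' = g ` l" by blast
  then have "(`) g ` G2set \<psi> = G2set \<psi>" using group_H_pres by (simp add: pres_def)
  then show "l' \<in> G2set \<psi>" using assms g by blast
next
  fix l' assume "l' \<in> G2set \<psi>"
  then show "l' \<in> (\<lambda>g. g ` l) ` group_H q"
    using flags2_connected[OF assms] special_in_H by (metis imageI)
qed

lemma H_orbits_G1: "H_orbits q (G1 q) = {G1set \<phi> | \<phi>. G1set \<phi> \<noteq> {}}"
proof -
  have "H_orbits q (G1 q) = {(\<lambda>g. g ` l) ` group_H q | l. \<exists>\<phi>. l \<in> G1set \<phi>}"
    unfolding H_orbits_def orbits_def orbit_H G1_eq by simp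
  also have "\<dots> = {G1set \<phi> | \<phi>. G1set \<phi> \<noteq> {}}"
    using orbit_G1set by blast
  finally show ?thesis .
qed

lemma H_orbits_G2: "H_orbits q (G2 q) = {G2set \<psi> | \<psi>. G2set \<psi> \<noteq> {}}"
proof -
  have "H_orbits q (G2 q) = {(\<lambda>g. g ` l) ` group_H q | l. \<exists>\<phi>. l \<in> G2set \<phi>}"
    unfolding H_orbits_def orbits_def orbit_H G2_eq by simp
  also have "\<dots> = {G2set \<phi> | \<phi>. G2set \<phi> \<noteq> {}}"
    using orbit_G2set by blast
  finally show ?thesis .
qed

end

subsection \<open>Reduction of Case (III)\<close>

context hermitian_field
begin

lemma n_gen_eq: "n_gen q P = card {l \<in> G1 q \<union> G2 q. P \<in> l}" for P :: "('a ^ 4) set"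
proof -
  have "{l \<in> generators q. P \<in> l \<and> l \<inter> Xplus q \<noteq> {}} = {l \<in> {l \<in> generators q. l \<inter> Xplus q \<noteq> {}}. P \<in> l}"
    by blast
  then show ?thesis unfolding n_gen_def generators_meeting_Xplus by (simp only:)
qed

lemma condition_B_image:
  assumes g: "g \<in> group_H q" and P: "P \<in> PG3_points"
  shows "condition_B q (G1set \<phi> \<union> G2set \<psi>) (g P) \<longleftrightarrow> condition_B q (G1set \<phi> \<union> G2set \<psi>) P"
proof -
  have pr: "pres 1 g" using g by (rule group_H_pres)
  have B: "g \<in> Bij PG3_points" using pr by (rule pres_Bij)
  have i: "(`) g ` G1set x = G1set x" "(`) g ` G2set x = G2set x" for x
    using pr by (simp_all add: pres_def)
  have "(`) g ` (G1set \<phi> \<union> G2set \<psi>) = G1set \<phi> \<union> G2set \<psi>"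
    unfolding image_Un i ..
  moreover have "G1set \<phi> \<union> G2set \<psi> \<subseteq> Pow PG3_points" using G1set_Pow G2set_Pow by (rule Un_least)
  moreover have "(`) g ` (G1 q \<union> G2 q) = (G1 q \<union> G2 q :: ('a ^ 4) set set set)"
    unfolding G1_eq G2_eq image_Un image_UN i ..
  moreover have "G1 q \<union> G2 q \<subseteq> Pow (PG3_points :: ('a ^ 4) set set)"
    unfolding G1_eq G2_eq by (intro Un_least UN_least G1set_Pow G2set_Pow)
  ultimately show ?thesis
    unfolding condition_B_def n_gen_eq by (simp only: card_through_image[OF B _ _ P])
qed

lemma proj_pi_span: "proj_pi (vec.span {vec4 p0 p1 p2 p3}) = vec.span {vec4 p0 0 p2 (p3::'a)}"
  unfolding proj_pi_def vec.span_singleton image_image by (simp add: vec4_smult)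

lemma span_in_conic: "v \<noteq> 0 \<Longrightarrow> vec.span {v} \<in> conic \<longleftrightarrow> v $ 1 = 0 \<and> v $ 0 * v $ 3 = (v $ 2)\<^sup>2" for v :: "'a ^ 4"
  unfolding conic_def
  by (auto simp: span_in_pi_plane mem_span_1 power2_eq_square intro: vec.span_base)

lemma PG2q_pointI:
  "a \<in> Fq q \<Longrightarrow> b \<in> Fq q \<Longrightarrow> c \<in> Fq q \<Longrightarrow> (a, b, c) \<noteq> (0, 0, 0) \<Longrightarrow> vec.span {vec4 a 0 b (c::'a)} \<in> PG2q_points q"
  unfolding PG2q_points_def pt_span by blast

text \<open>Shows that Case (III) is not vacuous and provides the point at which condition (B) is
  tested. The relevant tangent is X0 = X1 = 0, touching the conic at (0,0,0,1).\<close>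

lemma case_III_at_infinity:
  assumes aa: "a * cj a = - 2" and r: "r \<notin> Fq q"
  shows "case_III q (vec.span {vec4 0 a 1 r})"
proof -
  let ?P = "vec.span {vec4 0 a 1 r}"
  let ?l = "Lin (vec4 0 0 1 0) (vec4 0 0 0 (1::'a))"
  have ind: "indep2 (vec4 0 0 1 0) (vec4 0 0 0 (1::'a))"
    by (auto simp: indep2_def vec4_smult)
  have U: "?P \<in> U3 q" by (subst U3_iff) (simp_all add: hf_vec4 aa)
  have pr: "proj_pi ?P = vec.span {vec4 0 0 1 r}" by (rule proj_pi_span)
  have "proj_pi ?P \<notin> PG2q_points q"
  proof
    assume "proj_pi ?P \<in> PG2q_points q"
    then obtain x y z where F: "x \<in> Fq q" "y \<in> Fq q" "z \<in> Fq q" and eq: "vec.span {vec4 0 0 1 r} = vec.span {vec4 x 0 y z}"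
      unfolding pr PG2q_points_def pt_span by blast
    have "vec4 0 0 1 r \<noteq> 0" by simp
    then obtain k where "k \<noteq> 0" "vec4 0 0 1 r = k *s vec4 x 0 y z" using eq span_eq_iff by blast
    then have k: "1 = k * y" "r = k * z" by (simp_all add: vec4_smult)
    have "r = z / y" using k by (metis mult.commute mult_1 mult_zero_right nonzero_eq_divide_eq zero_neq_one mult.assoc)
    then show False using F r by auto
  qed
  moreover have "?l \<in> PG2q_lines q"
    unfolding PG2q_lines_def
  proof (intro CollectI conjI bexI)
    show "?l \<in> PG3_lines" by (rule Lin_in_lines[OF ind])
    show "vec.span {vec4 0 0 1 0} \<noteq> vec.span {vec4 0 0 0 (1::'a)}" using ind by (simp add: indep2_span)
    show "vec.span {vec4 0 0 1 0} \<in> ?l" "vec.span {vec4 0 0 0 1} \<in> ?l" using span_in_Lin[OF ind] by auto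
    show "vec.span {vec4 0 0 (1::'a) 0} \<in> PG2q_points q" by (rule PG2q_pointI) simp_all
    show "vec.span {vec4 0 0 0 (1::'a)} \<in> PG2q_points q" by (rule PG2q_pointI) simp_all
  qed
  moreover have "proj_pi ?P \<in> ?l"
    unfolding pr by (subst span_in_Lin_iff) (auto simp: vec4_smult vec4_add)
  moreover have "vec.span {vec4 0 0 0 1} \<in> (Omega q :: ('a ^ 4) set set)"
    using q_ge_5 by (simp add: Omega_explicit pt_span)
  moreover have "tangent_at ?l (vec.span {vec4 0 0 0 1})"
    unfolding tangent_at_def
  proof (intro equalityI subsetI)
    fix Q assume Q: "Q \<in> ?l \<inter> conic"
    then obtain w where w: "w \<noteq> 0" "Q = vec.span {w}" by (auto simp: Lin_def elim: point_cases)
    obtain s t where st: "w = s *s vec4 0 0 1 0 + t *s vec4 0 0 0 1"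
      using Q w span_in_Lin_iff by blast
    have "w $ 0 * w $ 3 = (w $ 2)\<^sup>2" using Q w span_in_conic by blast
    then have "s = 0" unfolding st by (simp add: vec4_smult vec4_add)
    then have wt: "w = t *s vec4 0 0 0 1" unfolding st by simp
    then have "t \<noteq> 0" using w by auto
    then show "Q \<in> {vec.span {vec4 0 0 0 1}}" unfolding w(2) wt by (simp add: point_span_cancel)
  next
    fix Q :: "('a ^ 4) set" assume "Q \<in> {vec.span {vec4 0 0 0 1}}"
    then have Q: "Q = vec.span {vec4 0 0 0 1}" by simp
    have "Q \<in> conic" unfolding Q by (subst span_in_conic) simp_all
    then show "Q \<in> ?l \<inter> conic" using span_in_Lin(2)[OF ind] Q by simp
  qed
  ultimately show ?thesis unfolding case_III_def using U by blast
qed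

text \<open>A matrix of determinant 1 over F_q moves the point of tangency to (0,0,0,1), hence the
  tangent to X0 = 0. Isotropy then forces X2 to be nonzero, so it can be scaled to 1.\<close>

lemma case_III_reduce:
  assumes "case_III q P"
  obtains g a r where "g \<in> group_H q" "P \<in> PG3_points" "a * cj a = - 2" "r \<notin> Fq q"
    "g P = vec.span {vec4 0 a 1 r}"
proof -
  obtain l R where U: "P \<in> U3 q" and np: "proj_pi P \<notin> PG2q_points q" and lq: "l \<in> PG2q_lines q"
    and pl: "proj_pi P \<in> l" and RO: "R \<in> Omega q" and tan: "l \<inter> conic = {R}"
    using assms unfolding case_III_def tangent_at_def by blast
  have Pp: "P \<in> PG3_points" using U by (simp add: U3_def)
  then obtain p where p: "p \<noteq> 0" "P = vec.span {p}" by (rule point_cases)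
  obtain p0 p1 p2 p3 where p4: "p = vec4 p0 p1 p2 p3" by (rule vec4_cases)
  define pp where "pp = vec4 p0 0 p2 p3"
  have pr: "proj_pi P = vec.span {pp}" unfolding p(2) p4 pp_def by (rule proj_pi_span)
  have l: "l \<in> PG3_lines" using lq by (simp add: PG2q_lines_def)
  obtain u v where uv: "u \<in> Fq q" "v \<in> Fq q" "(u, v) \<noteq> (0, 0)" "R = vec.span {Qv u v}"
    using RO unfolding Omega_eq by blast
  have "vec.span {pp} \<in> PG3_points" using pl l unfolding pr PG3_lines_def by blast
  then have pp0: "pp \<noteq> 0" using point_nonempty by (metis mem_span_1 vec.scale_zero_right)
  have Q0: "Qv u v \<noteq> 0" using uv(3) by (auto simp: Qv_def)
  have "R \<in> PG2q_points q"
    unfolding uv(4) Qv_def by (rule PG2q_pointI) (use uv in auto)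
  then have "vec.span {Qv u v} \<noteq> vec.span {pp}" using np pr uv(4) by auto
  then have ind: "indep2 (Qv u v) pp" using pp0 Q0 by (simp add: indep2_span)
  have Rl: "vec.span {Qv u v} \<in> l" using tan uv(4) by blast
  have lL: "l = Lin (Qv u v) pp" using line_eq_Lin[OF l ind Rl] pl pr by simp
  \<comment> \<open>The equation of the tangent at (u^2, uv, v^2), evaluated at the projection of
    P.\<close>
  define \<tau> where "\<tau> = v\<^sup>2 * p0 - 2 * (u * v) * p2 + u\<^sup>2 * p3"
  have tau: "\<tau> = 0"
  proof (rule ccontr)
    assume t0: "\<tau> \<noteq> 0"
    \<comment> \<open>On s Qv + pp the conic equation is linear in s, because Qv lies on the conic.
      A nonzero \<tau> would thus give a second intersection.\<close>
    define s where "s = - (p0 * p3 - p2\<^sup>2) / \<tau>"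
    define w where "w = s *s Qv u v + 1 *s pp"
    have w0: "w \<noteq> 0"
    proof
      assume "w = 0"
      then have "pp = (- s) *s Qv u v" by (simp add: w_def add_eq_0_iff)
      then show False using ind unfolding indep2_def by blast
    qed
    have "s * \<tau> = - (p0 * p3 - p2\<^sup>2)" using t0 by (simp add: s_def)
    moreover have "w $ 0 * w $ 3 - (w $ 2)\<^sup>2 = (p0 * p3 - p2\<^sup>2) + s * \<tau>"
      by (simp add: w_def Qv_def pp_def vec4_smult vec4_add \<tau>_def) (simp add: power2_eq_square algebra_simps)
    moreover have "w $ 1 = 0" by (simp add: w_def Qv_def pp_def)
    ultimately have "vec.span {w} \<in> conic" using span_in_conic[OF w0] by simp
    moreover have "vec.span {w} \<in> l" unfolding lL using span_in_Lin_iff[OF w0] w_def by blast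
    ultimately have "vec.span {w} = vec.span {Qv u v}" using tan uv(4) by blast
    then obtain k where "w = k *s Qv u v" using span_eq_iff[OF w0] by blast
    then have "pp = (k - s) *s Qv u v" unfolding w_def by (simp add: vec.scale_left_diff_distrib algebra_simps)
    then show False using ind unfolding indep2_def by blast
  qed
  obtain c d where cd: "c \<in> Fq q" "d \<in> Fq q" "v * d + u * c = 1"
  proof (cases "u = 0")
    case True
    then have "v \<noteq> 0" using uv by simp
    then show ?thesis using that[of 0 "1 / v"] uv by auto
  next
    case False
    then show ?thesis using that[of "1 / u" 0] uv by auto
  qed
  have det: "v * d - (- u) * c = 1" using cd by simp
  let ?S = "mat_S v (- u) c d 1"
  have F: "v \<in> Fq q" "- u \<in> Fq q" using uv by auto
  have gH: "collineation ?S \<in> group_H q" by (rule special_in_H[OF F cd(1,2) det]) simp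
  have adm: "admissible v (- u) c d 1" using F cd(1,2) det by (simp add: admissible_def)
  have inv: "invertible ?S" using adm by (rule admissible_invertible)
  define x2 where "x2 = v * c * p0 + (v * d - u * c) * p2 - u * d * p3"
  define x3 where "x3 = c\<^sup>2 * p0 + 2 * c * d * p2 + d\<^sup>2 * p3"
  have "v\<^sup>2 * p0 + 2 * v * - u * p2 + (- u)\<^sup>2 * p3 = 0"
    using tau by (simp add: \<tau>_def algebra_simps)
  then have Sp: "?S *v p = vec4 0 p1 x2 x3" and Spp: "?S *v pp = vec4 0 0 x2 x3"
    unfolding p4 pp_def mat_S_mult_vec x2_def x3_def by (simp_all add: algebra_simps)
  have SQ: "?S *v Qv u v = Qv 0 1"
  proof -
    have "?S *v Qv u v = Qv (v * u + - u * v) (c * u + d * v)"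
      unfolding Qv_def mat_S_mult_vec vec4_eq_iff by (simp add: power2_eq_square algebra_simps)
    also have "v * u + - u * v = 0" by simp
    also have "c * u + d * v = 1" using cd(3) by (simp add: algebra_simps)
    finally show ?thesis .
  qed
  have "hf p p = 0" using U p U3_iff by blast
  then have "hf (?S *v p) (?S *v p) = 0" using hf_mat_S[OF adm] by simp
  then have nn: "p1 * cj p1 = - 2 * (x2 * cj x2)"
    unfolding Sp by (simp add: hf_vec4 eq_neg_iff_add_eq_0 mult.assoc)
  have x20: "x2 \<noteq> 0"
  proof
    assume "x2 = 0"
    then have "?S *v pp = x3 *s (?S *v Qv u v)" unfolding Spp SQ by (simp add: Qv_def vec4_smult)
    then show False using indep2_matrix[OF inv ind] by (simp add: indep2_def)
  qed
  define a where "a = p1 / x2"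
  define r where "r = x3 / x2"
  have aa: "a * cj a = - 2" using nn x20 by (simp add: a_def)
  have "vec4 0 p1 x2 x3 = x2 *s vec4 0 a 1 r" using x20 by (simp add: vec4_smult a_def r_def)
  then have gP: "collineation ?S P = vec.span {vec4 0 a 1 r}"
    unfolding p(2) collineation_span[OF p(1)] Sp using x20 by (simp add: point_span_cancel)
  have rF: "r \<notin> Fq q"
  proof
    \<comment> \<open>Otherwise the inverse matrix, also over F_q, would carry (0, 1, r) back to a
      point of PG(2,q), namely the projection of P.\<close>
    assume r: "r \<in> Fq q"
    let ?S' = "mat_S (d / 1) (- (- u) / 1) (- c / 1) (v / 1) (1 / 1)"
    define y0 where "y0 = 2 * d * u + u\<^sup>2 * r"
    define y2 where "y2 = d * v - u * c + u * v * r"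
    define y3 where "y3 = v\<^sup>2 * r - 2 * c * v"
    have "pp = (?S' ** ?S) *v pp"
      unfolding mat_S_inverse(2)[OF det one_neq_zero one_neq_zero] by simp
    also have "\<dots> = ?S' *v vec4 0 0 x2 x3" by (simp add: Spp flip: matrix_vector_mul_assoc)
    also have "vec4 0 0 x2 x3 = x2 *s vec4 0 0 1 r" using x20 by (simp add: vec4_smult r_def)
    also have "?S' *v (x2 *s vec4 0 0 1 r) = x2 *s vec4 y0 0 y2 y3"
      unfolding vec4_smult mat_S_mult_vec vec4_eq_iff y0_def y2_def y3_def
      by (simp add: algebra_simps)
    finally have e: "pp = x2 *s vec4 y0 0 y2 y3" .
    have "(y0, y2, y3) \<noteq> (0, 0, 0)" using pp0 unfolding e by (auto simp: vec4_smult)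
    then have "vec.span {vec4 y0 0 y2 y3} \<in> PG2q_points q"
      by (intro PG2q_pointI) (use uv cd r in \<open>auto simp: y0_def y2_def y3_def\<close>)
    then show False using np unfolding pr e point_span_cancel[OF x20] by simp
  qed
  show ?thesis by (rule that[OF gH Pp aa rF gP])
qed

section \<open>Nonempty labels and the equivalence\<close>

lemma ex_neg2_root: "\<exists>w::'a. w\<^sup>2 = - 2"
proof -
  obtain s where s: "(2::'a) = s\<^sup>2" using two_square unfolding squares_Fq_def by blast
  obtain i :: 'a where i: "i\<^sup>2 = - 1" using chi_eq_1_iff[of "- 1"] chi_minus_1 by auto
  have "(i * s)\<^sup>2 = - 2" unfolding power_mult_distrib i s[symmetric] by simp
  then show ?thesis by blast
qed

lemma ex_power_h_neg2: "w\<^sup>2 = - 2 \<Longrightarrow> \<exists>e. e ^ h = w \<and> e * cj e = - 2"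
proof -
  assume w: "w\<^sup>2 = - 2"
  have "cj (w\<^sup>2) = w\<^sup>2" unfolding w by simp
  then obtain e where e: "e ^ h = w" using ex_power_h by blast
  then show ?thesis using w power_h_2[of e] by auto
qed

lemma G2set_nonempty: "\<psi>\<^sup>2 = - 2 \<Longrightarrow> G2set \<psi> \<noteq> {}"
proof -
  assume "\<psi>\<^sup>2 = - 2"
  then obtain e where e: "e ^ h = \<psi>" "e * cj e = - 2" using ex_power_h_neg2 by blast
  have "flag2 1 0 0 1 e" using e by (simp add: flag2_def)
  moreover have "(e / (1 * 1 - 0 * 0)) ^ h = \<psi>" using e by simp
  ultimately have "line2 1 0 0 1 e \<in> G2set \<psi>" unfolding G2set_def by blast
  then show ?thesis by blast
qed

lemma G1set_ex_nonempty: "\<exists>\<phi>. G1set \<phi> \<noteq> {}"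
proof -
  obtain w :: 'a where w: "w\<^sup>2 = - 2" using ex_neg2_root by blast
  obtain e where e: "e * cj e = - 2" using ex_power_h_neg2[OF w] by blast
  obtain y :: 'a where y: "y \<notin> Fq q" using ex_nonrational by blast
  have "cj ((cj y - y)\<^sup>2) = (cj y - y)\<^sup>2" by (simp add: power2_commute)
  then obtain x where x: "x ^ h = cj y - y" using ex_power_h by blast
  moreover have "x \<noteq> 0" using x y h_pos by (auto simp: Fq_iff power_0_left)
  ultimately have "flag x y e" using e by (simp add: flag_def curve_def)
  then have "line1 x y e \<in> G1set (Phi x y e)" unfolding G1set_def by blast
  then show ?thesis by blast
qed

lemma G1set_value: "G1set \<phi> \<noteq> {} \<Longrightarrow> \<phi>\<^sup>2 = - 2"
proof -
  assume "G1set \<phi> \<noteq> {}"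
  then obtain x y e where f: "flag x y e" and ph: "Phi x y e = \<phi>" unfolding G1set_def by blast
  have "eta (cj y - y - cj e * x) = 1 \<or> eta (cj y - y - cj e * x) = - 1"
    using flag_g_neq_0(1)[OF f] by (rule eta_cases)
  moreover have "(e ^ h)\<^sup>2 = - 2" using f flag_power_h(2) by (simp add: flag_def)
  ultimately show ?thesis unfolding ph[symmetric] Phi_def by (auto simp: power_mult_distrib)
qed

lemma G2set_value: "G2set \<psi> \<noteq> {} \<Longrightarrow> \<psi>\<^sup>2 = - 2"
proof -
  assume "G2set \<psi> \<noteq> {}"
  then obtain l where "l \<in> G2set \<psi>" by blast
  then obtain u v s t e where f: "flag2 u v s t e" and d: "u * t - v * s = 1" and e: "e ^ h = \<psi>"
    using G2set_normal by metis
  have "e * cj e = - 2" using f unfolding flag2_def d by simp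
  then show ?thesis unfolding e[symmetric] power_h_2 .
qed

theorem condition_B_iff:
  "(\<exists>M1 \<in> H_orbits q (G1 q :: ('a ^ 4) set set set). \<exists>M2 \<in> H_orbits q (G2 q).
      \<forall>P. case_III q P \<longrightarrow> condition_B q (M1 \<union> M2) P)
   \<longleftrightarrow> N_E TYPE('a) q = q - 1 \<or> N_E TYPE('a) q = q + 3"
proof -
  have "(\<exists>M1 \<in> H_orbits q (G1 q :: ('a ^ 4) set set set). \<exists>M2 \<in> H_orbits q (G2 q).
      \<forall>P. case_III q P \<longrightarrow> condition_B q (M1 \<union> M2) P) \<longleftrightarrow> cubic_sum = 2 \<or> cubic_sum = - 2"
  proof
    assume "\<exists>M1 \<in> H_orbits q (G1 q :: ('a ^ 4) set set set). \<exists>M2 \<in> H_orbits q (G2 q).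
      \<forall>P. case_III q P \<longrightarrow> condition_B q (M1 \<union> M2) P"
    then obtain \<phi> \<psi> where ne: "G1set \<phi> \<noteq> {}" "G2set \<psi> \<noteq> {}"
      and B: "\<And>P. case_III q P \<Longrightarrow> condition_B q (G1set \<phi> \<union> G2set \<psi>) P"
      unfolding H_orbits_G1 H_orbits_G2 by blast
    obtain w :: 'a where w: "w\<^sup>2 = - 2" using ex_neg2_root by blast
    obtain a where aa: "a * cj a = - 2" using ex_power_h_neg2[OF w] by blast
    obtain r :: 'a where r: "r \<notin> Fq q" using ex_nonrational by blast
    show "cubic_sum = 2 \<or> cubic_sum = - 2"
      using B[OF case_III_at_infinity[OF aa r]]
      unfolding condition_B_normal[OF aa r G1set_value[OF ne(1)] G2set_value[OF ne(2)]]
      by (simp split: if_splits)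
  next
    assume c: "cubic_sum = 2 \<or> cubic_sum = - 2"
    obtain \<phi> where ne: "G1set \<phi> \<noteq> {}" using G1set_ex_nonempty by blast
    have ph: "\<phi>\<^sup>2 = - 2" by (rule G1set_value[OF ne])
    then have "\<phi> \<noteq> 0" by auto
    then have neg: "\<phi> \<noteq> - \<phi>" by (simp only: neg_eq_self_iff) simp
    \<comment> \<open>Only one label of the first family has been shown to occur, while both occur
      in the second; so the relative sign is adjusted in the second.\<close>
    define \<psi> where "\<psi> = (if cubic_sum = 2 then \<phi> else - \<phi>)"
    have ps: "\<psi>\<^sup>2 = - 2" using ph by (simp add: \<psi>_def)
    have "condition_B q (G1set \<phi> \<union> G2set \<psi>) P" if III: "case_III q P" for P
    proof -
      obtain g a r where g: "g \<in> group_H q" and P: "P \<in> PG3_points" and aa: "a * cj a = - 2"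
        and r: "r \<notin> Fq q" and gP: "g P = vec.span {vec4 0 a 1 r}"
        using case_III_reduce[OF III] by blast
      have "condition_B q (G1set \<phi> \<union> G2set \<psi>) (g P)"
        unfolding gP condition_B_normal[OF aa r ph ps] using c neg by (auto simp: \<psi>_def)
      then show ?thesis unfolding condition_B_image[OF g P] .
    qed
    moreover have "G1set \<phi> \<in> H_orbits q (G1 q)" "G2set \<psi> \<in> H_orbits q (G2 q)"
      unfolding H_orbits_G1 H_orbits_G2 using ne G2set_nonempty[OF ps] by blast+
    ultimately show "\<exists>M1 \<in> H_orbits q (G1 q :: ('a ^ 4) set set set). \<exists>M2 \<in> H_orbits q (G2 q).
      \<forall>P. case_III q P \<longrightarrow> condition_B q (M1 \<union> M2) P" by blast
  qed
  also have "\<dots> \<longleftrightarrow> N_E TYPE('a) q = q - 1 \<or> N_E TYPE('a) q = q + 3"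
    using N_E_eq q_ge_5 by auto
  finally show ?thesis .
qed

end

theorem theorem7p1:
  fixes q :: nat
  assumes "primepow q"
    and "q mod 4 = 1"
    and "CARD('a::{field,finite}) = q\<^sup>2"
    and "(2 :: 'a) \<in> squares_Fq q"
  shows "(\<exists>M1 \<in> H_orbits q (G1 q :: ('a ^ 4) set set set). \<exists>M2 \<in> H_orbits q (G2 q).
            \<forall>P. case_III q P \<longrightarrow> condition_B q (M1 \<union> M2) P)
         \<longleftrightarrow> N_E TYPE('a) q = q - 1 \<or> N_E TYPE('a) q = q + 3"
proof -
  interpret hermitian_field q "TYPE('a)"
    using assms by unfold_locales
  show ?thesis by (rule condition_B_iff)
qed

end
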